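(* There is a deterministic algorithm which, given as input (by their multiplication tables) two finite groups $G_1$ and $G_2$ such that $G_1$ belongs to the class $\mathrm{Coprime}(\mathrm{Ab},\mathrm{Cyc})$, runs in time polynomial in $|G_1|+|G_2|$ and decides whether there exists a surjective group homomorphism $G_1\to G_2$. Moreover, if such a surjective homomorphism exists, the algorithm computes one.
   Context: All groups are finite and given by their multiplication (Cayley) tables; running time is measured as a function of the orders of the groups. For classes of finite groups $X$ and $Y$, $\mathrm{Coprime}(X,Y)$ denotes the class of finite groups $G$ having a normal subgroup $N\in X$ and a complement $H\in Y$ of $N$ in $G$ (i.e. $G=NH$, $N\cap H=1$) such that $\gcd(|N|,|H|)=1$. $\mathrm{Ab}$ is the class of Abelian groups and $\mathrm{Cyc}$ is the class of cyclic groups. An epimorphism of groups is a surjective homomorphism. *)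

theory Defs
  imports "HOL-Algebra.Elementary_Groups"
begin

section \<open>Classes of finite groups\<close>

definition Ab :: "('a, 'b) monoid_scheme set" where
  "Ab = {G. comm_group G \<and> finite (carrier G)}"

definition Cyc :: "('a, 'b) monoid_scheme set" where
  "Cyc = {G. group G \<and> finite (carrier G) \<and> cyclic_group G}"

definition Coprime ::
  "('a, 'b) monoid_scheme set \<Rightarrow> ('a, 'b) monoid_scheme set \<Rightarrow> ('a, 'b) monoid_scheme set" where
  "Coprime X Y = {G. group G \<and> finite (carrier G) \<and>
     (\<exists>N H. N \<lhd> G \<and> G\<lparr>carrier := N\<rparr> \<in> X \<and>
            subgroup H G \<and> G\<lparr>carrier := H\<rparr> \<in> Y \<and>
            N <#>\<^bsub>G\<^esub> H = carrier G \<and> N \<inter> H = {\<one>\<^bsub>G\<^esub>} \<and>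
            gcd (card N) (card H) = 1)}"

section \<open>Deterministic algorithms\<close>

text \<open>
  Algorithms are while-programs over a random access memory, with registers and
  two-dimensional arrays of natural numbers, under the uniform cost measure: every elementary
  command and every evaluation of a branching condition costs one unit. A program is a fixed
  finite object, so a unit step comprises a bounded number of arithmetic operations and memory
  accesses. The only arithmetic operations are addition and truncated subtraction;
  multiplication is deliberately absent. Hence the bit length of the numbers in memory grows by
  at most an additive constant per step, and polynomial time in this model coincides with
  polynomial time on Turing machines.
\<close>

type_synonym vname = string

record state =
  vars :: "vname \<Rightarrow> nat"
  arrs :: "vname \<Rightarrow> nat \<Rightarrow> nat \<Rightarrow> nat"

datatype aexp =
    Num nat
  | Var vname
  | Elem vname aexp aexp
  | Add aexp aexp
  | Sub aexp aexp

datatype bexp =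
    Less aexp aexp
  | Neg bexp
  | Conj bexp bexp

datatype com =
    Skip
  | Assign vname aexp
  | Store vname aexp aexp aexp
  | Seq com com
  | Branch bexp com com
  | While bexp com

primrec aval :: "aexp \<Rightarrow> state \<Rightarrow> nat" where
  "aval (Num n) s = n"
| "aval (Var x) s = vars s x"
| "aval (Elem a e1 e2) s = arrs s a (aval e1 s) (aval e2 s)"
| "aval (Add e1 e2) s = aval e1 s + aval e2 s"
| "aval (Sub e1 e2) s = aval e1 s - aval e2 s"

primrec bval :: "bexp \<Rightarrow> state \<Rightarrow> bool" where
  "bval (Less e1 e2) s \<longleftrightarrow> aval e1 s < aval e2 s"
| "bval (Neg b) s \<longleftrightarrow> \<not> bval b s"
| "bval (Conj b1 b2) s \<longleftrightarrow> bval b1 s \<and> bval b2 s"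

definition assign :: "vname \<Rightarrow> nat \<Rightarrow> state \<Rightarrow> state" where
  "assign x v s = s\<lparr>vars := (vars s)(x := v)\<rparr>"

definition store :: "vname \<Rightarrow> nat \<Rightarrow> nat \<Rightarrow> nat \<Rightarrow> state \<Rightarrow> state" where
  "store a i j v s = s\<lparr>arrs := (arrs s)(a := (arrs s a)(i := (arrs s a i)(j := v)))\<rparr>"

text \<open>\<open>exec c s t s'\<close>: started in \<open>s\<close>, the program \<open>c\<close> halts after exactly \<open>t\<close> steps in \<open>s'\<close>.\<close>

inductive exec :: "com \<Rightarrow> state \<Rightarrow> nat \<Rightarrow> state \<Rightarrow> bool" where
  Skip: "exec Skip s 1 s"
| Assign: "exec (Assign x e) s 1 (assign x (aval e s) s)"
| Store: "exec (Store a e1 e2 e) s 1 (store a (aval e1 s) (aval e2 s) (aval e s) s)"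
| Seq: "exec c1 s t1 s' \<Longrightarrow> exec c2 s' t2 s'' \<Longrightarrow> exec (Seq c1 c2) s (t1 + t2) s''"
| BranchTrue: "bval b s \<Longrightarrow> exec c1 s t s' \<Longrightarrow> exec (Branch b c1 c2) s (1 + t) s'"
| BranchFalse: "\<not> bval b s \<Longrightarrow> exec c2 s t s' \<Longrightarrow> exec (Branch b c1 c2) s (1 + t) s'"
| WhileFalse: "\<not> bval b s \<Longrightarrow> exec (While b c) s 1 s"
| WhileTrue: "bval b s \<Longrightarrow> exec c s t1 s' \<Longrightarrow> exec (While b c) s' t2 s'' \<Longrightarrow>
    exec (While b c) s (1 + t1 + t2) s''"

inductive_cases SkipE: "exec Skip s t s'"
inductive_cases AssignE: "exec (Assign x e) s t s'"
inductive_cases StoreE: "exec (Store a e1 e2 e) s t s'"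
inductive_cases SeqE: "exec (Seq c1 c2) s t s'"
inductive_cases BranchE: "exec (Branch b c1 c2) s t s'"
inductive_cases WhileE: "exec (While b c) s t s'"

lemma exec_deterministic:
  "exec c s t s' \<Longrightarrow> exec c s u s'' \<Longrightarrow> u = t \<and> s'' = s'"
proof (induction arbitrary: u s'' rule: exec.induct)
  case (Skip s)
  then show ?case by (rule SkipE) simp
next
  case (Assign x e s)
  then show ?case by (rule AssignE) simp
next
  case (Store a e1 e2 e s)
  then show ?case by (rule StoreE) simp
next
  case (Seq c1 s t1 s' c2 t2 s'')
  from Seq.prems show ?case by (rule SeqE) (use Seq.IH in metis)
next
  case (BranchTrue b s c1 t s' c2)
  from BranchTrue.prems show ?case
    by (rule BranchE) (use BranchTrue.IH BranchTrue.hyps in \<open>metis plus_1_eq_Suc\<close>)+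
next
  case (BranchFalse b s c2 t s' c1)
  from BranchFalse.prems show ?case
    by (rule BranchE) (use BranchFalse.IH BranchFalse.hyps in \<open>metis plus_1_eq_Suc\<close>)+
next
  case (WhileFalse b s c)
  from WhileFalse.prems show ?case
    by (rule WhileE) (use WhileFalse.hyps in simp_all)
next
  case (WhileTrue b s c t1 s' t2 s'')
  from WhileTrue.prems show ?case
    by (rule WhileE) (use WhileTrue.IH WhileTrue.hyps in \<open>metis plus_1_eq_Suc add_Suc\<close>)+
qed

section \<open>Groups as inputs and homomorphisms as outputs\<close>

text \<open>
  A group of order \<open>n\<close> given by its multiplication table has \<open>{0..<n}\<close> as its carrier.
  The labelling is arbitrary; in particular the identity need not be \<open>0\<close>.
\<close>

definition table_group :: "nat monoid \<Rightarrow> bool" where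
  "table_group G \<longleftrightarrow> group G \<and> carrier G = {0..<order G}"

definition cayley_table :: "nat monoid \<Rightarrow> nat \<Rightarrow> nat \<Rightarrow> nat" where
  "cayley_table G i j = (if i < order G \<and> j < order G then i \<otimes>\<^bsub>G\<^esub> j else 0)"

definition input_state :: "nat monoid \<Rightarrow> nat monoid \<Rightarrow> state" where
  "input_state G1 G2 =
     \<lparr>vars = (\<lambda>_. 0)(''n1'' := order G1, ''n2'' := order G2),
      arrs = (\<lambda>_ _ _. 0)(''table1'' := cayley_table G1, ''table2'' := cayley_table G2)\<rparr>"

definition answer :: "state \<Rightarrow> nat" where
  "answer s = vars s ''answer''"

definition output_map :: "state \<Rightarrow> nat \<Rightarrow> nat" where
  "output_map s i = arrs s ''map'' i 0"

end

theory Submission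
  imports Defs "HOL-Computational_Algebra.Polynomial" "HOL-Number_Theory.Residues"
begin

text \<open>
  Let \<open>G1\<close> be the semidirect product of \<open>A\<close> and \<open>\<langle>c\<rangle>\<close>, let \<open>f\<close> be an epimorphism onto \<open>G2\<close>, \<open>d = f c\<close> and
  \<open>B = f ` A\<close>. Conjugation by \<open>c\<close> and \<open>d\<close> makes \<open>A\<close> and \<open>B\<close> modules over the polynomial ring \<open>R = \<int>[X]\<close>.
  Since the orders are coprime, \<open>R\<close> acts through a finite principal ideal ring, and such modules decompose
  greedily: an element generating a cyclic submodule of maximal size among those meeting the span of the
  previous choices trivially spans, together with them, a direct summand. This yields
  \<open>A = R a\<^sub>1 \<oplus> R a\<^sub>2 \<oplus> \<dots>\<close> and \<open>B = R b\<^sub>1 \<oplus> R b\<^sub>2 \<oplus> \<dots>\<close> with increasing annihilators. A linear surjection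
  from \<open>A\<close> onto \<open>B\<close> exists iff the annihilator of \<open>a\<^sub>i\<close> is contained in that of \<open>b\<^sub>i\<close> for all \<open>i\<close>, and then
  \<open>a\<^sub>i \<mapsto> b\<^sub>i\<close> defines one, which extends to an epimorphism of groups sending \<open>c\<close> to \<open>d\<close>.

  The algorithm tries all \<open>c\<close>, \<open>d\<close> and all candidates \<open>m\<close> for the order of \<open>A\<close>; for the right choice, \<open>A\<close> and
  \<open>B\<close> are the sets of solutions of \<open>x ^ m = 1\<close>. It builds the graph of the map as a subgroup of \<open>G1 \<times> G2\<close>,
  closing it under multiplication and conjugation by \<open>(c, d)\<close>.
\<close>

section \<open>Finite modules with coprime action\<close>

text \<open>A finite \<open>int poly\<close> module need not be a direct sum of cyclic modules;
  coprimality is what rescues the decomposition. Since \<open>X ^ h - 1\<close> acts as zero and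
  \<open>h\<close> is prime to every \<open>p\<close> dividing \<open>m\<close>, one power
  \<open>q = p ^ t\<close> satisfies \<open>r ^ q = r\<close> modulo \<open>p\<close> for all
  scalars. So nilpotent scalars are multiples of \<open>p\<close>, and on a submodule without proper
  idempotents the scalars behave like the integers modulo a prime power. The principal ideal ring
  itself is never built: only scalars and their effect on submodules occur.

  The annihilator condition has to be necessary for whatever decompositions the greedy choice
  returns, so it is proved by counting for arbitrary ones, not by adapting generators to
  \<open>f\<close>. The map found may differ from \<open>f\<close>, whose existence is all that is
  used.

  Generators are chosen in pairs, so both lists have the same length; once one side is exhausted it
  contributes trivial elements. Closing a set of pairs under the group operations replaces any
  computation with coefficients, of which there are infinitely many, and needs at most
  \<open>n1 * n2\<close> additions.\<close>

locale rmod = comm_group M for M (structure) +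
  fixes act :: "'r::comm_ring_1 \<Rightarrow> 'a \<Rightarrow> 'a"
  assumes act_closed [simp, intro]: "x \<in> carrier M \<Longrightarrow> act r x \<in> carrier M"
    and act_mult: "x \<in> carrier M \<Longrightarrow> y \<in> carrier M \<Longrightarrow> act r (x \<otimes> y) = act r x \<otimes> act r y"
    and act_add: "x \<in> carrier M \<Longrightarrow> act (r + s) x = act r x \<otimes> act s x"
    and act_times: "x \<in> carrier M \<Longrightarrow> act (r * s) x = act r (act s x)"
    and act_1 [simp]: "x \<in> carrier M \<Longrightarrow> act 1 x = x"
begin

lemma act_0 [simp]: "x \<in> carrier M \<Longrightarrow> act 0 x = \<one>"
  using act_add[of x 0 0] by (metis act_closed add.right_neutral l_cancel_one')

lemma act_one [simp]: "act r \<one> = \<one>"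
  by (metis act_closed act_mult one_closed r_cancel_one' r_one)

lemma act_uminus: "x \<in> carrier M \<Longrightarrow> act (- r) x = inv (act r x)"
  by (metis act_add act_closed act_0 add.left_inverse inv_equality)

lemma act_inv: "x \<in> carrier M \<Longrightarrow> act r (inv x) = inv (act r x)"
  by (metis act_closed act_mult act_one inv_closed inv_equality l_inv)

lemma act_diff: "x \<in> carrier M \<Longrightarrow> act (r - s) x = act r x \<otimes> inv (act s x)"
  using act_add[of x r "- s"] by (simp add: act_uminus)

lemma act_commute: "x \<in> carrier M \<Longrightarrow> act r (act s x) = act s (act r x)"
  by (metis act_times mult.commute)

section \<open>Submodules, cyclic submodules and annihilators\<close>

definition submod :: "'a set \<Rightarrow> bool" where
  "submod X \<longleftrightarrow> X \<subseteq> carrier M \<and> \<one> \<in> X \<and> (\<forall>x\<in>X. \<forall>y\<in>X. x \<otimes> y \<in> X) \<and> (\<forall>x\<in>X. \<forall>r. act r x \<in> X)"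

definition cyc :: "'a \<Rightarrow> 'a set" where
  "cyc a = range (\<lambda>r. act r a)"

definition kills :: "'r \<Rightarrow> 'a set \<Rightarrow> bool" where
  "kills r X \<longleftrightarrow> (\<forall>x\<in>X. act r x = \<one>)"

text \<open>The analogue of an element whose order is the exponent of an abelian group: the
  annihilator of \<open>a\<close> is that of all of \<open>X\<close>. Such elements generate direct
  summands.\<close>

definition faithful :: "'a \<Rightarrow> 'a set \<Rightarrow> bool" where
  "faithful a X \<longleftrightarrow> a \<in> X \<and> (\<forall>r. act r a = \<one> \<longrightarrow> kills r X)"

lemma submod_carrier [simp]: "submod (carrier M)"
  by (auto simp: submod_def)

lemma submodD:
  assumes "submod X"
  shows "X \<subseteq> carrier M" "x \<in> X \<Longrightarrow> x \<in> carrier M" "\<one> \<in> X"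
    "x \<in> X \<Longrightarrow> y \<in> X \<Longrightarrow> x \<otimes> y \<in> X" "x \<in> X \<Longrightarrow> act r x \<in> X" "x \<in> X \<Longrightarrow> inv x \<in> X"
proof -
  show "x \<in> X \<Longrightarrow> inv x \<in> X"
    using assms act_uminus[of x 1] by (metis act_1 in_mono submod_def)
qed (use assms in \<open>auto simp: submod_def\<close>)

lemma submod_cyc:
  assumes "a \<in> carrier M"
  shows "submod (cyc a)"
  unfolding submod_def cyc_def
proof (intro conjI ballI allI)
  show "range (\<lambda>r. act r a) \<subseteq> carrier M" using assms by blast
  show "\<one> \<in> range (\<lambda>r. act r a)" using assms by (metis act_0 rangeI)
next
  fix x y assume "x \<in> range (\<lambda>r. act r a)" "y \<in> range (\<lambda>r. act r a)"
  then show "x \<otimes> y \<in> range (\<lambda>r. act r a)" using assms by (auto simp flip: act_add)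
next
  fix x s assume "x \<in> range (\<lambda>r. act r a)"
  then show "act s x \<in> range (\<lambda>r. act r a)" using assms by (auto simp flip: act_times)
qed

lemma cyc_self: "a \<in> carrier M \<Longrightarrow> a \<in> cyc a"
  unfolding cyc_def by (metis act_1 rangeI)

lemma cyc_subset: "submod X \<Longrightarrow> a \<in> X \<Longrightarrow> cyc a \<subseteq> X"
  by (auto simp: cyc_def submodD)

lemma submod_image:
  assumes "submod X"
  shows "submod (act f ` X)"
  unfolding submod_def
proof (intro conjI ballI allI)
  show "act f ` X \<subseteq> carrier M" "\<one> \<in> act f ` X"
    using submodD(2)[OF assms] image_eqI[of _ "act f", OF _ submodD(3)[OF assms]] by auto
next
  fix x y assume "x \<in> act f ` X" "y \<in> act f ` X"
  then obtain x' y' where "x' \<in> X" "x = act f x'" "y' \<in> X" "y = act f y'" by blast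
  then show "x \<otimes> y \<in> act f ` X"
    using submodD(2,4)[OF assms] by (intro image_eqI[of _ _ "x' \<otimes> y'"]) (simp_all add: act_mult)
next
  fix x r assume "x \<in> act f ` X"
  then obtain x' where "x' \<in> X" "x = act f x'" by blast
  then show "act r x \<in> act f ` X"
    using submodD(2,5)[OF assms] by (intro image_eqI[of _ _ "act r x'"]) (simp_all add: act_commute)
qed

lemma act_idem_split:
  assumes "x \<in> carrier M"
  shows "x = act f x \<otimes> act (1 - f) x"
  using act_add[OF assms, of f "1 - f"] assms by simp

lemma act_power_add: "x \<in> carrier M \<Longrightarrow> act (r ^ (m + n)) x = act (r ^ m) (act (r ^ n) x)"
  by (simp add: power_add act_times)

end

section \<open>Idempotent scalars and local submodules\<close>

locale finite_rmod = rmod +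
  assumes finite_carrier: "finite (carrier M)"
begin

lemma finite_submod: "submod X \<Longrightarrow> finite X"
  using finite_carrier finite_subset submodD(1) by blast

text \<open>Pigeonhole: the powers of \<open>r\<close> induce finitely many self-maps of
  \<open>X\<close>, so they become periodic, and a sufficiently large multiple of the period is an
  idempotent exponent.\<close>

lemma idempotent_power:
  assumes "submod X"
  shows "\<exists>N\<ge>1. \<forall>x\<in>X. act (r ^ N) (act (r ^ N) x) = act (r ^ N) x"
proof -
  have "finite (range (\<lambda>i::nat. restrict (act (r ^ i)) X))"
    by (rule finite_subset[of _ "X \<rightarrow>\<^sub>E X"])
      (use finite_submod[OF assms] submodD[OF assms] in \<open>auto intro: finite_PiE\<close>)
  then have "\<not> inj (\<lambda>i::nat. restrict (act (r ^ i)) X)"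
    using finite_imageD infinite_UNIV_nat by blast
  then obtain i j :: nat where ij: "i < j" "restrict (act (r ^ i)) X = restrict (act (r ^ j)) X"
    unfolding inj_def by (metis linorder_neqE_nat)
  define d where "d = j - i"
  have d: "d \<ge> 1" "j = d + i" using ij by (auto simp: d_def)
  have eq: "act (r ^ (d + n)) x = act (r ^ n) x" if "x \<in> X" "n \<ge> i" for x n
  proof -
    have x: "x \<in> carrier M" using that submodD[OF assms] by blast
    have "act (r ^ i) x = act (r ^ j) x" using ij(2) that by (metis restrict_apply')
    then have "act (r ^ (n - i)) (act (r ^ i) x) = act (r ^ (n - i)) (act (r ^ j) x)" by simp
    then show ?thesis using that d x by (simp flip: act_power_add) (simp add: algebra_simps)
  qed
  have eq': "act (r ^ (k * d + n)) x = act (r ^ n) x" if "x \<in> X" "n \<ge> i" for x n k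
  proof (induction k)
    case (Suc k)
    then show ?case using eq[OF that(1), of "k * d + n"] that by (simp add: algebra_simps)
  qed simp
  \<comment> \<open>A multiple of the period \<open>d\<close> that lies beyond the preperiod
    \<open>i\<close>; the factor \<open>i + 1\<close> keeps it positive even for
    \<open>i = 0\<close>.\<close>
  define N where "N = (i + 1) * d"
  have "i + 1 \<le> N" using mult_le_mono2[of 1 d "i + 1"] d(1) unfolding N_def by simp
  then have N: "N \<ge> 1" "N \<ge> i" by linarith+
  have "act (r ^ N) (act (r ^ N) x) = act (r ^ N) x" if "x \<in> X" for x
    using eq'[OF that N(2), of "i + 1", folded N_def] that submodD(2)[OF assms]
    by (simp add: act_power_add)
  then show ?thesis using N by blast
qed

text \<open>In the absence of a proper idempotent, the idempotent \<open>r ^ N\<close> acts as zero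
  or as the identity, which makes \<open>r\<close> nilpotent or gives it the inverse
  \<open>r ^ (N - 1)\<close>. The scalars then act through a local ring.\<close>

lemma split_or_local:
  assumes X: "submod X"
  obtains (split) f where "\<And>x. x \<in> X \<Longrightarrow> act f (act f x) = act f x" "act f ` X \<noteq> {\<one>}" "act f ` X \<noteq> X"
  | (loc) "\<And>r. (\<exists>N. kills (r ^ N) X) \<or> (\<exists>r'. \<forall>x\<in>X. act r' (act r x) = x)"
proof (cases "\<exists>f. (\<forall>x\<in>X. act f (act f x) = act f x) \<and> act f ` X \<noteq> {\<one>} \<and> act f ` X \<noteq> X")
  case True
  then obtain f where "\<forall>x\<in>X. act f (act f x) = act f x" "act f ` X \<noteq> {\<one>}" "act f ` X \<noteq> X" by blast
  then show ?thesis by (intro split[of f]) simp_all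
next
  case False
  show ?thesis
  proof (rule loc)
    fix r
    obtain N where N: "N \<ge> 1" "\<forall>x\<in>X. act (r ^ N) (act (r ^ N) x) = act (r ^ N) x"
      using idempotent_power[OF X] by blast
    consider "act (r ^ N) ` X = {\<one>}" | "act (r ^ N) ` X = X" using False N(2) by blast
    then show "(\<exists>N. kills (r ^ N) X) \<or> (\<exists>r'. \<forall>x\<in>X. act r' (act r x) = x)"
    proof cases
      case 1
      then show ?thesis unfolding kills_def by blast
    next
      case 2
      have "act (r ^ (N - 1)) (act r x) = x" if "x \<in> X" for x
      proof -
        have "x \<in> act (r ^ N) ` X" using 2 that by simp
        then obtain y where "y \<in> X" "x = act (r ^ N) y" by blast
        then have "act (r ^ N) x = x" using N(2) by simp
        then have "act (r ^ (N - 1) * r) x = x" using N(1) by (cases N) (auto simp: mult.commute)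
        then show ?thesis using that submodD(2)[OF X] by (simp add: act_times)
      qed
      then show ?thesis by blast
    qed
  qed
qed

end

text \<open>
  The assumption \<open>frob\<close> is the only trace of coprimality: it says that modulo \<open>p\<close> every scalar is a
  power of itself, so that nilpotent scalars are divisible by \<open>p\<close>.
\<close>

locale coprime_rmod = finite_rmod +
  fixes e :: nat
  assumes e_pos: "e > 0"
    and act_e: "x \<in> carrier M \<Longrightarrow> act (of_nat e) x = \<one>"
    and frob: "prime p \<Longrightarrow> p dvd e \<Longrightarrow> \<exists>q w. q > 1 \<and> (\<forall>x\<in>carrier M. act (r ^ q) x = act (r + of_nat p * w) x)"
begin

text \<open>The local ring through which the scalars act is a chain ring with maximal ideal
  generated by a prime \<open>p\<close>: non-units are nilpotent, and \<open>frob\<close> makes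
  nilpotent scalars divisible by \<open>p\<close>.\<close>

lemma local_prime:
  assumes X: "submod X" "X \<noteq> {\<one>}"
    and loc: "\<And>r. (\<exists>N. kills (r ^ N) X) \<or> (\<exists>r'. \<forall>x\<in>X. act r' (act r x) = x)"
  shows "\<exists>p k. kills (of_nat p ^ Suc k) X \<and> \<not> kills (of_nat p ^ k) X \<and>
    (\<forall>r. (\<exists>r'. \<forall>x\<in>X. act r' (act r x) = x) \<or> (\<exists>w. \<forall>x\<in>X. act r x = act (of_nat p) (act w x)))"
proof -
  note XD = submodD[OF X(1)]
  \<comment> \<open>The prime is found as a factor of the least divisor \<open>d\<close> of
    \<open>e\<close> acting nilpotently. If \<open>p\<close> were not nilpotent it would be
    invertible, and cancelling it would leave the smaller divisor \<open>d'\<close>.\<close>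
  define P where "P d \<longleftrightarrow> d > 0 \<and> d dvd e \<and> (\<exists>N. kills (of_nat d ^ N) X)" for d
  have "kills (of_nat e ^ 1) X" using act_e XD(2) unfolding kills_def by auto
  then have "P e" using e_pos unfolding P_def by (metis dvd_refl)
  then obtain d where d: "P d" "\<And>d'. d' < d \<Longrightarrow> \<not> P d'" by (metis exists_least_iff)
  have one_not: "\<not> kills 1 X"
  proof
    assume "kills 1 X"
    then have "x = \<one>" if "x \<in> X" for x using that XD(2) unfolding kills_def by force
    then show False using X(2) XD(3) by blast
  qed
  then have "d \<noteq> 1" using d(1) unfolding P_def by auto
  then obtain p where p: "prime p" "p dvd d" using prime_factor_nat by blast
  then obtain d' where d': "d = p * d'" by blast
  have p_nil: "\<exists>N. kills (of_nat p ^ N) X"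
  proof (rule ccontr)
    assume "\<not> ?thesis"
    then obtain r' where r': "\<forall>x\<in>X. act r' (act (of_nat p) x) = x" using loc[of "of_nat p"] by blast
    have r'N: "act (r' ^ N) (act (of_nat p ^ N) x) = x" if "x \<in> X" for x N
    proof (induction N)
      case (Suc N)
      have "act (r' ^ Suc N) (act (of_nat p ^ Suc N) x) = act ((r' ^ N * of_nat p ^ N) * (r' * of_nat p)) x"
        using that XD(2) by (simp flip: act_times add: ac_simps)
      also have "\<dots> = act (r' ^ N) (act (of_nat p ^ N) x)" using that XD(2) r' by (simp add: act_times)
      finally show ?case using Suc by simp
    qed (use that XD(2) in simp)
    obtain N where N: "kills (of_nat d ^ N) X" using d(1) unfolding P_def by blast
    have "act (of_nat d' ^ N) x = \<one>" if "x \<in> X" for x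
    proof -
      have "act (of_nat p ^ N) (act (of_nat d' ^ N) x) = \<one>"
        using N that XD(2) unfolding kills_def d' by (simp flip: act_times add: power_mult_distrib)
      then show ?thesis using r'N[of "act (of_nat d' ^ N) x" N] that XD by simp
    qed
    then have "P d'" using d(1) d' unfolding P_def kills_def by auto
    moreover have "d' < d" using d' p(1) d(1) prime_gt_1_nat[OF p(1)] unfolding P_def by auto
    ultimately show False using d(2) by blast
  qed
  define k0 where "k0 = (LEAST N. kills (of_nat p ^ N) X)"
  have k0: "kills (of_nat p ^ k0) X" unfolding k0_def using p_nil by (metis LeastI)
  have "k0 \<noteq> 0" using k0 one_not by (cases k0) simp_all
  then obtain k where k: "k0 = Suc k" by (cases k0) auto
  have "\<not> kills (of_nat p ^ k) X"
    using not_less_Least[of k "\<lambda>N. kills (of_nat p ^ N) X"] k unfolding k0_def by auto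
  moreover have "\<exists>w. \<forall>x\<in>X. act r x = act (of_nat p) (act w x)" if nil: "kills (r ^ N) X" for r N
  proof -
    obtain q w where q: "q > 1" and w: "\<forall>x\<in>carrier M. act (r ^ q) x = act (r + of_nat p * w) x"
      using frob[OF p(1)] p(2) d(1) unfolding P_def by (meson dvd_trans)
    \<comment> \<open>Geometric series: \<open>r = r * y ^ N + (r - r * y) * z\<close>. The first
      term acts as zero because \<open>r\<close> is nilpotent, and
      \<open>r - r * y = r - r ^ q\<close> acts as a multiple of \<open>p\<close>.\<close>
    define y where "y = r ^ (q - 1)"
    define z where "z = (\<Sum>i<N. y ^ i)"
    have rq: "r ^ q = r * y" using q unfolding y_def by (cases q) auto
    have "act r x = act (of_nat p) (act (- w * z) x)" if x: "x \<in> X" for x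
    proof -
      have xc: "x \<in> carrier M" using x XD by blast
      have "(q - 1) * N = ((q - 1) * N - N) + N" using q by (cases "q - 1") auto
      then have "y ^ N = r ^ ((q - 1) * N - N) * r ^ N"
        unfolding y_def by (metis power_mult power_add)
      then have yN: "act (y ^ N) x = \<one>"
        using nil x xc unfolding kills_def by (simp add: act_times)
      have "(1 - y) * z = 1 - y ^ N" unfolding z_def by (rule one_diff_power_eq[symmetric])
      then have "r * y ^ N + r * ((1 - y) * z) = r"
        by (simp only:) (simp add: algebra_simps)
      then have "r * y ^ N + (r - r * y) * z = r" by (simp add: algebra_simps)
      then have "act r x = act (r * y ^ N + (r - r * y) * z) x" by (simp only:)
      also have "\<dots> = act (r * y ^ N) x \<otimes> act ((r - r * y) * z) x" by (rule act_add[OF xc])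
      also have "act (r * y ^ N) x = \<one>" using yN xc by (simp add: act_times)
      also have "act ((r - r * y) * z) x = act (r - r * y) (act z x)" using xc by (rule act_times)
      also have "\<dots> = act r (act z x) \<otimes> inv (act (r + of_nat p * w) (act z x))"
        using xc w by (simp add: act_diff flip: rq)
      also have "\<dots> = act (- (of_nat p * w)) (act z x)"
        using xc act_diff[of "act z x" r "r + of_nat p * w"] by simp
      also have "\<dots> = act (of_nat p) (act (- w * z) x)"
        using xc by (simp flip: act_times add: mult.assoc)
      finally show ?thesis using xc by simp
    qed
    then show ?thesis by blast
  qed
  ultimately have "(\<exists>r'. \<forall>x\<in>X. act r' (act r x) = x) \<or> (\<exists>w. \<forall>x\<in>X. act r x = act (of_nat p) (act w x))" for r
    using loc[of r] by blast
  then show ?thesis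
    using k0 \<open>\<not> kills (of_nat p ^ k) X\<close> unfolding k by blast
qed

text \<open>Makes induction on \<open>card X\<close> possible. For the second part,
  \<open>f * (1 - f)\<close> acts as zero, so a surjective \<open>1 - f\<close> would force
  \<open>f\<close> to act trivially.\<close>

lemma split_smaller:
  assumes X: "submod X" and f: "\<And>x. x \<in> X \<Longrightarrow> act f (act f x) = act f x" "act f ` X \<noteq> {\<one>}" "act f ` X \<noteq> X"
  shows "card (act f ` X) < card X" "card (act (1 - f) ` X) < card X"
proof -
  note XD = submodD[OF X]
  have "act f ` X \<subseteq> X" for f using XD(5) by blast
  then have smaller: "act f ` X \<noteq> X \<Longrightarrow> card (act f ` X) < card X" for f
    using finite_submod[OF X] by (intro psubset_card_mono) blast+
  show "card (act f ` X) < card X" using f(3) by (rule smaller)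
  have "act (1 - f) ` X \<noteq> X"
  proof
    assume *: "act (1 - f) ` X = X"
    have "act f x = \<one>" if "x \<in> X" for x
    proof -
      have "x \<in> act (1 - f) ` X" using * that by simp
      then obtain y where "y \<in> X" "x = act (1 - f) y" by blast
      then show ?thesis using XD(2,5) f(1) by (simp add: act_diff act_mult act_inv)
    qed
    then show False using f(2) XD(3) by force
  qed
  then show "card (act (1 - f) ` X) < card X" by (rule smaller)
qed

text \<open>
  Splitting off idempotents \<open>r ^ N\<close> reduces to the local case, where every scalar acts as a power of \<open>p\<close>
  times a unit and any element of maximal additive order is faithful.
\<close>

lemma ex_faithful: "submod X \<Longrightarrow> \<exists>a. faithful a X"
proof (induction "card X" arbitrary: X rule: less_induct)
  case less
  note X = less.prems
  note XD = submodD[OF X]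
  show ?case
  proof (cases "X = {\<one>}")
    case True
    then show ?thesis by (auto simp: faithful_def kills_def)
  next
    case False
    from X show ?thesis
    proof (cases rule: split_or_local)
      case (split f)
      obtain a b where a: "faithful a (act f ` X)" and b: "faithful b (act (1 - f) ` X)"
        using less.hyps[OF split_smaller(1)[OF X split] submod_image[OF X]]
          less.hyps[OF split_smaller(2)[OF X split] submod_image[OF X]] by blast
      have aX: "a \<in> X" "act f a = a"
        using a split(1) XD(5) unfolding faithful_def by auto
      have bX: "b \<in> X" "act f b = \<one>"
      proof -
        obtain x where "x \<in> X" "b = act (1 - f) x" using b unfolding faithful_def by blast
        then show "b \<in> X" "act f b = \<one>"
          using split(1) XD(2,5) by (blast, simp add: act_diff act_mult act_inv)
      qed
      \<comment> \<open>Since \<open>f\<close> fixes \<open>a\<close> and kills \<open>b\<close>,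
        applying it to \<open>act r (a \<otimes> b)\<close> separates the two components.\<close>
      have "kills r X" if r: "act r (a \<otimes> b) = \<one>" for r
      proof -
        have "act r (act f (a \<otimes> b)) = \<one>" using r aX bX XD(2,4) using act_commute[of "a \<otimes> b" r f] by simp
        then have ra: "act r a = \<one>" using aX bX XD(2) by (simp add: act_mult)
        then have rb: "act r b = \<one>" using r aX bX XD(2) by (simp add: act_mult)
        show ?thesis
          unfolding kills_def
        proof
          fix x assume x: "x \<in> X"
          have "act r (act f x) = \<one>" "act r (act (1 - f) x) = \<one>"
            using a b ra rb x unfolding faithful_def kills_def by blast+
          then have "act r (act f x \<otimes> act (1 - f) x) = \<one>" using x XD(2) by (simp add: act_mult)
          then show "act r x = \<one>" using act_idem_split[of x f] x XD(2) by simp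
        qed
      qed
      then show ?thesis using XD(4)[OF aX(1) bX(1)] unfolding faithful_def by blast
    next
      case loc
      obtain p k where pk: "kills (of_nat p ^ Suc k) X" "\<not> kills (of_nat p ^ k) X"
        and unit: "\<And>r. (\<exists>r'. \<forall>x\<in>X. act r' (act r x) = x) \<or> (\<exists>w. \<forall>x\<in>X. act r x = act (of_nat p) (act w x))"
        using local_prime[OF X False loc] by blast
      obtain a where a: "a \<in> X" "act (of_nat p ^ k) a \<noteq> \<one>" using pk(2) unfolding kills_def by blast
      have "kills r X" if r: "act r a = \<one>" for r
      proof -
        \<comment> \<open>Factors \<open>p\<close> are split off \<open>r\<close> one at a time.
          Were the cofactor \<open>w\<close> a unit, \<open>act r a = \<one>\<close> would let
          \<open>p ^ j\<close> kill \<open>a\<close> for some \<open>j \<le> k\<close>, against the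
          choice of \<open>a\<close>. At \<open>j = Suc k\<close> the scalar acts as zero.\<close>
        have "\<exists>w. \<forall>x\<in>X. act r x = act (of_nat p ^ j) (act w x)" if "j \<le> Suc k" for j
          using that
        proof (induction j)
          case 0
          have "\<forall>x\<in>X. act r x = act (of_nat p ^ 0) (act r x)" using XD(2) by simp
          then show ?case by blast
        next
          case (Suc j)
          then obtain w where w: "\<forall>x\<in>X. act r x = act (of_nat p ^ j) (act w x)" by auto
          have "\<not> (\<forall>x\<in>X. act r' (act w x) = x)" for r'
          proof
            assume "\<forall>x\<in>X. act r' (act w x) = x"
            moreover have "act r a = act (of_nat p ^ j) (act w a)" using w a(1) by blast
            ultimately have "act r' (act r a) = act (of_nat p ^ j) a"
              using a(1) XD(2) act_commute[of "act w a" r' "of_nat p ^ j"] by simp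
            moreover have "act (of_nat p ^ (k - j)) (act (of_nat p ^ j) a) = act (of_nat p ^ k) a"
              using a(1) Suc.prems XD(2) by (simp flip: act_power_add)
            ultimately show False using a r by (metis act_one)
          qed
          then obtain w' where "\<forall>x\<in>X. act w x = act (of_nat p) (act w' x)" using unit[of w] by blast
          then have "\<forall>x\<in>X. act r x = act (of_nat p ^ Suc j) (act w' x)"
            using w XD(2) by (simp add: act_times power_Suc2 del: power_Suc)
          then show ?case by blast
        qed
        from this[of "Suc k"] show ?thesis using pk(1) XD(2,5) unfolding kills_def by simp
      qed
      then show ?thesis using a unfolding faithful_def by blast
    qed
  qed
qed

end

section \<open>Sums of submodules and complements of cyclic ones\<close>

context rmod begin

lemma set_mult_iff: "x \<in> U <#> W \<longleftrightarrow> (\<exists>u\<in>U. \<exists>w\<in>W. x = u \<otimes> w)"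
  by (auto simp: set_mult_def)

lemma submod_set_mult:
  assumes U: "submod U" and W: "submod W"
  shows "submod (U <#> W)"
  unfolding submod_def
proof (intro conjI ballI allI subsetI)
  fix x assume "x \<in> U <#> W"
  then show "x \<in> carrier M" using submodD(2)[OF U] submodD(2)[OF W] by (auto simp: set_mult_iff)
next
  show "\<one> \<in> U <#> W" using submodD(3)[OF U] submodD(3)[OF W] by (force simp: set_mult_iff)
next
  fix x y assume "x \<in> U <#> W" "y \<in> U <#> W"
  then obtain u w u' w' where *: "u \<in> U" "w \<in> W" "u' \<in> U" "w' \<in> W" "x = u \<otimes> w" "y = u' \<otimes> w'"
    by (auto simp: set_mult_iff)
  then have "x \<otimes> y = (u \<otimes> u') \<otimes> (w \<otimes> w')"
    using submodD(2)[OF U] submodD(2)[OF W] by (simp add: m_ac)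
  then show "x \<otimes> y \<in> U <#> W"
    using *(5,6) submodD(4)[OF U *(1,3)] submodD(4)[OF W *(2,4)] unfolding set_mult_iff by metis
next
  fix x r assume "x \<in> U <#> W"
  then obtain u w where *: "u \<in> U" "w \<in> W" "x = u \<otimes> w" by (auto simp: set_mult_iff)
  then have "act r x = act r u \<otimes> act r w"
    using submodD(2)[OF U] submodD(2)[OF W] by (simp add: act_mult)
  then show "act r x \<in> U <#> W"
    using submodD(5)[OF U *(1)] submodD(5)[OF W *(2)] unfolding set_mult_iff by metis
qed

lemma set_mult_left: "submod U \<Longrightarrow> submod W \<Longrightarrow> U \<subseteq> U <#> W"
  using submodD(2,3) by (force simp: set_mult_iff)

lemma set_mult_right: "submod U \<Longrightarrow> submod W \<Longrightarrow> W \<subseteq> U <#> W"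
  using submodD(2,3) by (force simp: set_mult_iff)

end

context coprime_rmod begin

text \<open>Generalises the fact that a cyclic subgroup of maximal order in a finite abelian p-group
  is a direct summand. An idempotent reduces the claim to the two components. In the local case
  \<open>U\<close> is maximal among the submodules meeting \<open>cyc a\<close> trivially, and
  \<open>V = cyc a <#> U\<close> turns out to be closed under division by \<open>p\<close>; as
  \<open>p ^ Suc k\<close> kills \<open>X\<close>, this gives
  \<open>X \<subseteq> V\<close>.\<close>

lemma ex_complement:
  "submod X \<Longrightarrow> faithful a X \<Longrightarrow> \<exists>U. submod U \<and> U \<subseteq> X \<and> U \<inter> cyc a = {\<one>} \<and> X \<subseteq> cyc a <#> U"
proof (induction "card X" arbitrary: X a rule: less_induct)
  case less
  note X = less.prems(1) and a = less.prems(2)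
  note XD = submodD[OF X]
  have aX: "a \<in> X" using a unfolding faithful_def by blast
  have ac: "a \<in> carrier M" using aX XD(2) by blast
  note cycD = submodD[OF submod_cyc[OF ac]]
  show ?case
  proof (cases "X = {\<one>}")
    case True
    have "cyc a \<subseteq> X" by (rule cyc_subset[OF X aX])
    then show ?thesis using cycD(3) X unfolding True
      by (intro exI[of _ "{\<one>}"]) (auto simp: set_mult_iff intro!: bexI[of _ \<one>])
  next
    case False
    from X show ?thesis
    proof (cases rule: split_or_local)
      case (split f)
      define g where "g = 1 - f"
      have fg: "x = act f x \<otimes> act g x" if "x \<in> carrier M" for x
        unfolding g_def by (rule act_idem_split[OF that])
      have idem: "act f (act f x) = act f x" "act f (act g x) = \<one>" "act g (act f x) = \<one>" "act g (act g x) = act g x"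
        if "x \<in> X" for x
        using split(1)[OF that] XD(2)[OF that] unfolding g_def
        by (simp_all add: act_diff act_mult act_inv)
      have aa: "faithful (act h a) (act h ` X)" for h
        unfolding faithful_def
      proof (intro conjI allI impI)
        fix r assume "act r (act h a) = \<one>"
        then have "act (r * h) a = \<one>" using ac by (simp add: act_times)
        then have "kills (r * h) X" using a unfolding faithful_def by blast
        then show "kills r (act h ` X)" using XD(2) unfolding kills_def by (auto simp: act_times)
      qed (use aX in blast)
      obtain U where U: "submod U" "U \<subseteq> act f ` X" "U \<inter> cyc (act f a) = {\<one>}" "act f ` X \<subseteq> cyc (act f a) <#> U"
        using less.hyps[OF split_smaller(1)[OF X split] submod_image[OF X] aa] by blast
      obtain W where W: "submod W" "W \<subseteq> act g ` X" "W \<inter> cyc (act g a) = {\<one>}" "act g ` X \<subseteq> cyc (act g a) <#> W"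
        using less.hyps[OF split_smaller(2)[OF X split] submod_image[OF X] aa] unfolding g_def by blast
      have fU: "u \<in> X" "act f u = u" "act g u = \<one>" if "u \<in> U" for u
        using that U(2) idem XD(5) by (blast, force, force)
      have gW: "w \<in> X" "act g w = w" "act f w = \<one>" if "w \<in> W" for w
        using that W(2) idem XD(5) by (blast, force, force)
      have "U <#> W \<subseteq> X"
        using fU(1) gW(1) XD(4) by (auto simp: set_mult_iff)
      moreover have "(U <#> W) \<inter> cyc a \<subseteq> {\<one>}"
      proof
        fix x assume x: "x \<in> (U <#> W) \<inter> cyc a"
        then obtain u w r where *: "u \<in> U" "w \<in> W" "x = u \<otimes> w" "x = act r a"
          by (auto simp: set_mult_iff cyc_def)
        have uc: "u \<in> carrier M" "w \<in> carrier M" using fU(1) gW(1) XD(2) *(1,2) by blast+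
        have "act f (u \<otimes> w) = act r (act f a)" "act g (u \<otimes> w) = act r (act g a)"
          using *(3,4) act_commute[OF ac] by simp_all
        then have "u = act r (act f a)" "w = act r (act g a)"
          using uc fU[OF *(1)] gW[OF *(2)] by (simp_all add: act_mult)
        then have "u \<in> U \<inter> cyc (act f a)" "w \<in> W \<inter> cyc (act g a)" using * unfolding cyc_def by blast+
        then show "x \<in> {\<one>}" using U(3) W(3) *(3) by simp
      qed
      moreover have "X \<subseteq> cyc a <#> (U <#> W)"
      proof
        fix x assume x: "x \<in> X"
        have "act f x \<in> cyc (act f a) <#> U" "act g x \<in> cyc (act g a) <#> W" using x U(4) W(4) by blast+
        then obtain r s u w where *: "u \<in> U" "w \<in> W" "act f x = act r (act f a) \<otimes> u" "act g x = act s (act g a) \<otimes> w"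
          by (auto simp: set_mult_iff cyc_def)
        have uc: "u \<in> carrier M" "w \<in> carrier M" using fU(1) gW(1) XD(2) *(1,2) by blast+
        have "x = (act r (act f a) \<otimes> u) \<otimes> (act s (act g a) \<otimes> w)"
          using fg[of x] * XD(2)[OF x] by simp
        also have "\<dots> = act (r * f + s * g) a \<otimes> (u \<otimes> w)"
          using uc ac by (simp add: act_add act_times m_ac)
        finally have "x = act (r * f + s * g) a \<otimes> (u \<otimes> w)" .
        moreover have "u \<otimes> w \<in> U <#> W" using *(1,2) unfolding set_mult_iff by blast
        ultimately show "x \<in> cyc a <#> (U <#> W)"
          unfolding set_mult_iff[of x] cyc_def by blast
      qed
      ultimately show ?thesis
        using submod_set_mult[OF U(1) W(1)] cycD(3) submodD(3) by (intro exI[of _ "U <#> W"]) blast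
    next
      case loc
      obtain p k where pk: "kills (of_nat p ^ Suc k) X" "\<not> kills (of_nat p ^ k) X"
        and unit: "\<And>r. (\<exists>r'. \<forall>x\<in>X. act r' (act r x) = x) \<or> (\<exists>w. \<forall>x\<in>X. act r x = act (of_nat p) (act w x))"
        using local_prime[OF X False loc] by blast
      have pka: "act (of_nat p ^ k) a \<noteq> \<one>" using pk(2) a unfolding faithful_def by blast
      define F where "F = {U. submod U \<and> U \<subseteq> X \<and> U \<inter> cyc a = {\<one>}}"
      have "finite F" by (rule finite_subset[of _ "Pow X"]) (use finite_submod[OF X] in \<open>auto simp: F_def\<close>)
      moreover have "{\<one>} \<in> F" using XD(3) cycD(3) by (auto simp: submod_def F_def)
      ultimately obtain U where UF: "U \<in> F" and max: "\<And>V. V \<in> F \<Longrightarrow> U \<subseteq> V \<Longrightarrow> U = V"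
        using finite_has_maximal[of F] by blast
      have U: "submod U" "U \<subseteq> X" "U \<inter> cyc a = {\<one>}" using UF unfolding F_def by simp_all
      note UD = submodD[OF U(1)]
      define V where "V = cyc a <#> U"
      have V: "submod V" unfolding V_def by (intro submod_set_mult submod_cyc ac U(1))
      note VD = submodD[OF V]
      have aV: "cyc a \<subseteq> V" "U \<subseteq> V"
        unfolding V_def using set_mult_left set_mult_right submod_cyc ac U(1) by blast+
      \<comment> \<open>If \<open>r\<close> were a unit, multiplying by \<open>p ^ k\<close> would
        put a nontrivial multiple of \<open>a\<close> into \<open>U\<close>. So \<open>r\<close> is
        \<open>p\<close> times some \<open>v\<close>, and subtracting \<open>v\<close> times
        \<open>a\<close> from \<open>w\<close> gives \<open>w'\<close> with
        \<open>act (of_nat p) w' = u\<close> in \<open>U\<close>.\<close>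
      have step: "w \<in> V" if w: "w \<in> X" "act (of_nat p) w \<in> V" for w
      proof -
        have wc: "w \<in> carrier M" using w(1) XD(2) by blast
        obtain r u where ru: "act (of_nat p) w = act r a \<otimes> u" "u \<in> U"
          using w(2) unfolding V_def set_mult_iff cyc_def by blast
        have uc: "u \<in> carrier M" using ru(2) UD(2) by blast
        have "\<not> (\<forall>x\<in>X. act r' (act r x) = x)" for r'
        proof
          assume r': "\<forall>x\<in>X. act r' (act r x) = x"
          have "act (of_nat p ^ Suc k) w = \<one>" using pk(1) w(1) unfolding kills_def by blast
          then have "act (of_nat p ^ k) (act r a) \<otimes> act (of_nat p ^ k) u = \<one>"
            using ru(1) wc uc ac by (simp add: act_times power_Suc2 act_mult del: power_Suc)
          then have "act (of_nat p ^ k) (act r a) = inv (act (of_nat p ^ k) u)"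
            using uc ac by (simp add: inv_equality)
          then have "act (of_nat p ^ k) (act r a) \<in> U \<inter> cyc a"
            using UD(5,6) ru(2) cycD(5) unfolding cyc_def by (metis Int_iff rangeI)
          then have "act r' (act (of_nat p ^ k) (act r a)) = \<one>" using U(3) by simp
          moreover have "act r' (act (of_nat p ^ k) (act r a)) = act (of_nat p ^ k) a"
            using r' aX act_commute[of "act r a" r' "of_nat p ^ k"] ac by simp
          ultimately show False using pka by simp
        qed
        then obtain v where v: "\<forall>x\<in>X. act r x = act (of_nat p) (act v x)" using unit[of r] by blast
        define w' where "w' = w \<otimes> inv (act v a)"
        have w'X: "w' \<in> X" unfolding w'_def using XD(4,5,6) w(1) aX by blast
        have w'c: "w' \<in> carrier M" using w'X XD(2) by blast
        have "act (of_nat p) w' = act r a \<otimes> u \<otimes> inv (act r a)"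
          unfolding w'_def using wc ac ru(1) v aX by (simp add: act_mult act_inv)
        also have "\<dots> = u" using uc ac by (simp add: m_ac)
        finally have pw': "act (of_nat p) w' = u" .
        have "w' \<in> V"
        proof (rule ccontr)
          assume nV: "w' \<notin> V"
          \<comment> \<open>Adjoining \<open>w'\<close> to \<open>U\<close> violates maximality, so
            some nontrivial \<open>x\<close> in \<open>cyc a\<close> equals \<open>s\<close> times
            \<open>w'\<close> plus an element of \<open>U\<close>. If \<open>s\<close> is a unit,
            \<open>w'\<close> already lies in \<open>V\<close>; if \<open>s\<close> is divisible by
            \<open>p\<close>, then \<open>x\<close> lies in \<open>U\<close>. Both are
            impossible.\<close>
          have sub: "submod (cyc w' <#> U)" by (intro submod_set_mult submod_cyc w'c U(1))
          have "w' \<in> cyc w' <#> U" using set_mult_left[OF submod_cyc[OF w'c] U(1)] cyc_self[OF w'c] by blast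
          then have "U \<noteq> cyc w' <#> U" using nV aV(2) by blast
          moreover have "U \<subseteq> cyc w' <#> U" by (rule set_mult_right[OF submod_cyc[OF w'c] U(1)])
          moreover have "cyc w' <#> U \<subseteq> X"
            using cyc_subset[OF X w'X] U(2) XD(4) unfolding set_mult_def by blast
          moreover have "\<one> \<in> (cyc w' <#> U) \<inter> cyc a" using submodD(3)[OF sub] cycD(3) by blast
          ultimately obtain x where x: "x \<in> cyc w' <#> U" "x \<in> cyc a" "x \<noteq> \<one>"
            using max[of "cyc w' <#> U"] sub unfolding F_def by blast
          then obtain s u' t where *: "x = act s w' \<otimes> u'" "u' \<in> U" "x = act t a"
            unfolding cyc_def set_mult_iff by blast
          have u'c: "u' \<in> carrier M" using *(2) UD(2) by blast
          from unit[of s] show False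
          proof (elim disjE exE)
            fix s' assume s': "\<forall>x\<in>X. act s' (act s x) = x"
            have "act s w' = act t a \<otimes> inv u'"
              using *(1,3) w'c u'c ac by (metis act_closed inv_solve_right)
            then have "act s' (act s w') \<in> V"
              using VD(4,5,6) aV *(2) unfolding cyc_def by (metis rangeI subsetD)
            then show False using s' w'X nV by simp
          next
            fix v' assume "\<forall>x\<in>X. act s x = act (of_nat p) (act v' x)"
            then have "act s w' = act v' u" using w'X pw' act_commute[OF w'c] by metis
            then have "x \<in> U" using *(1,2) ru(2) UD(4,5) by simp
            then show False using x U(3) by blast
          qed
        qed
        moreover have "w = w' \<otimes> act v a" unfolding w'_def using wc ac by (simp add: m_assoc)
        ultimately show ?thesis using VD(4) aV(1) unfolding cyc_def by blast
      qed
      have "w \<in> X \<Longrightarrow> act (of_nat p ^ j) w \<in> V \<Longrightarrow> w \<in> V" for w j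
      proof (induction j arbitrary: w)
        case 0
        then show ?case using XD(2) by simp
      next
        case (Suc j)
        have "act (of_nat p ^ j) (act (of_nat p) w) \<in> V"
          using Suc.prems XD(2) by (simp add: act_times power_Suc2 del: power_Suc)
        then have "act (of_nat p) w \<in> V" using Suc.IH XD(5) Suc.prems(1) by blast
        then show ?case using step Suc.prems(1) by blast
      qed
      then have "X \<subseteq> V" using pk(1) VD(3) unfolding kills_def by (metis subsetI)
      then show ?thesis using U unfolding V_def by blast
    qed
  qed
qed

end

section \<open>Independent families and epimorphisms\<close>

context rmod begin

primrec comb :: "(nat \<Rightarrow> 'r) \<Rightarrow> (nat \<Rightarrow> 'a) \<Rightarrow> nat \<Rightarrow> 'a" where
  "comb t \<alpha> 0 = \<one>"
| "comb t \<alpha> (Suc k) = comb t \<alpha> k \<otimes> act (t k) (\<alpha> k)"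

definition span :: "(nat \<Rightarrow> 'a) \<Rightarrow> nat \<Rightarrow> 'a set" where
  "span \<alpha> k = range (\<lambda>t. comb t \<alpha> k)"

lemma comb_closed [intro, simp]: "(\<And>i. i < k \<Longrightarrow> \<alpha> i \<in> carrier M) \<Longrightarrow> comb t \<alpha> k \<in> carrier M"
  by (induction k) simp_all

lemma mult_interchange:
  "a \<in> carrier M \<Longrightarrow> b \<in> carrier M \<Longrightarrow> c \<in> carrier M \<Longrightarrow> d \<in> carrier M \<Longrightarrow>
    (a \<otimes> b) \<otimes> (c \<otimes> d) = (a \<otimes> c) \<otimes> (b \<otimes> d)"
  by (simp add: m_ac)

lemma comb_cong:
  "(\<And>i. i < k \<Longrightarrow> act (t i) (\<alpha> i) = act (t' i) (\<alpha>' i)) \<Longrightarrow> comb t \<alpha> k = comb t' \<alpha>' k"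
  by (induction k) simp_all

lemma comb_add:
  "(\<And>i. i < k \<Longrightarrow> \<alpha> i \<in> carrier M) \<Longrightarrow> comb t \<alpha> k \<otimes> comb t' \<alpha> k = comb (\<lambda>i. t i + t' i) \<alpha> k"
proof (induction k)
  case (Suc k)
  have "comb t \<alpha> k \<in> carrier M" "comb t' \<alpha> k \<in> carrier M" "\<alpha> k \<in> carrier M" using Suc.prems by auto
  then show ?case
    using Suc mult_interchange[of "comb t \<alpha> k" "act (t k) (\<alpha> k)" "comb t' \<alpha> k" "act (t' k) (\<alpha> k)"]
    by (simp add: act_add)
qed simp

lemma comb_act:
  "(\<And>i. i < k \<Longrightarrow> \<alpha> i \<in> carrier M) \<Longrightarrow> act r (comb t \<alpha> k) = comb (\<lambda>i. r * t i) \<alpha> k"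
  by (induction k) (simp_all add: act_times act_mult)

lemma comb_0: "(\<And>i. i < k \<Longrightarrow> \<alpha> i \<in> carrier M) \<Longrightarrow> comb (\<lambda>_. 0) \<alpha> k = \<one>"
  by (induction k) simp_all

text \<open>Composition of linear maps: the coefficient vector \<open>t\<close> is multiplied by the
  matrix \<open>c\<close>.\<close>

lemma comb_swap:
  assumes "\<And>l. l < k \<Longrightarrow> \<beta> l \<in> carrier M"
  shows "comb t (\<lambda>j. comb (c j) \<beta> k) n = comb (\<lambda>l. \<Sum>j<n. t j * c j l) \<beta> k"
  using assms by (induction n) (simp_all add: comb_0 comb_act comb_add)

lemma comb_extend:
  assumes "\<And>i. i < k \<Longrightarrow> \<alpha> i \<in> carrier M" "k \<le> n" "\<And>i. k \<le> i \<Longrightarrow> i < n \<Longrightarrow> act (t i) (\<alpha> i) = \<one>"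
  shows "comb t \<alpha> n = comb t \<alpha> k"
  using assms(2,3) by (induction n rule: dec_induct) (simp_all add: assms(1))

lemma span_submod:
  assumes "\<And>i. i < k \<Longrightarrow> \<alpha> i \<in> carrier M"
  shows "submod (span \<alpha> k)"
  unfolding submod_def span_def
proof (intro conjI ballI allI)
  show "range (\<lambda>t. comb t \<alpha> k) \<subseteq> carrier M" using assms by auto
  show "\<one> \<in> range (\<lambda>t. comb t \<alpha> k)" using comb_0[of k \<alpha>] assms by (metis rangeI)
next
  fix x y assume "x \<in> range (\<lambda>t. comb t \<alpha> k)" "y \<in> range (\<lambda>t. comb t \<alpha> k)"
  then show "x \<otimes> y \<in> range (\<lambda>t. comb t \<alpha> k)" using assms by (auto simp: comb_add)
next
  fix x r assume "x \<in> range (\<lambda>t. comb t \<alpha> k)"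
  then show "act r x \<in> range (\<lambda>t. comb t \<alpha> k)" using assms by (auto simp: comb_act)
qed

lemma span_Suc: "span \<alpha> (Suc k) = span \<alpha> k <#> cyc (\<alpha> k)"
proof (intro equalityI subsetI)
  fix x assume "x \<in> span \<alpha> k <#> cyc (\<alpha> k)"
  then obtain t r where x: "x = comb t \<alpha> k \<otimes> act r (\<alpha> k)" by (auto simp: set_mult_iff span_def cyc_def)
  have "comb (t(k := r)) \<alpha> k = comb t \<alpha> k" by (rule comb_cong) simp
  then have "x = comb (t(k := r)) \<alpha> (Suc k)" using x by simp
  then show "x \<in> span \<alpha> (Suc k)" unfolding span_def by blast
qed (auto simp: set_mult_iff span_def cyc_def)

text \<open>Directness of the sum together with increasing annihilators, as for invariant factors
  listed from the largest. Trivial entries are allowed at the end, which lets families for different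
  modules share one length.\<close>

definition indep :: "(nat \<Rightarrow> 'a) \<Rightarrow> nat \<Rightarrow> bool" where
  "indep \<alpha> k \<longleftrightarrow> (\<forall>i<k. \<alpha> i \<in> carrier M) \<and>
    (\<forall>t. comb t \<alpha> k = \<one> \<longrightarrow> (\<forall>i<k. act (t i) (\<alpha> i) = \<one>)) \<and>
    (\<forall>i j r. i \<le> j \<longrightarrow> j < k \<longrightarrow> act r (\<alpha> i) = \<one> \<longrightarrow> act r (\<alpha> j) = \<one>)"

lemma comb_diff:
  assumes "\<And>i. i < k \<Longrightarrow> \<alpha> i \<in> carrier M"
  shows "comb (\<lambda>i. t i - t' i) \<alpha> k = comb t \<alpha> k \<otimes> inv (comb t' \<alpha> k)"
proof -
  have "comb (\<lambda>i. t i - t' i) \<alpha> k = comb t \<alpha> k \<otimes> comb (\<lambda>i. - 1 * t' i) \<alpha> k"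
    using assms by (simp add: comb_add)
  also have "comb (\<lambda>i. - 1 * t' i) \<alpha> k = act (- 1) (comb t' \<alpha> k)"
    using assms by (simp only: comb_act)
  finally show ?thesis using assms by (simp add: act_uminus)
qed

text \<open>Coefficients are determined only modulo annihilators, so uniqueness is a statement about
  the summands.\<close>

lemma indep_eq:
  assumes "indep \<alpha> k" "comb t \<alpha> k = comb t' \<alpha> k" "i < k"
  shows "act (t i) (\<alpha> i) = act (t' i) (\<alpha> i)"
proof -
  have c: "\<And>i. i < k \<Longrightarrow> \<alpha> i \<in> carrier M" using assms(1) unfolding indep_def by blast
  have "comb (\<lambda>i. t i - t' i) \<alpha> k = \<one>" using assms(2) c by (simp add: comb_diff)
  then have "act (t i - t' i) (\<alpha> i) = \<one>" using assms(1,3) unfolding indep_def by blast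
  then show ?thesis using c[OF assms(3)] act_add[of "\<alpha> i" "t i - t' i" "t' i"] by simp
qed

end

text \<open>Counting: the hypothesis would produce a surjection \<open>S\<^sup>i \<rightarrow> S\<^sup>i\<^sup>+\<^sup>1\<close> for \<open>S = cyc (r b)\<close>.\<close>

lemma annihilator_chain:
  fixes act :: "'r::comm_ring_1 \<Rightarrow> 'a \<Rightarrow> 'a" and act' :: "'r \<Rightarrow> 'b \<Rightarrow> 'b"
  assumes M: "finite_rmod M act" and N: "finite_rmod N act'"
    and \<alpha>: "rmod.indep M act \<alpha> k" "rmod.span M act \<alpha> k = carrier M"
    and \<beta>: "rmod.indep N act' \<beta> k" "rmod.span N act' \<beta> k = carrier N"
    and f: "f \<in> hom M N" "f ` carrier M = carrier N"
      "\<And>r x. x \<in> carrier M \<Longrightarrow> f (act r x) = act' r (f x)"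
    and i: "i < k" and r: "act r (\<alpha> i) = \<one>\<^bsub>M\<^esub>"
  shows "act' r (\<beta> i) = \<one>\<^bsub>N\<^esub>"
proof (rule ccontr)
  assume neq: "act' r (\<beta> i) \<noteq> \<one>\<^bsub>N\<^esub>"
  interpret M: finite_rmod M act by (rule M)
  interpret N: finite_rmod N act' by (rule N)
  interpret f: group_hom M N f using f(1) by unfold_locales
  have \<alpha>c: "\<And>j. j < k \<Longrightarrow> \<alpha> j \<in> carrier M" using \<alpha>(1) unfolding M.indep_def by blast
  have \<beta>c: "\<And>j. j < k \<Longrightarrow> \<beta> j \<in> carrier N" using \<beta>(1) unfolding N.indep_def by blast
  define b where "b = act' r (\<beta> i)"
  have bc: "b \<in> carrier N" unfolding b_def using \<beta>c[OF i] by simp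
  define S where "S = N.cyc b"
  have sS: "N.submod S" unfolding S_def by (rule N.submod_cyc[OF bc])
  have finS: "finite S" by (rule N.finite_submod[OF sS])
  have "{\<one>\<^bsub>N\<^esub>, b} \<subseteq> S" using N.submodD(3)[OF sS] N.cyc_self[OF bc] unfolding S_def by blast
  then have "card {\<one>\<^bsub>N\<^esub>, b} \<le> card S" by (rule card_mono[OF finS])
  then have card2: "card S > 1" using neq unfolding b_def by simp
  have "\<forall>j<k. \<exists>c. f (\<alpha> j) = N.comb c \<beta> k"
  proof (intro allI impI)
    fix j assume "j < k"
    then have "f (\<alpha> j) \<in> N.span \<beta> k" using \<alpha>c f.hom_closed unfolding \<beta>(2) by blast
    then show "\<exists>c. f (\<alpha> j) = N.comb c \<beta> k" unfolding N.span_def by blast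
  qed
  then obtain c where c: "\<And>j. j < k \<Longrightarrow> f (\<alpha> j) = N.comb (c j) \<beta> k" by metis
  have fcomb: "f (M.comb t \<alpha> n) = N.comb t (\<lambda>j. f (\<alpha> j)) n" if "n \<le> k" for t n
    using that by (induction n) (simp_all add: \<alpha>c f(3))
  \<comment> \<open>Multiplication of a vector in \<open>S ^ i\<close> by the first \<open>i\<close>
    rows and \<open>i + 1\<close> columns of the matrix \<open>c\<close> of \<open>f\<close>. The
    target \<open>\<sigma>\<close> is lifted to \<open>n\<close>, whose coordinates after
    multiplication by \<open>r\<close> reproduce it.\<close>
  define \<Phi> where "\<Phi> \<tau> = restrict (\<lambda>l. N.comb (\<lambda>j. c j l) \<tau> i) {..i}" for \<tau>
  have "{..i} \<rightarrow>\<^sub>E S \<subseteq> \<Phi> ` ({..<i} \<rightarrow>\<^sub>E S)"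
  proof
    fix \<sigma> assume \<sigma>: "\<sigma> \<in> {..i} \<rightarrow>\<^sub>E S"
    then have "\<forall>l\<in>{..i}. \<exists>s. \<sigma> l = act' s b" unfolding S_def N.cyc_def by blast
    then obtain s where s: "\<And>l. l \<le> i \<Longrightarrow> \<sigma> l = act' (s l) b" by (metis atMost_iff)
    define n where "n = N.comb s \<beta> (Suc i)"
    have n: "n \<in> carrier N" unfolding n_def using \<beta>c i by (intro N.comb_closed) simp
    have "n \<in> f ` M.span \<alpha> k" unfolding \<alpha>(2) f(2) by (rule n)
    then obtain t where t: "f (M.comb t \<alpha> k) = n" unfolding M.span_def by blast
    \<comment> \<open>Because annihilators increase, \<open>r\<close> kills every
      \<open>\<alpha> j\<close> with \<open>j \<ge> i\<close>; only the first \<open>i\<close> rows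
      of the matrix survive.\<close>
    have rn: "act' r n = N.comb (\<lambda>l. \<Sum>j<i. r * t j * c j l) \<beta> k"
    proof -
      have "act' r n = f (act r (M.comb t \<alpha> k))" using t f(3) \<alpha>c by simp
      also have "act r (M.comb t \<alpha> k) = M.comb (\<lambda>j. r * t j) \<alpha> k" using \<alpha>c by (rule M.comb_act)
      also have "\<dots> = M.comb (\<lambda>j. r * t j) \<alpha> i"
      proof (rule M.comb_extend)
        fix j assume j: "i \<le> j" "j < k"
        then have "act r (\<alpha> j) = \<one>\<^bsub>M\<^esub>" using \<alpha>(1) r unfolding M.indep_def by blast
        then show "act (r * t j) (\<alpha> j) = \<one>\<^bsub>M\<^esub>"
          using \<alpha>c[OF j(2)] by (simp add: M.act_times M.act_commute[of _ r])
      qed (use \<alpha>c i in auto)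
      also have "f \<dots> = N.comb (\<lambda>j. r * t j) (\<lambda>j. f (\<alpha> j)) i" using i by (intro fcomb) simp
      also have "\<dots> = N.comb (\<lambda>j. r * t j) (\<lambda>j. N.comb (c j) \<beta> k) i"
        using i c by (intro N.comb_cong) simp
      also have "\<dots> = N.comb (\<lambda>l. \<Sum>j<i. r * t j * c j l) \<beta> k" by (rule N.comb_swap) (rule \<beta>c)
      finally show ?thesis .
    qed
    have rn': "act' r n = N.comb (\<lambda>l. if l \<le> i then r * s l else 0) \<beta> k"
    proof -
      have "act' r n = N.comb (\<lambda>l. r * s l) \<beta> (Suc i)" unfolding n_def using \<beta>c i by (intro N.comb_act) simp
      also have "\<dots> = N.comb (\<lambda>l. if l \<le> i then r * s l else 0) \<beta> (Suc i)" by (rule N.comb_cong) simp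
      also have "\<dots> = N.comb (\<lambda>l. if l \<le> i then r * s l else 0) \<beta> k"
        using \<beta>c i by (intro N.comb_extend[symmetric]) auto
      finally show ?thesis .
    qed
    define \<tau> where "\<tau> = restrict (\<lambda>j. act' (t j) b) {..<i}"
    have "\<tau> \<in> {..<i} \<rightarrow>\<^sub>E S" unfolding \<tau>_def S_def N.cyc_def by auto
    moreover have "\<Phi> \<tau> = \<sigma>"
    proof
      fix l
      show "\<Phi> \<tau> l = \<sigma> l"
      proof (cases "l \<le> i")
        case True
        have l: "l < k" using True i by simp
        define u where "u = (\<Sum>j<i. t j * c j l)"
        have "act' (\<Sum>j<i. r * t j * c j l) (\<beta> l) = act' (r * s l) (\<beta> l)"
          using N.indep_eq[OF \<beta>(1) rn[symmetric, unfolded rn'] l] True by simp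
        then have "act' (r * u) (\<beta> l) = act' (r * s l) (\<beta> l)"
          unfolding u_def by (simp add: sum_distrib_left mult.assoc)
        then have "act' (r * u - r * s l) (\<beta> l) = \<one>\<^bsub>N\<^esub>"
          using \<beta>c[OF l] by (simp add: N.act_diff)
        \<comment> \<open>The comparison takes place at \<open>\<beta> l\<close>; since
          \<open>l \<le> i\<close>, increasing annihilators carry it over to
          \<open>\<beta> i\<close>, where \<open>b\<close> lives.\<close>
        then have "act' (r * u - r * s l) (\<beta> i) = \<one>\<^bsub>N\<^esub>"
          using \<beta>(1) True i unfolding N.indep_def by blast
        then have "act' (r * u) (\<beta> i) = act' (r * s l) (\<beta> i)"
          using \<beta>c[OF i] N.act_add[of "\<beta> i" "r * u - r * s l" "r * s l"] by simp
        then have "act' (u * r) (\<beta> i) = act' (s l * r) (\<beta> i)" by (simp add: mult.commute)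
        then have eq: "act' u b = act' (s l) b" unfolding b_def using \<beta>c[OF i] by (simp add: N.act_times)
        have "\<Phi> \<tau> l = N.comb (\<lambda>j. c j l) (\<lambda>j. act' (t j) b) i"
          unfolding \<Phi>_def \<tau>_def using True by (auto intro!: N.comb_cong)
        also have "\<dots> = N.comb (\<lambda>j. t j * c j l) (\<lambda>j. b) i"
          using bc by (intro N.comb_cong) (simp add: N.act_times N.act_commute)
        also have "\<dots> = act' u b"
        proof -
          have "N.comb (\<lambda>j. t j * c j l) (\<lambda>j. b) m = act' (\<Sum>j<m. t j * c j l) b" for m
            using bc by (induction m) (simp_all add: N.act_add)
          then show ?thesis unfolding u_def .
        qed
        finally show ?thesis using eq s[OF True] by simp
      next
        case False
        then show ?thesis using PiE_arb[OF \<sigma>, of l] unfolding \<Phi>_def by simp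
      qed
    qed
    ultimately show "\<sigma> \<in> \<Phi> ` ({..<i} \<rightarrow>\<^sub>E S)" by blast
  qed
  then have "card ({..i} \<rightarrow>\<^sub>E S) \<le> card (\<Phi> ` ({..<i} \<rightarrow>\<^sub>E S))"
    using finS by (intro card_mono finite_imageI finite_PiE) auto
  also have "\<dots> \<le> card ({..<i} \<rightarrow>\<^sub>E S)" using finS by (intro card_image_le finite_PiE) auto
  finally have "card S ^ Suc i \<le> card S ^ i" by (simp add: card_PiE)
  then have "Suc i \<le> i" using power_le_imp_le_exp[OF card2] by blast
  then show False by simp
qed

section \<open>Greedy splitting into invariant factors\<close>

context coprime_rmod begin

text \<open>
  The condition on \<open>U\<close> says that \<open>\<alpha>\<close> starts a decomposition into invariant factors. An element of
  maximal cyclic span among those independent of \<open>\<alpha>\<close> projects to a faithful element of \<open>U\<close>, so the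
  greedy choice in \<open>summand_Suc\<close> never has to be revised.
\<close>

definition summand :: "(nat \<Rightarrow> 'a) \<Rightarrow> nat \<Rightarrow> bool" where
  "summand \<alpha> k \<longleftrightarrow> indep \<alpha> k \<and> (\<exists>U. submod U \<and> U \<inter> span \<alpha> k = {\<one>} \<and>
     carrier M \<subseteq> span \<alpha> k <#> U \<and> (\<forall>i<k. \<forall>r. act r (\<alpha> i) = \<one> \<longrightarrow> kills r U))"

lemma span_0: "span \<alpha> 0 = {\<one>}"
  by (auto simp: span_def)

lemma summand_0: "summand \<alpha> 0"
  unfolding summand_def indep_def span_0
  by (auto simp: set_mult_iff intro!: exI[of _ "carrier M"])

lemma summand_Suc:
  assumes \<alpha>: "summand \<alpha> k" and a: "a \<in> carrier M" "cyc a \<inter> span \<alpha> k \<subseteq> {\<one>}"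
    and max: "\<And>a'. a' \<in> carrier M \<Longrightarrow> cyc a' \<inter> span \<alpha> k \<subseteq> {\<one>} \<Longrightarrow> card (cyc a') \<le> card (cyc a)"
  shows "summand (\<alpha>(k := a)) (Suc k)"
proof -
  obtain U where ind: "indep \<alpha> k" and U: "submod U" "U \<inter> span \<alpha> k = {\<one>}" "carrier M \<subseteq> span \<alpha> k <#> U"
    and chain: "\<And>i r. i < k \<Longrightarrow> act r (\<alpha> i) = \<one> \<Longrightarrow> kills r U"
    using \<alpha> unfolding summand_def by blast
  have \<alpha>c: "\<And>i. i < k \<Longrightarrow> \<alpha> i \<in> carrier M" using ind unfolding indep_def by blast
  have sp: "submod (span \<alpha> k)" using \<alpha>c by (rule span_submod)
  note UD = submodD[OF U(1)] and SD = submodD[OF sp]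
  obtain s a' where sa: "s \<in> span \<alpha> k" "a' \<in> U" "a = s \<otimes> a'" using U(3) a(1) unfolding set_mult_def by blast
  have sc: "s \<in> carrier M" "a' \<in> carrier M" using sa SD(2) UD(2) by blast+
  \<comment> \<open>As \<open>cyc a\<close> meets the span trivially, the projection to
    \<open>U\<close> is injective on \<open>cyc a\<close>, so \<open>a\<close> and its component
    \<open>a'\<close> have the same annihilator.\<close>
  have ann: "act r a = \<one> \<longleftrightarrow> act r a' = \<one>" for r
  proof
    assume "act r a' = \<one>"
    then have "act r a = act r s" using sa(3) sc by (simp add: act_mult)
    then have "act r a \<in> span \<alpha> k" using SD(5)[OF sa(1)] by simp
    then show "act r a = \<one>" using a(2) unfolding cyc_def by blast
  next
    assume "act r a = \<one>"
    then have "act r a' \<otimes> act r s = \<one>" using sa(3) sc by (simp add: act_mult m_comm)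
    then have "act r a' = inv (act r s)" using sc by (simp add: inv_equality)
    then have "act r a' \<in> span \<alpha> k" using SD(6)[OF SD(5)[OF sa(1)]] by simp
    then have "act r a' \<in> U \<inter> span \<alpha> k" using UD(5)[OF sa(2)] by blast
    then show "act r a' = \<one>" using U(2) by blast
  qed
  \<comment> \<open>An inclusion of annihilators induces a surjection \<open>g\<close> from
    \<open>cyc x\<close> onto \<open>cyc y\<close>; equal cardinalities make it bijective and so
    reverse the inclusion.\<close>
  have card_le: "card (cyc y) \<le> card (cyc x)" and
    inj: "card (cyc x) \<le> card (cyc y) \<Longrightarrow> act r y = \<one> \<Longrightarrow> act r x = \<one>"
    if xy: "x \<in> carrier M" "y \<in> carrier M" "\<And>r. act r x = \<one> \<Longrightarrow> act r y = \<one>" for x y r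
  proof -
    define g where "g z = act (SOME r. act r x = z) y" for z
    have g: "g (act r x) = act r y" for r
    proof -
      define r' where "r' = (SOME r'. act r' x = act r x)"
      have "act r' x = act r x" unfolding r'_def by (rule someI[of _ r]) simp
      then have "act (r' - r) x = \<one>" using xy(1) by (simp add: act_diff)
      then have "act (r' - r) y = \<one>" by (rule xy(3))
      then show ?thesis using xy(2) act_add[of y "r' - r" r] unfolding g_def r'_def by simp
    qed
    have img: "g ` cyc x = cyc y" unfolding cyc_def by (auto simp: g image_image)
    have fin: "finite (cyc x)" using finite_submod submod_cyc xy(1) by blast
    show "card (cyc y) \<le> card (cyc x)" using card_image_le[OF fin, of g] img by simp
    assume "card (cyc x) \<le> card (cyc y)" and r: "act r y = \<one>"
    then have "inj_on g (cyc x)" using fin img card_image_le[OF fin, of g] by (intro eq_card_imp_inj_on) auto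
    moreover have "g (act r x) = g (act 0 x)" using g[of r] g[of 0] r xy(2) by simp
    ultimately have "act r x = act 0 x" unfolding inj_on_def cyc_def by blast
    then show "act r x = \<one>" using xy(1) by simp
  qed
  \<comment> \<open>Comparison with a faithful \<open>u\<close> of \<open>U\<close>: maximality
    gives \<open>card (cyc u) \<le> card (cyc a')\<close>, while everything that kills
    \<open>u\<close> kills \<open>a'\<close>. Hence \<open>a'\<close> is faithful as well, and
    \<open>ex_complement\<close> applies to it inside \<open>U\<close>.\<close>
  obtain u where u: "faithful u U" using ex_faithful[OF U(1)] by blast
  have uU: "u \<in> U" "u \<in> carrier M" using u UD(2) unfolding faithful_def by blast+
  have "cyc u \<inter> span \<alpha> k \<subseteq> {\<one>}" using cyc_subset[OF U(1) uU(1)] U(2) by blast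
  then have "card (cyc u) \<le> card (cyc a)" by (rule max[OF uU(2)])
  also have "\<dots> \<le> card (cyc a')" using card_le[OF sc(2) a(1)] ann by blast
  finally have le: "card (cyc u) \<le> card (cyc a')" .
  have u_a': "act r u = \<one> \<Longrightarrow> act r a' = \<one>" for r
    using u sa(2) unfolding faithful_def kills_def by blast
  have fa': "faithful a' U"
    using inj[OF uU(2) sc(2) u_a' le] u sa(2) unfolding faithful_def by blast
  obtain W where W: "submod W" "W \<subseteq> U" "W \<inter> cyc a' = {\<one>}" "U \<subseteq> cyc a' <#> W"
    using ex_complement[OF U(1) fa'] by blast
  note WD = submodD[OF W(1)]
  define \<alpha>' where "\<alpha>' = \<alpha>(k := a)"
  have comb': "comb t \<alpha>' k = comb t \<alpha> k" for t unfolding \<alpha>'_def by (rule comb_cong) simp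
  have span': "span \<alpha>' (Suc k) = span \<alpha> k <#> cyc a"
    unfolding span_Suc by (simp add: span_def comb') (simp add: \<alpha>'_def)
  have "indep \<alpha>' (Suc k)"
    unfolding indep_def
  proof (intro conjI allI impI)
    fix i assume "i < Suc k"
    then show "\<alpha>' i \<in> carrier M" unfolding \<alpha>'_def using \<alpha>c a(1) by auto
  next
    fix t i assume t: "comb t \<alpha>' (Suc k) = \<one>" and i: "i < Suc k"
    have t': "comb t \<alpha> k \<otimes> act (t k) a = \<one>" using t comb' by (simp add: \<alpha>'_def)
    have cc: "comb t \<alpha> k \<in> span \<alpha> k" unfolding span_def by blast
    have "act (t k) a \<otimes> comb t \<alpha> k = \<one>" using t' cc SD(2) a(1) m_comm by simp
    then have "act (t k) a = inv (comb t \<alpha> k)" using cc SD(2) a(1) by (simp add: inv_equality)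
    then have "act (t k) a \<in> span \<alpha> k" using SD(6)[OF cc] by simp
    then have ta: "act (t k) a = \<one>" using a(2) unfolding cyc_def by blast
    then have "comb t \<alpha> k = \<one>" using t' cc SD(2) by simp
    then show "act (t i) (\<alpha>' i) = \<one>" using ind i ta unfolding indep_def \<alpha>'_def by (cases "i = k") auto
  next
    fix i j r assume *: "i \<le> j" "j < Suc k" "act r (\<alpha>' i) = \<one>"
    show "act r (\<alpha>' j) = \<one>"
    proof (cases "j = k \<and> i \<noteq> k")
      case True
      then have "kills r U" using * chain[of i r] unfolding \<alpha>'_def by auto
      then show ?thesis using True sa(2) ann unfolding kills_def \<alpha>'_def by auto
    next
      case False
      then have "i = j \<or> j < k" using * by linarith
      then show ?thesis using * ind unfolding indep_def \<alpha>'_def by auto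
    qed
  qed
  moreover have "W \<inter> span \<alpha>' (Suc k) = {\<one>}"
  proof -
    have "x = \<one>" if x: "x \<in> W" "x \<in> span \<alpha> k <#> cyc a" for x
    proof -
      obtain s' r where sr: "s' \<in> span \<alpha> k" "x = s' \<otimes> act r a" using x(2) unfolding set_mult_iff cyc_def by blast
      have s'c: "s' \<in> carrier M" and xc: "x \<in> carrier M" using sr(1) SD(2) x(1) WD(2) by blast+
      have "x = (s' \<otimes> act r s) \<otimes> act r a'"
        using sr(2) sa(3) sc s'c by (simp add: act_mult m_assoc)
      \<comment> \<open>The left side lies in \<open>U\<close>, the right side in the span; their
        intersection is trivial, so both vanish.\<close>
      then have eq: "x \<otimes> inv (act r a') = s' \<otimes> act r s" using sc s'c by (simp add: m_assoc)
      moreover have "x \<otimes> inv (act r a') \<in> U" using UD(4,5,6) sa(2) x(1) W(2) by blast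
      moreover have "s' \<otimes> act r s \<in> span \<alpha> k" using SD(4,5) sr(1) sa(1) by blast
      ultimately have "x \<otimes> inv (act r a') = \<one>" using U(2) by auto
      then have "x = act r a'" using xc sc inv_equality[of x "inv (act r a')"] by simp
      then have "x \<in> W \<inter> cyc a'" using x(1) unfolding cyc_def by blast
      then show ?thesis using W(3) by blast
    qed
    moreover have "\<one> \<in> span \<alpha> k <#> cyc a"
      using submodD(3)[OF submod_set_mult[OF sp submod_cyc[OF a(1)]]] .
    ultimately show ?thesis unfolding span' using WD(3) by blast
  qed
  moreover have "carrier M \<subseteq> span \<alpha>' (Suc k) <#> W"
  proof
    fix x assume x: "x \<in> carrier M"
    then obtain s' v where sv: "s' \<in> span \<alpha> k" "v \<in> U" "x = s' \<otimes> v" using U(3) unfolding set_mult_def by blast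
    then obtain r w where rw: "w \<in> W" "v = act r a' \<otimes> w" using W(4) unfolding set_mult_def cyc_def by blast
    have c: "s' \<in> carrier M" "w \<in> carrier M" using sv(1) rw(1) SD(2) WD(2) by blast+
    have "act r a = act r s \<otimes> act r a'" using sa(3) sc by (simp add: act_mult)
    then have "x = (s' \<otimes> inv (act r s)) \<otimes> act r a \<otimes> w"
      using sv(3) rw(2) c sc by (simp add: m_assoc inv_solve_left)
    moreover have "s' \<otimes> inv (act r s) \<in> span \<alpha> k" using SD(4,5,6) sv(1) sa(1) by blast
    ultimately show "x \<in> span \<alpha>' (Suc k) <#> W"
      unfolding span' using rw(1) by (auto simp: set_mult_def cyc_def)
  qed
  moreover have "kills r W" if "i < Suc k" "act r (\<alpha>' i) = \<one>" for i r
  proof (cases "i = k")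
    case True
    then have "kills r U" using that(2) ann fa' unfolding faithful_def \<alpha>'_def by auto
    then show ?thesis using W(2) unfolding kills_def by blast
  next
    case False
    then have "kills r U" using that chain[of i r] unfolding \<alpha>'_def by auto
    then show ?thesis using W(2) unfolding kills_def by blast
  qed
  ultimately show ?thesis unfolding summand_def \<alpha>'_def[symmetric] using W(1) by blast
qed

text \<open>Every element of the complement \<open>U\<close> generates a submodule that misses the
  span, so it is among the excluded candidates.\<close>

lemma summand_full:
  assumes \<alpha>: "summand \<alpha> k"
    and none: "\<And>a. a \<in> carrier M \<Longrightarrow> cyc a \<inter> span \<alpha> k \<subseteq> {\<one>} \<Longrightarrow> a = \<one>"
  shows "span \<alpha> k = carrier M"
proof -
  obtain U where ind: "indep \<alpha> k" and U: "submod U" "U \<inter> span \<alpha> k = {\<one>}" "carrier M \<subseteq> span \<alpha> k <#> U"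
    using \<alpha> unfolding summand_def by blast
  have "\<And>i. i < k \<Longrightarrow> \<alpha> i \<in> carrier M" using ind unfolding indep_def by blast
  then have sp: "submod (span \<alpha> k)" by (rule span_submod)
  have "u = \<one>" if "u \<in> U" for u
    using none[of u] cyc_subset[OF U(1) that] U(2) submodD(2)[OF U(1) that] by blast
  then have "span \<alpha> k <#> U \<subseteq> span \<alpha> k"
    using submodD(2)[OF sp] unfolding set_mult_def by (auto simp del: One_nat_def) (metis r_one)
  then show ?thesis using U(3) submodD(1)[OF sp] by blast
qed

end

text \<open>Two coefficient families of the same element differ by annihilators of the
  \<open>\<alpha> i\<close>; by \<open>ann\<close> these also kill the \<open>\<beta> i\<close>, so
  transporting coefficients is well defined.\<close>

lemma ex_lift:
  fixes act :: "'r::comm_ring_1 \<Rightarrow> 'a \<Rightarrow> 'a" and act' :: "'r \<Rightarrow> 'b \<Rightarrow> 'b"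
  assumes M: "rmod M act" and N: "rmod N act'"
    and \<alpha>: "rmod.indep M act \<alpha> k" "rmod.span M act \<alpha> k = carrier M"
    and \<beta>: "\<And>i. i < k \<Longrightarrow> \<beta> i \<in> carrier N" "rmod.span N act' \<beta> k = carrier N"
    and ann: "\<And>i r. i < k \<Longrightarrow> act r (\<alpha> i) = \<one>\<^bsub>M\<^esub> \<Longrightarrow> act' r (\<beta> i) = \<one>\<^bsub>N\<^esub>"
  shows "\<exists>\<phi>\<in>hom M N. \<phi> ` carrier M = carrier N \<and> (\<forall>t. \<phi> (rmod.comb M act t \<alpha> k) = rmod.comb N act' t \<beta> k) \<and>
    (\<forall>r. \<forall>x\<in>carrier M. \<phi> (act r x) = act' r (\<phi> x))"
proof -
  interpret M: rmod M act by (rule M)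
  interpret N: rmod N act' by (rule N)
  have \<alpha>c: "\<And>j. j < k \<Longrightarrow> \<alpha> j \<in> carrier M" using \<alpha>(1) unfolding M.indep_def by blast
  define \<phi> where "\<phi> x = N.comb (SOME t. M.comb t \<alpha> k = x) \<beta> k" for x
  have \<phi>: "\<phi> (M.comb t \<alpha> k) = N.comb t \<beta> k" for t
  proof -
    define t' where "t' = (SOME t'. M.comb t' \<alpha> k = M.comb t \<alpha> k)"
    have t': "M.comb t' \<alpha> k = M.comb t \<alpha> k" unfolding t'_def by (rule someI[of _ t]) simp
    have "act' (t' i) (\<beta> i) = act' (t i) (\<beta> i)" if i: "i < k" for i
    proof -
      have "act (t' i - t i) (\<alpha> i) = \<one>\<^bsub>M\<^esub>"
        using M.indep_eq[OF \<alpha>(1) t' i] \<alpha>c[OF i] by (simp add: M.act_diff)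
      then have "act' (t' i - t i) (\<beta> i) = \<one>\<^bsub>N\<^esub>" by (rule ann[OF i])
      then show ?thesis using \<beta>(1)[OF i] N.act_add[of "\<beta> i" "t' i - t i" "t i"] by simp
    qed
    then have "N.comb t' \<beta> k = N.comb t \<beta> k" by (rule N.comb_cong)
    then show ?thesis unfolding \<phi>_def t'_def .
  qed
  have ex: "\<exists>t. x = M.comb t \<alpha> k" if "x \<in> carrier M" for x
    using that unfolding \<alpha>(2)[symmetric] M.span_def by blast
  have "\<phi> \<in> hom M N"
  proof (rule homI)
    fix x assume "x \<in> carrier M"
    then show "\<phi> x \<in> carrier N" using ex[of x] \<phi> \<beta>(1) by force
  next
    fix x y assume "x \<in> carrier M" "y \<in> carrier M"
    then obtain t u where "x = M.comb t \<alpha> k" "y = M.comb u \<alpha> k" using ex by blast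
    then show "\<phi> (x \<otimes>\<^bsub>M\<^esub> y) = \<phi> x \<otimes>\<^bsub>N\<^esub> \<phi> y" using \<alpha>c \<beta>(1) by (simp add: M.comb_add N.comb_add \<phi>)
  qed
  moreover have "\<phi> ` carrier M = carrier N"
    unfolding \<alpha>(2)[symmetric] \<beta>(2)[symmetric] M.span_def N.span_def by (simp add: image_image \<phi>)
  moreover have "\<phi> (act r x) = act' r (\<phi> x)" if x: "x \<in> carrier M" for r x
  proof -
    obtain t where "x = M.comb t \<alpha> k" using ex[OF x] by blast
    then show ?thesis using \<alpha>c \<beta>(1) by (simp add: M.comb_act N.comb_act \<phi>)
  qed
  ultimately show ?thesis using \<phi> by blast
qed

section \<open>Endomorphisms as polynomial actions\<close>

text \<open>The additivity of the Frobenius map, with its error term kept as an explicit multiple of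
  \<open>p\<close> because the ring does not have characteristic \<open>p\<close>.\<close>

lemma binomial_prime_power:
  fixes u v :: "'r::comm_ring_1"
  assumes "prime p"
  shows "\<exists>w. (u + v) ^ p = u ^ p + v ^ p + of_nat p * w"
proof -
  have p: "p \<ge> 1" using assms prime_ge_1_nat by blast
  have "\<exists>w. of_nat (p choose k) * u ^ k * v ^ (p - k) = of_nat p * w" if "k \<in> {0<..<p}" for k
  proof -
    have "p dvd (p choose k)" using that assms by (intro dvd_choose_prime) auto
    then obtain m where "p choose k = p * m" by blast
    then show ?thesis by (intro exI[of _ "of_nat m * u ^ k * v ^ (p - k)"]) (simp add: mult.assoc)
  qed
  then obtain w where w: "\<And>k. k \<in> {0<..<p} \<Longrightarrow> of_nat (p choose k) * u ^ k * v ^ (p - k) = of_nat p * w k"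
    by metis
  have split: "{..p} = insert 0 (insert p {0<..<p})" using p by auto
  have "(u + v) ^ p = (\<Sum>k\<le>p. of_nat (p choose k) * u ^ k * v ^ (p - k))" by (rule binomial_ring)
  also have "\<dots> = v ^ p + (u ^ p + (\<Sum>k\<in>{0<..<p}. of_nat (p choose k) * u ^ k * v ^ (p - k)))"
    unfolding split using p by simp
  also have "(\<Sum>k\<in>{0<..<p}. of_nat (p choose k) * u ^ k * v ^ (p - k)) = (\<Sum>k\<in>{0<..<p}. of_nat p * w k)"
    using w by (rule sum.cong[OF refl])
  finally show ?thesis by (intro exI[of _ "\<Sum>k\<in>{0<..<p}. w k"]) (simp add: sum_distrib_left algebra_simps)
qed

lemma binomial_prime_power_power:
  fixes u v :: "'r::comm_ring_1"
  assumes "prime p"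
  shows "\<exists>w. (u + v) ^ p ^ t = u ^ p ^ t + v ^ p ^ t + of_nat p * w"
proof (induction t)
  case (Suc t)
  then obtain w where w: "(u + v) ^ p ^ t = u ^ p ^ t + v ^ p ^ t + of_nat p * w" by blast
  let ?U = "u ^ p ^ t" and ?V = "v ^ p ^ t"
  obtain w1 where w1: "(?U + ?V) ^ p = ?U ^ p + ?V ^ p + of_nat p * w1"
    using binomial_prime_power[OF assms] by blast
  obtain w2 where w2: "(?U + ?V + of_nat p * w) ^ p = (?U + ?V) ^ p + (of_nat p * w) ^ p + of_nat p * w2"
    using binomial_prime_power[OF assms] by blast
  obtain n where n: "p = Suc n" using prime_gt_0_nat[OF assms] by (cases p) auto
  have w3: "(of_nat p * w) ^ p = of_nat p * (w * (of_nat p * w) ^ n)"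
    by (subst (2) n) (simp add: mult.assoc)
  have "(u + v) ^ p ^ Suc t = ((u + v) ^ p ^ t) ^ p" by (simp add: mult.commute flip: power_mult)
  also have "\<dots> = ?U ^ p + ?V ^ p + of_nat p * (w1 + w * (of_nat p * w) ^ n + w2)"
    unfolding w w2 w1 w3 by (simp add: algebra_simps)
  also have "\<dots> = u ^ p ^ Suc t + v ^ p ^ Suc t + of_nat p * (w1 + w * (of_nat p * w) ^ n + w2)"
    by (simp add: mult.commute flip: power_mult)
  finally show ?case by blast
qed (auto intro: exI[of _ 0])

text \<open>For \<open>q = p ^ totient h\<close>, Euler's theorem gives \<open>h dvd q - 1\<close>,
  so \<open>X ^ q - X\<close> is a multiple of \<open>X ^ h - 1\<close>. Modulo \<open>p\<close> the
  \<open>q\<close>-th power is additive. Hence the polynomials with \<open>r ^ q\<close> congruent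
  to \<open>r\<close> modulo the ideal of \<open>p\<close> and \<open>X ^ h - 1\<close> form a
  subring containing \<open>X\<close>, which is everything.\<close>

lemma int_poly_frobenius:
  assumes p: "prime p" and h: "coprime p h"
  shows "\<exists>q>1. \<forall>r::int poly. \<exists>w w'. r ^ q = r + of_nat p * w + ([:0, 1:] ^ h - 1) * w'"
proof -
  \<comment> \<open>The value for \<open>h = 0\<close> only keeps the exponent positive until
    coprimality with \<open>p\<close> excludes that case.\<close>
  define t where "t = (if h = 0 then 1 else totient h)"
  define q where "q = p ^ t"
  define J where "J z \<longleftrightarrow> (\<exists>w w'. z = of_nat p * w + ([:0, 1:] ^ h - 1) * w')" for z :: "int poly"
  have "t > 0" by (simp add: t_def)
  then have q: "q > 1" unfolding q_def using prime_gt_1_nat[OF p] one_less_power by blast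
  have h0: "h \<noteq> 0" using h prime_gt_1_nat[OF p] by (metis coprime_0_right_iff nat_dvd_1_iff_1 nat_neq_iff)
  have "[q = 1] (mod h)" unfolding q_def t_def using euler_theorem[OF h] h0 by simp
  then have "h dvd q - 1" using q by (simp add: cong_altdef_nat)
  then obtain s where s: "q - 1 = h * s" by blast
  have J_p: "J (of_nat p * w)" for w unfolding J_def by (metis add.right_neutral mult_zero_right)
  have J_add: "J (x + y)" if xy: "J x" "J y" for x y
  proof -
    obtain u u' v v' where "x = of_nat p * u + ([:0, 1:] ^ h - 1) * u'" "y = of_nat p * v + ([:0, 1:] ^ h - 1) * v'"
      using xy unfolding J_def by blast
    then have "x + y = of_nat p * (u + v) + ([:0, 1:] ^ h - 1) * (u' + v')"
      by (simp only: distrib_left add_ac)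
    then show ?thesis unfolding J_def by blast
  qed
  have J_mult: "J (x * y)" if y: "J y" for x y
  proof -
    obtain v v' where "y = of_nat p * v + ([:0, 1:] ^ h - 1) * v'" using y unfolding J_def by blast
    then have "x * y = of_nat p * (x * v) + ([:0, 1:] ^ h - 1) * (x * v')"
      by (simp only: distrib_left mult_ac)
    then show ?thesis unfolding J_def by blast
  qed
  have J_neg: "J (- y)" if "J y" for y using J_mult[OF that, of "- 1"] by simp
  define T where "T r \<longleftrightarrow> J (r ^ q - r)" for r
  have T_add: "T (u + v)" if uv: "T u" "T v" for u v
  proof -
    obtain w where w: "(u + v) ^ q = u ^ q + v ^ q + of_nat p * w"
      using binomial_prime_power_power[OF p] unfolding q_def by blast
    have "(u + v) ^ q - (u + v) = (u ^ q - u) + ((v ^ q - v) + of_nat p * w)" unfolding w by simp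
    then show ?thesis using uv J_add J_p unfolding T_def by metis
  qed
  have T_mult: "T (u * v)" if uv: "T u" "T v" for u v
  proof -
    have "(u * v) ^ q - u * v = u ^ q * (v ^ q - v) + v * (u ^ q - u)"
      by (simp add: power_mult_distrib algebra_simps)
    then show ?thesis using uv J_add J_mult unfolding T_def by metis
  qed
  have T_0: "T 0" unfolding T_def J_def using q by (intro exI[of _ 0]) (simp add: zero_power)
  have T_1: "T 1" unfolding T_def J_def by (intro exI[of _ 0]) simp
  have T_neg: "T (- u)" if "T u" for u
  proof -
    \<comment> \<open>Expanding \<open>(u + - u) ^ q = 0\<close> treats even and odd
      \<open>q\<close> alike.\<close>
    obtain w where w: "(u + - u) ^ q = u ^ q + (- u) ^ q + of_nat p * w"
      using binomial_prime_power_power[OF p] unfolding q_def by blast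
    have "(- u) ^ q - (- u) = - (u ^ q - u) + of_nat p * (- w)"
      using w q by (simp add: zero_power algebra_simps)
    then show ?thesis using that J_add J_p J_neg unfolding T_def by metis
  qed
  have T_nat: "T (of_nat n)" for n by (induction n) (simp_all add: T_0 T_add T_1)
  have T_int: "T (of_int k)" for k by (cases k) (auto intro: T_neg simp: T_nat simp del: of_nat_Suc)
  have T_X: "T [:0, 1:]"
  proof -
    let ?X = "[:0, 1:] :: int poly"
    have "?X ^ q - ?X = ?X * ((?X ^ h) ^ s - 1)"
      using q s by (cases q) (simp_all add: algebra_simps flip: power_mult)
    also have "(?X ^ h) ^ s - 1 = (?X ^ h - 1) * (\<Sum>i<s. (?X ^ h) ^ i)" by (rule power_diff_1_eq)
    finally have "?X ^ q - ?X = of_nat p * 0 + ([:0, 1:] ^ h - 1) * (?X * (\<Sum>i<s. (?X ^ h) ^ i))"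
      by (simp only: mult_zero_right add_0_left mult.left_commute)
    then show ?thesis unfolding T_def J_def by blast
  qed
  have "T r" for r
  proof (induction r)
    case (pCons k r)
    have "pCons k r = of_int k + [:0, 1:] * r" by (simp add: of_int_poly)
    then show ?case using T_add T_mult T_X T_int pCons by metis
  qed (rule T_0)
  then show ?thesis using q unfolding T_def J_def by (intro exI[of _ q]) (metis add.assoc diff_eq_eq add.commute)
qed

text \<open>
  The indeterminate acts as \<open>\<chi>\<close>, so this is the group ring action of a cyclic group generated by \<open>\<chi>\<close>.
\<close>

definition poly_act :: "('a, 'm) monoid_scheme \<Rightarrow> ('a \<Rightarrow> 'a) \<Rightarrow> int poly \<Rightarrow> 'a \<Rightarrow> 'a" where
  "poly_act M \<chi> p x = fold_coeffs (\<lambda>k y. x [^]\<^bsub>M\<^esub> k \<otimes>\<^bsub>M\<^esub> \<chi> y) p \<one>\<^bsub>M\<^esub>"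

locale endo = comm_group M for M (structure) +
  fixes \<chi>
  assumes endo: "\<chi> \<in> hom M M"
begin

abbreviation "pact \<equiv> poly_act M \<chi>"

lemma endo_closed [simp]: "x \<in> carrier M \<Longrightarrow> \<chi> x \<in> carrier M"
  using endo by (rule hom_in_carrier)

lemma endo_mult: "x \<in> carrier M \<Longrightarrow> y \<in> carrier M \<Longrightarrow> \<chi> (x \<otimes> y) = \<chi> x \<otimes> \<chi> y"
  using endo by (rule hom_mult)

lemma endo_one [simp]: "\<chi> \<one> = \<one>"
  using hom_one[OF endo] is_group by blast

lemma pact_0 [simp]: "pact 0 x = \<one>"
  by (simp add: poly_act_def)

lemma pact_pCons: "pact (pCons k p) x = x [^] k \<otimes> \<chi> (pact p x)"
  by (cases "p = 0 \<and> k = 0") (auto simp: poly_act_def)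

lemma pact_closed [simp]: "x \<in> carrier M \<Longrightarrow> pact p x \<in> carrier M"
  by (induction p) (simp_all add: pact_pCons)

lemma pact_mult_right:
  assumes "x \<in> carrier M" "y \<in> carrier M"
  shows "pact p (x \<otimes> y) = pact p x \<otimes> pact p y"
  using assms by (induction p) (simp_all add: pact_pCons endo_mult int_pow_distrib m_ac)

lemma pact_add:
  assumes "x \<in> carrier M"
  shows "pact (p + q) x = pact p x \<otimes> pact q x"
proof (induction p q rule: poly_induct2)
  case (pCons k p l q)
  then show ?case using assms by (simp add: pact_pCons endo_mult int_pow_mult m_ac)
qed (use assms in simp)

lemma pact_smult:
  assumes "x \<in> carrier M"
  shows "pact (Polynomial.smult k p) x = pact p x [^] k"
proof (induction p)
  case (pCons l p)
  have "\<chi> (pact p x [^] k) = \<chi> (pact p x) [^] k"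
    using hom_int_pow[OF endo] assms is_group by simp
  then show ?case using pCons assms
    by (simp add: pact_pCons int_pow_distrib int_pow_pow mult.commute)
qed simp

lemma pact_times:
  assumes "x \<in> carrier M"
  shows "pact (p * q) x = pact p (pact q x)"
proof (induction p)
  case (pCons k p)
  have "pact (pCons k p * q) x = pact q x [^] k \<otimes> \<chi> (pact (p * q) x)"
    using assms by (simp add: mult_pCons_left pact_add pact_smult pact_pCons)
  then show ?case using pCons by (simp add: pact_pCons)
qed simp

lemma pact_X_power: "x \<in> carrier M \<Longrightarrow> pact ([:0, 1:] ^ n) x = (\<chi> ^^ n) x"
proof (induction n)
  case 0
  then show ?case by (simp add: one_pCons pact_pCons)
next
  case (Suc n)
  then have "(\<chi> ^^ n) x \<in> carrier M" by (metis pact_closed)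
  then show ?case using Suc pact_times[of x "[:0, 1:]" "[:0, 1:] ^ n"] by (simp add: pact_pCons)
qed

text \<open>The place where coprimality enters: a prime dividing \<open>e\<close> is prime to
  \<open>h\<close>, and \<open>X ^ h - 1\<close> acts as zero because \<open>\<chi> ^^ h\<close> is
  the identity. The polynomial congruence then collapses to \<open>frob\<close>.\<close>

lemma coprime_rmod_pact:
  assumes fin: "finite (carrier M)" and e: "e > 0" "\<And>x. x \<in> carrier M \<Longrightarrow> x [^] (e::nat) = \<one>"
    and h: "coprime e h" "\<And>x. x \<in> carrier M \<Longrightarrow> (\<chi> ^^ h) x = x"
  shows "coprime_rmod M pact e"
proof -
  interpret rmod M pact
  proof
    fix x assume "x \<in> carrier M"
    then show "pact 1 x = x" by (simp add: one_pCons pact_pCons)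
  qed (simp_all add: pact_mult_right pact_add pact_times)
  have zero: "pact ([:0, 1:] ^ h - 1) x = \<one>" if "x \<in> carrier M" for x
    using that h(2) by (simp add: act_diff pact_X_power)
  show ?thesis
  proof
    fix x assume x: "x \<in> carrier M"
    have "(of_nat e :: int poly) = [:int e:]" by (simp only: of_nat_poly)
    then have "pact (of_nat e) x = x [^] int e \<otimes> \<chi> (pact 0 x)" by (simp only: pact_pCons)
    then show "pact (of_nat e) x = \<one>" using e(2)[OF x] by (simp add: int_pow_int)
  next
    fix p assume p: "prime p" "p dvd e"
    have "coprime p h" by (rule coprime_divisors[OF p(2) dvd_refl h(1)])
    then obtain q where q: "q > 1" "\<forall>r::int poly. \<exists>w w'. r ^ q = r + of_nat p * w + ([:0, 1:] ^ h - 1) * w'"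
      using int_poly_frobenius[OF p(1)] by blast
    fix r :: "int poly"
    obtain w w' where w: "r ^ q = r + of_nat p * w + ([:0, 1:] ^ h - 1) * w'" using q(2) by blast
    have "pact (r ^ q) x = pact (r + of_nat p * w) x" if "x \<in> carrier M" for x
      unfolding w using that zero by (simp add: act_add act_times)
    then show "\<exists>q w. q > 1 \<and> (\<forall>x\<in>carrier M. pact (r ^ q) x = pact (r + of_nat p * w) x)"
      using q(1) by blast
  qed (use fin e in auto)
qed

end

section \<open>Epimorphisms from coprime semidirect products\<close>

text \<open>
  Conjugation by \<open>(c, d)\<close> is expressed without inverses, because the multiplication tables do not
  provide them directly.
\<close>

inductive_set pair_closure ::
  "('a, 'm) monoid_scheme \<Rightarrow> ('b, 'n) monoid_scheme \<Rightarrow> 'a \<Rightarrow> 'b \<Rightarrow> ('a \<times> 'b) set \<Rightarrow> ('a \<times> 'b) set"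
  for G1 :: "('a, 'm) monoid_scheme" and G2 :: "('b, 'n) monoid_scheme" and c d S where
  base: "x \<in> S \<Longrightarrow> x \<in> pair_closure G1 G2 c d S"
| mult: "(x, y) \<in> pair_closure G1 G2 c d S \<Longrightarrow> (u, v) \<in> pair_closure G1 G2 c d S \<Longrightarrow>
    (x \<otimes>\<^bsub>G1\<^esub> u, y \<otimes>\<^bsub>G2\<^esub> v) \<in> pair_closure G1 G2 c d S"
| conj: "(x, y) \<in> pair_closure G1 G2 c d S \<Longrightarrow> u \<in> carrier G1 \<Longrightarrow> v \<in> carrier G2 \<Longrightarrow>
    u \<otimes>\<^bsub>G1\<^esub> c = c \<otimes>\<^bsub>G1\<^esub> x \<Longrightarrow> v \<otimes>\<^bsub>G2\<^esub> d = d \<otimes>\<^bsub>G2\<^esub> y \<Longrightarrow> (u, v) \<in> pair_closure G1 G2 c d S"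

definition pair_closed ::
  "('a, 'm) monoid_scheme \<Rightarrow> ('b, 'n) monoid_scheme \<Rightarrow> 'a \<Rightarrow> 'b \<Rightarrow> ('a \<times> 'b) set \<Rightarrow> bool" where
  "pair_closed G1 G2 c d X \<longleftrightarrow>
    (\<forall>x y u v. (x, y) \<in> X \<longrightarrow> (u, v) \<in> X \<longrightarrow> (x \<otimes>\<^bsub>G1\<^esub> u, y \<otimes>\<^bsub>G2\<^esub> v) \<in> X) \<and>
    (\<forall>x y u v. (x, y) \<in> X \<longrightarrow> u \<in> carrier G1 \<longrightarrow> v \<in> carrier G2 \<longrightarrow>
      u \<otimes>\<^bsub>G1\<^esub> c = c \<otimes>\<^bsub>G1\<^esub> x \<longrightarrow> v \<otimes>\<^bsub>G2\<^esub> d = d \<otimes>\<^bsub>G2\<^esub> y \<longrightarrow> (u, v) \<in> X)"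

lemma pair_closure_least:
  assumes "S \<subseteq> X" "pair_closed G1 G2 c d X"
  shows "pair_closure G1 G2 c d S \<subseteq> X"
proof (rule subrelI)
  fix x y assume "(x, y) \<in> pair_closure G1 G2 c d S"
  then show "(x, y) \<in> X"
  proof (induction rule: pair_closure.induct[split_format (complete)])
    case (base x y)
    then show ?case using assms(1) by blast
  qed (use assms(2) in \<open>unfold pair_closed_def, blast+\<close>)
qed

lemma pair_closed_closure: "pair_closed G1 G2 c d (pair_closure G1 G2 c d S)"
  unfolding pair_closed_def using pair_closure.mult pair_closure.conj by metis

text \<open>Replaces integer exponents by natural ones, since closure under multiplication alone
  provides no inverses.\<close>

lemma (in group) pow_mod_eq:
  assumes "x \<in> carrier G" "x [^] (m::nat) = \<one>"
  shows "x [^] (k * m + n) = x [^] n" "m > 0 \<Longrightarrow> x [^] (j::int) = x [^] nat (j mod int m)"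
proof -
  have *: "x [^] (int m * j) = \<one>" for j
    using assms by (metis int_pow_int int_pow_one int_pow_pow)
  show "x [^] (k * m + n) = x [^] n"
  proof -
    have "x [^] (k * m) = \<one>"
      using nat_pow_pow[OF assms(1), of m k] by (simp only: assms(2) nat_pow_one mult.commute)
    then show ?thesis using assms(1) by (simp flip: nat_pow_mult)
  qed
  assume m: "m > 0"
  have "x [^] j = x [^] (int m * (j div int m) + j mod int m)" by simp
  also have "\<dots> = x [^] (j mod int m)" using assms(1) * by (simp only: int_pow_mult) simp
  also have "\<dots> = x [^] int (nat (j mod int m))" using m by simp
  finally show "x [^] j = x [^] nat (j mod int m)" by (simp only: int_pow_int)
qed

section \<open>Coprime semidirect products and their images\<close>

locale semidirect =
  fixes G1 :: "('a, 'm) monoid_scheme" (structure) and A :: "'a set" and c :: 'a and m h :: nat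
  assumes normal_A: "A \<lhd> G1"
    and fin1: "finite (carrier G1)"
    and comm_A: "comm_group (G1\<lparr>carrier := A\<rparr>)"
    and c: "c \<in> carrier G1"
    and decomp: "x \<in> carrier G1 \<Longrightarrow> \<exists>u\<in>A. \<exists>n::nat. x = u \<otimes> c [^] n"
    and inter: "c [^] (n::nat) \<in> A \<Longrightarrow> c [^] n = \<one>"
    and pow_A: "u \<in> A \<Longrightarrow> u [^] m = \<one>"
    and pow_c: "c [^] h = \<one>"
    and coprime: "coprime m h"
    and m_pos: "m > 0"
begin

sublocale G1: group G1 using normal_A by (simp add: normal_def)

sublocale A: normal A G1 by (rule normal_A)

end

text \<open>A hypothetical epimorphism \<open>f\<close>, needed only as a witness. The numbers
  \<open>m\<close> and \<open>h\<close> are exponents, not orders: exponents pass to the images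
  \<open>B\<close> and \<open>d\<close>, whose orders may be smaller than those of \<open>A\<close>
  and \<open>c\<close>.\<close>

locale semidirect_epi = semidirect G1 A c m h + G2: group G2
  for G1 :: "('a, 'm) monoid_scheme" (structure) and A c m h and G2 :: "('b, 'n) monoid_scheme" +
  fixes f
  assumes epi_f: "f \<in> epi G1 G2"
begin

sublocale f: group_hom G1 G2 f
  using epi_f by unfold_locales (auto simp: epi_def)

definition "B = f ` A"
definition "d = f c"

lemma A_sub: "x \<in> A \<Longrightarrow> x \<in> carrier G1"
  using A.subset by blast

lemma f_surj: "f ` carrier G1 = carrier G2"
  using epi_f by (auto simp: epi_def)

lemma B_subgroup: "subgroup B G2"
  unfolding B_def by (rule f.subgroup_img_is_subgroup) (rule A.is_subgroup)

lemma B_sub: "x \<in> B \<Longrightarrow> x \<in> carrier G2"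
  using subgroup.subset[OF B_subgroup] by blast

lemma d: "d \<in> carrier G2"
  unfolding d_def using c by simp

lemma pow_B: "y \<in> B \<Longrightarrow> y [^]\<^bsub>G2\<^esub> m = \<one>\<^bsub>G2\<^esub>"
  unfolding B_def using A_sub pow_A by (auto simp flip: f.hom_nat_pow)

text \<open>Makes \<open>B\<close> computable from \<open>m\<close> without knowledge of
  \<open>f\<close>. An element \<open>y\<close> with \<open>y ^ m = 1\<close> is the image of
  \<open>u \<otimes> v\<close> with \<open>u\<close> in \<open>A\<close> and \<open>v\<close> a
  power of \<open>c\<close>. Its \<open>m\<close>-th power puts \<open>f v ^ m\<close> into
  \<open>B\<close>, and \<open>m\<close> is invertible modulo the exponent \<open>h\<close> of
  \<open>f v\<close>, so \<open>f v\<close> lies in \<open>B\<close> too.\<close>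

lemma B_eq: "B = {y \<in> carrier G2. y [^]\<^bsub>G2\<^esub> m = \<one>\<^bsub>G2\<^esub>}"
proof (intro equalityI subsetI)
  fix y assume y: "y \<in> {y \<in> carrier G2. y [^]\<^bsub>G2\<^esub> m = \<one>\<^bsub>G2\<^esub>}"
  then obtain x where x: "x \<in> carrier G1" "y = f x" using f_surj by blast
  obtain u n where un: "u \<in> A" "x = u \<otimes> c [^] (n::nat)" using decomp[OF x(1)] by blast
  define v where "v = c [^] n"
  have vc: "v \<in> carrier G1" unfolding v_def using c by simp
  \<comment> \<open>Normality of \<open>A\<close> allows all factors from \<open>A\<close> to be
    collected on the left.\<close>
  have "\<exists>u'\<in>A. x [^] k = u' \<otimes> v [^] k" for k :: nat
  proof (induction k)
    case 0
    then show ?case using A.one_closed by force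
  next
    case (Suc k)
    then obtain u' where u': "u' \<in> A" "x [^] k = u' \<otimes> v [^] k" by blast
    define w where "w = v [^] k"
    have wc: "w \<in> carrier G1" unfolding w_def using vc by simp
    have uc: "u \<in> carrier G1" "u' \<in> carrier G1" using un(1) u'(1) A_sub by blast+
    have "x [^] Suc k = (u' \<otimes> w) \<otimes> (u \<otimes> v)"
      using u'(2) un(2) by (simp add: w_def v_def)
    also have "\<dots> = (u' \<otimes> (w \<otimes> u \<otimes> inv w)) \<otimes> (w \<otimes> v)"
      using wc uc vc by (simp add: G1.m_assoc G1.inv_solve_left)
    finally have "x [^] Suc k = (u' \<otimes> (w \<otimes> u \<otimes> inv w)) \<otimes> v [^] Suc k"
      by (simp add: w_def)
    moreover have "u' \<otimes> (w \<otimes> u \<otimes> inv w) \<in> A"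
      using u'(1) A.inv_op_closed2[OF wc un(1)] A.m_closed by blast
    ultimately show ?case by blast
  qed
  then obtain u' where u': "u' \<in> A" "x [^] m = u' \<otimes> v [^] m" by blast
  have "f (x [^] m) = \<one>\<^bsub>G2\<^esub>" using y x by (simp add: f.hom_nat_pow)
  then have "f u' \<otimes>\<^bsub>G2\<^esub> f v [^]\<^bsub>G2\<^esub> m = \<one>\<^bsub>G2\<^esub>"
    using u' vc A_sub by (simp add: f.hom_nat_pow)
  then have "f v [^]\<^bsub>G2\<^esub> m = inv\<^bsub>G2\<^esub> (f u')"
    using u'(1) vc A_sub by (metis G2.inv_equality G2.inv_inv G2.nat_pow_closed f.hom_closed G2.inv_closed)
  then have fvm: "f v [^]\<^bsub>G2\<^esub> m \<in> B"
    using u'(1) subgroup.m_inv_closed[OF B_subgroup] unfolding B_def by simp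
  obtain s where s: "[m * s = 1] (mod h)" using cong_solve_coprime_nat[OF coprime] by auto
  have vh: "v [^] h = \<one>"
  proof -
    have "v [^] h = (c [^] h) [^] n"
      unfolding v_def G1.nat_pow_pow[OF c] by (simp only: mult.commute)
    then show ?thesis by (simp only: pow_c G1.nat_pow_one)
  qed
  have "f v = (f v [^]\<^bsub>G2\<^esub> m) [^]\<^bsub>G2\<^esub> s"
  proof -
    have fvh: "f v [^]\<^bsub>G2\<^esub> h = \<one>\<^bsub>G2\<^esub>" using vh vc by (simp flip: f.hom_nat_pow)
    have *: "f v [^]\<^bsub>G2\<^esub> a = f v [^]\<^bsub>G2\<^esub> (a mod h)" for a :: nat
      using G2.pow_mod_eq(1)[of "f v" h "a div h" "a mod h"] fvh vc by simp
    have "f v [^]\<^bsub>G2\<^esub> (m * s) = f v [^]\<^bsub>G2\<^esub> (1::nat)"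
      using *[of "m * s"] *[of 1] s unfolding cong_def by metis
    then show ?thesis using vc by (simp add: G2.nat_pow_pow)
  qed
  moreover have "(f v [^]\<^bsub>G2\<^esub> m) [^]\<^bsub>G2\<^esub> s \<in> B"
    using fvm G2.subgroup_int_pow_closed[OF B_subgroup, of _ "int s"] by (simp add: int_pow_int)
  ultimately have "f v \<in> B" by simp
  then have "f u \<otimes>\<^bsub>G2\<^esub> f v \<in> B"
    using un(1) subgroup.m_closed[OF B_subgroup] unfolding B_def by blast
  then show "y \<in> B" using x(2) un A_sub vc unfolding v_def by simp
qed (use B_sub pow_B in blast)

definition "M = G1\<lparr>carrier := A\<rparr>"
definition "N = G2\<lparr>carrier := B\<rparr>"
definition "\<chi>1 x = c \<otimes> x \<otimes> inv c"
definition "\<chi>2 y = d \<otimes>\<^bsub>G2\<^esub> y \<otimes>\<^bsub>G2\<^esub> inv\<^bsub>G2\<^esub> d"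
abbreviation "act1 \<equiv> poly_act M \<chi>1"
abbreviation "act2 \<equiv> poly_act N \<chi>2"

lemma M_simps [simp]: "carrier M = A" "x \<otimes>\<^bsub>M\<^esub> y = x \<otimes> y" "\<one>\<^bsub>M\<^esub> = \<one>"
  "x [^]\<^bsub>M\<^esub> (n::nat) = x [^] n"
  by (simp_all add: M_def G1.nat_pow_consistent[symmetric])

lemma N_simps [simp]: "carrier N = B" "x \<otimes>\<^bsub>N\<^esub> y = x \<otimes>\<^bsub>G2\<^esub> y" "\<one>\<^bsub>N\<^esub> = \<one>\<^bsub>G2\<^esub>"
  "x [^]\<^bsub>N\<^esub> (n::nat) = x [^]\<^bsub>G2\<^esub> n"
  by (simp_all add: N_def G2.nat_pow_consistent[symmetric])

lemma f_chi: "x \<in> carrier G1 \<Longrightarrow> f (\<chi>1 x) = \<chi>2 (f x)"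
  using c unfolding \<chi>1_def \<chi>2_def d_def by simp

lemma chi_mult:
  "x \<in> carrier G1 \<Longrightarrow> y \<in> carrier G1 \<Longrightarrow> \<chi>1 (x \<otimes> y) = \<chi>1 x \<otimes> \<chi>1 y"
  using c unfolding \<chi>1_def by (simp add: G1.m_assoc G1.inv_solve_left)

lemma chi_mult_c:
  "z \<in> carrier G1 \<Longrightarrow> w \<in> carrier G1 \<Longrightarrow>
    \<chi>1 z \<otimes> (c \<otimes> w) = c \<otimes> (z \<otimes> w)"
  using c G1.m_assoc[of "inv c" c w] unfolding \<chi>1_def by (simp add: G1.m_assoc)

lemma chi_A: "x \<in> A \<Longrightarrow> \<chi>1 x \<in> A"
  using A.inv_op_closed2 c unfolding \<chi>1_def by blast

text \<open>Moving \<open>c ^ n\<close> past \<open>x\<close> states iterated conjugation without an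
  inverse of \<open>c ^ n\<close>. At \<open>n = h\<close> it says that the \<open>h\<close>-th
  iterate of \<open>\<chi>1\<close> is trivial.\<close>

lemma chi_pow: "x \<in> carrier G1 \<Longrightarrow> (\<chi>1 ^^ n) x \<otimes> c [^] n = c [^] n \<otimes> x"
  "x \<in> carrier G1 \<Longrightarrow> (\<chi>1 ^^ n) x \<in> carrier G1"
proof (induction n)
  case (Suc n)
  { case 2
    then show ?case using Suc(2) c by (simp add: \<chi>1_def)
  next
    case 1
    have cc: "c [^] Suc n = c \<otimes> c [^] n" using c G1.nat_pow_Suc2 by simp
    have "(\<chi>1 ^^ Suc n) x \<otimes> c [^] Suc n = c \<otimes> ((\<chi>1 ^^ n) x \<otimes> c [^] n)"
      using chi_mult_c[OF Suc(2)[OF 1], of "c [^] n"] c unfolding cc by simp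
    also have "\<dots> = c [^] Suc n \<otimes> x"
      using Suc(1)[OF 1] 1 c unfolding cc by (simp add: G1.m_assoc)
    finally show ?case . }
qed simp_all

sublocale M_endo: endo M \<chi>1
proof -
  interpret comm_group M using comm_A by (simp add: M_def)
  show "endo M \<chi>1"
    by unfold_locales (auto simp: hom_def chi_A chi_mult A_sub)
qed

lemma comm_group_N: "comm_group N"
proof (rule group.group_comm_groupI)
  show "group N" unfolding N_def by (rule subgroup.subgroup_is_group[OF B_subgroup G2.is_group])
  fix x y assume "x \<in> carrier N" "y \<in> carrier N"
  then obtain u v where uv: "u \<in> A" "v \<in> A" "x = f u" "y = f v" by (auto simp: B_def)
  have "u \<otimes> v = v \<otimes> u" using M_endo.m_comm[of u v] uv(1,2) by simp
  then show "x \<otimes>\<^bsub>N\<^esub> y = y \<otimes>\<^bsub>N\<^esub> x" using uv A_sub by (simp flip: f.hom_mult)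
qed

sublocale N_endo: endo N \<chi>2
proof -
  interpret comm_group N by (rule comm_group_N)
  have "\<chi>2 y \<in> B" if "y \<in> B" for y
    using that chi_A f_chi A_sub unfolding B_def by (auto simp flip: f_chi)
  then show "endo N \<chi>2"
    using d by unfold_locales (auto simp: hom_def \<chi>2_def B_sub G2.m_assoc G2.inv_solve_left)
qed

sublocale M: coprime_rmod M act1 m
proof (rule M_endo.coprime_rmod_pact[where h = h])
  show "finite (carrier M)" using fin1 A.subset finite_subset by simp blast
  fix x assume x: "x \<in> carrier M"
  then show "x [^]\<^bsub>M\<^esub> m = \<one>\<^bsub>M\<^esub>" using pow_A by simp
  have xc: "x \<in> carrier G1" using x A_sub by simp
  show "(\<chi>1 ^^ h) x = x" using chi_pow[OF xc, of h] xc pow_c by simp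
qed (use m_pos coprime in simp_all)

lemma f_chi_pow: "x \<in> carrier G1 \<Longrightarrow> f ((\<chi>1 ^^ n) x) = (\<chi>2 ^^ n) (f x)"
  by (induction n) (simp_all add: f_chi chi_pow(2))

sublocale N: coprime_rmod N act2 m
proof (rule N_endo.coprime_rmod_pact[where h = h])
  show "finite (carrier N)" using M.finite_carrier by (simp add: B_def)
  fix y assume y: "y \<in> carrier N"
  then show "y [^]\<^bsub>N\<^esub> m = \<one>\<^bsub>N\<^esub>" using pow_B by simp
  obtain x where x: "x \<in> A" "y = f x" using y by (auto simp: B_def)
  have "(\<chi>1 ^^ h) x = x" using chi_pow[OF A_sub[OF x(1)], of h] A_sub[OF x(1)] pow_c by simp
  then show "(\<chi>2 ^^ h) y = y" using f_chi_pow[OF A_sub[OF x(1)], of h] x(2) by simp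
qed (use m_pos coprime in simp_all)

lemma f_hom_MN: "f \<in> hom M N"
  by (auto simp: hom_def B_def A_sub)

lemma f_act: "x \<in> A \<Longrightarrow> f (act1 p x) = act2 p (f x)"
proof (induction p)
  case 0
  then show ?case by simp
next
  case (pCons k p)
  have 1: "x [^]\<^bsub>M\<^esub> k \<in> A" "\<chi>1 (act1 p x) \<in> A" "act1 p x \<in> A"
    using pCons.prems M_endo.int_pow_closed[of x k] M_endo.pact_closed[of x p] chi_A by auto
  have "f (x [^]\<^bsub>M\<^esub> k) = f x [^]\<^bsub>N\<^esub> k"
    using hom_int_pow[OF f_hom_MN] pCons.prems M_endo.is_group N_endo.is_group by simp
  then show ?case
    using pCons 1 A_sub by (simp add: M_endo.pact_pCons N_endo.pact_pCons f_chi)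
qed

text \<open>The linear correspondence sending the combination of the \<open>\<alpha> i\<close> to
  that of the \<open>\<beta> i\<close> with the same coefficients. It is only a relation until the
  annihilators of the two families have been compared.\<close>

definition pairs :: "(nat \<Rightarrow> 'a) \<Rightarrow> (nat \<Rightarrow> 'b) \<Rightarrow> nat \<Rightarrow> ('a \<times> 'b) set" where
  "pairs \<alpha> \<beta> k = range (\<lambda>t. (M.comb t \<alpha> k, N.comb t \<beta> k))"

abbreviation "cl \<equiv> pair_closure G1 G2 c d"

lemma Domain_pairs: "Domain (pairs \<alpha> \<beta> k) = M.span \<alpha> k"
  by (auto simp: pairs_def M.span_def)

lemma Range_pairs: "Range (pairs \<alpha> \<beta> k) = N.span \<beta> k"
  by (auto simp: pairs_def N.span_def)

lemma conj_iff:
  assumes "x \<in> carrier G1" "u \<in> carrier G1"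
  shows "u \<otimes> c = c \<otimes> x \<longleftrightarrow> u = \<chi>1 x"
  using assms c unfolding \<chi>1_def by (metis G1.inv_solve_right G1.m_closed)

lemma conj_iff':
  assumes "x \<in> carrier G2" "u \<in> carrier G2"
  shows "u \<otimes>\<^bsub>G2\<^esub> d = d \<otimes>\<^bsub>G2\<^esub> x \<longleftrightarrow> u = \<chi>2 x"
  using assms d unfolding \<chi>2_def by (metis G2.inv_solve_right G2.m_closed)

lemma act_X: "x \<in> A \<Longrightarrow> act1 [:0, 1:] x = \<chi>1 x" "y \<in> B \<Longrightarrow> act2 [:0, 1:] y = \<chi>2 y"
  using M_endo.pact_X_power[of x 1] N_endo.pact_X_power[of y 1] by simp_all

lemma pair_closed_pairs:
  assumes \<alpha>: "\<And>i. i < k \<Longrightarrow> \<alpha> i \<in> A" and \<beta>: "\<And>i. i < k \<Longrightarrow> \<beta> i \<in> B"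
  shows "pair_closed G1 G2 c d (pairs \<alpha> \<beta> k)"
proof -
  have ca: "M.comb t \<alpha> k \<in> A" and cb: "N.comb t \<beta> k \<in> B" for t
    using M.comb_closed[of k \<alpha>] N.comb_closed[of k \<beta>] \<alpha> \<beta> by simp_all
  have "(M.comb t \<alpha> k \<otimes> M.comb t' \<alpha> k, N.comb t \<beta> k \<otimes>\<^bsub>G2\<^esub> N.comb t' \<beta> k) \<in> pairs \<alpha> \<beta> k" for t t'
    using M.comb_add[of k \<alpha> t t'] N.comb_add[of k \<beta> t t'] \<alpha> \<beta> unfolding pairs_def by simp
  moreover have "(u, v) \<in> pairs \<alpha> \<beta> k"
    if uv: "u \<in> carrier G1" "v \<in> carrier G2" "u \<otimes> c = c \<otimes> M.comb t \<alpha> k"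
      "v \<otimes>\<^bsub>G2\<^esub> d = d \<otimes>\<^bsub>G2\<^esub> N.comb t \<beta> k" for u v t
  proof -
    have "u = act1 [:0, 1:] (M.comb t \<alpha> k)" "v = act2 [:0, 1:] (N.comb t \<beta> k)"
      using uv conj_iff[OF A_sub[OF ca]] conj_iff'[OF B_sub[OF cb]] act_X ca cb by auto
    then have "u = M.comb (\<lambda>i. [:0, 1:] * t i) \<alpha> k" "v = N.comb (\<lambda>i. [:0, 1:] * t i) \<beta> k"
      using M.comb_act[of k \<alpha> "[:0, 1:]" t] N.comb_act[of k \<beta> "[:0, 1:]" t] \<alpha> \<beta> by simp_all
    then show ?thesis unfolding pairs_def by blast
  qed
  ultimately show ?thesis unfolding pair_closed_def pairs_def by blast
qed

text \<open>By Horner's rule, products and conjugation by \<open>(c, d)\<close> already generate the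
  action of every polynomial. Negative coefficients are reduced modulo \<open>m\<close>, an exponent
  common to \<open>A\<close> and \<open>B\<close>, so that one natural number serves both
  coordinates.\<close>

lemma cl_act:
  assumes one: "(\<one>, \<one>\<^bsub>G2\<^esub>) \<in> cl S" and ab: "(a, b) \<in> cl S" and a: "a \<in> A" and b: "b \<in> B"
  shows "(act1 p a, act2 p b) \<in> cl S"
proof (induction p)
  case 0
  then show ?case using one by simp
next
  case (pCons k p)
  have nat: "(a [^] n, b [^]\<^bsub>G2\<^esub> n) \<in> cl S" for n :: nat
    by (induction n) (simp_all add: one ab pair_closure.mult)
  have "a [^]\<^bsub>M\<^esub> k = a [^]\<^bsub>M\<^esub> nat (k mod int m)" "b [^]\<^bsub>N\<^esub> k = b [^]\<^bsub>N\<^esub> nat (k mod int m)"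
    using M_endo.pow_mod_eq(2)[of a m k] N_endo.pow_mod_eq(2)[of b m k] a b pow_A pow_B m_pos by simp_all
  then have k: "(a [^]\<^bsub>M\<^esub> k, b [^]\<^bsub>N\<^esub> k) \<in> cl S" using nat by simp
  have ap: "act1 p a \<in> A" and bp: "act2 p b \<in> B"
    using M_endo.pact_closed[of a p] N_endo.pact_closed[of b p] a b by simp_all
  have chi: "\<chi>1 (act1 p a) \<in> A" "\<chi>2 (act2 p b) \<in> B"
    using M_endo.endo_closed[of "act1 p a"] N_endo.endo_closed[of "act2 p b"] ap bp by simp_all
  have "(\<chi>1 (act1 p a), \<chi>2 (act2 p b)) \<in> cl S"
    using pair_closure.conj[OF pCons.IH A_sub[OF chi(1)] B_sub[OF chi(2)]]
      conj_iff[OF A_sub[OF ap] A_sub[OF chi(1)]] conj_iff'[OF B_sub[OF bp] B_sub[OF chi(2)]] by blast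
  then show ?case
    using pair_closure.mult[OF k] by (simp add: M_endo.pact_pCons N_endo.pact_pCons)
qed

text \<open>Connects the combinatorial closure with linear algebra: adding a pair and closing
  extends both families by one generator. One inclusion holds because linear correspondences are
  closed, the other by \<open>cl_act\<close>.\<close>

lemma cl_insert_pairs:
  assumes \<alpha>: "\<And>i. i < k \<Longrightarrow> \<alpha> i \<in> A" and \<beta>: "\<And>i. i < k \<Longrightarrow> \<beta> i \<in> B" and a: "a \<in> A" and b: "b \<in> B"
  shows "cl (insert (a, b) (pairs \<alpha> \<beta> k)) = pairs (\<alpha>(k := a)) (\<beta>(k := b)) (Suc k)"
proof -
  have cong: "M.comb t (\<alpha>(k := a)) k = M.comb t \<alpha> k" "N.comb t (\<beta>(k := b)) k = N.comb t \<beta> k" for t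
    by (auto intro!: M.comb_cong N.comb_cong)
  show ?thesis
  proof
    have "(a, b) \<in> pairs (\<alpha>(k := a)) (\<beta>(k := b)) (Suc k)"
    proof -
      have "M.comb (\<lambda>i. if i = k then 1 else 0) \<alpha> k = M.comb (\<lambda>_. 0) \<alpha> k"
        "N.comb (\<lambda>i. if i = k then 1 else 0) \<beta> k = N.comb (\<lambda>_. 0) \<beta> k"
        by (auto intro!: M.comb_cong N.comb_cong)
      then have "(a, b) = (M.comb (\<lambda>i. if i = k then 1 else 0) (\<alpha>(k := a)) (Suc k),
          N.comb (\<lambda>i. if i = k then 1 else 0) (\<beta>(k := b)) (Suc k))"
        using a b \<alpha> \<beta> A_sub B_sub M.act_1[of a] N.act_1[of b] by (simp add: cong M.comb_0 N.comb_0)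
      then show ?thesis unfolding pairs_def by blast
    qed
    moreover have "pairs \<alpha> \<beta> k \<subseteq> pairs (\<alpha>(k := a)) (\<beta>(k := b)) (Suc k)"
    proof (rule subrelI)
      fix x y assume "(x, y) \<in> pairs \<alpha> \<beta> k"
      then obtain t where t: "x = M.comb t \<alpha> k" "y = N.comb t \<beta> k" unfolding pairs_def by blast
      have "M.comb (t(k := 0)) \<alpha> k = M.comb t \<alpha> k" "N.comb (t(k := 0)) \<beta> k = N.comb t \<beta> k"
        by (auto intro!: M.comb_cong N.comb_cong)
      moreover have "x \<in> A" "y \<in> B" using t M.comb_closed[of k \<alpha>] N.comb_closed[of k \<beta>] \<alpha> \<beta> by simp_all
      ultimately have "(x, y) = (M.comb (t(k := 0)) (\<alpha>(k := a)) (Suc k), N.comb (t(k := 0)) (\<beta>(k := b)) (Suc k))"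
        using t A_sub B_sub M.act_0[of a] N.act_0[of b] a b by (simp add: cong)
      then show "(x, y) \<in> pairs (\<alpha>(k := a)) (\<beta>(k := b)) (Suc k)" unfolding pairs_def by blast
    qed
    moreover have "pair_closed G1 G2 c d (pairs (\<alpha>(k := a)) (\<beta>(k := b)) (Suc k))"
      using \<alpha> \<beta> a b by (intro pair_closed_pairs) auto
    ultimately show "cl (insert (a, b) (pairs \<alpha> \<beta> k)) \<subseteq> pairs (\<alpha>(k := a)) (\<beta>(k := b)) (Suc k)"
      by (intro pair_closure_least) auto
  next
    show "pairs (\<alpha>(k := a)) (\<beta>(k := b)) (Suc k) \<subseteq> cl (insert (a, b) (pairs \<alpha> \<beta> k))"
    proof (rule subrelI)
      fix x y assume "(x, y) \<in> pairs (\<alpha>(k := a)) (\<beta>(k := b)) (Suc k)"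
      then obtain t where t: "x = M.comb t \<alpha> k \<otimes> act1 (t k) a" "y = N.comb t \<beta> k \<otimes>\<^bsub>G2\<^esub> act2 (t k) b"
        unfolding pairs_def by (auto simp: cong)
      let ?S = "insert (a, b) (pairs \<alpha> \<beta> k)"
      have "(\<one>, \<one>\<^bsub>G2\<^esub>) = (M.comb (\<lambda>_. 0) \<alpha> k, N.comb (\<lambda>_. 0) \<beta> k)"
        using \<alpha> \<beta> M.comb_0[of k \<alpha>] N.comb_0[of k \<beta>] by simp
      then have "(\<one>, \<one>\<^bsub>G2\<^esub>) \<in> cl ?S" unfolding pairs_def by (auto intro: pair_closure.base)
      then have "(act1 (t k) a, act2 (t k) b) \<in> cl ?S"
        using a b by (intro cl_act) (auto intro: pair_closure.base)
      moreover have "(M.comb t \<alpha> k, N.comb t \<beta> k) \<in> cl ?S"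
        unfolding pairs_def by (auto intro: pair_closure.base)
      ultimately show "(x, y) \<in> cl ?S" unfolding t by (intro pair_closure.mult)
    qed
  qed
qed

end

section \<open>The greedy choice of pairs and the resulting epimorphism\<close>

context semidirect_epi begin

text \<open>The identity pair stands for the empty family, so this is an instance of
  \<open>cl_insert_pairs\<close>.\<close>

abbreviation "Z a b \<equiv> cl {(\<one>, \<one>\<^bsub>G2\<^esub>), (a, b)}"

lemma pairs_0: "pairs \<alpha> \<beta> 0 = {(\<one>, \<one>\<^bsub>G2\<^esub>)}"
  by (auto simp: pairs_def)

lemma Z_cyc:
  assumes "a \<in> A" "b \<in> B"
  shows "Domain (Z a b) = M.cyc a" "Range (Z a b) = N.cyc b"
proof -
  have "Z a b = pairs (\<lambda>_. a) (\<lambda>_. b) (Suc 0)"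
    using cl_insert_pairs[of 0 "\<lambda>_. a" "\<lambda>_. b" a b] assms by (simp add: pairs_0 insert_commute fun_upd_idem)
  moreover have "M.span (\<lambda>_. a) (Suc 0) = M.cyc a"
    unfolding M.span_Suc M.span_0 using assms M.submodD(2)[OF M.submod_cyc[of a]] A_sub
    by (auto simp: M.set_mult_iff)
  moreover have "N.span (\<lambda>_. b) (Suc 0) = N.cyc b"
    unfolding N.span_Suc N.span_0 using assms N.submodD(2)[OF N.submod_cyc[of b]] B_sub
    by (auto simp: N.set_mult_iff)
  ultimately show "Domain (Z a b) = M.cyc a" "Range (Z a b) = N.cyc b"
    by (simp_all add: Domain_pairs Range_pairs)
qed

definition feasible :: "('a \<times> 'b) set \<Rightarrow> 'a \<Rightarrow> 'b \<Rightarrow> bool" where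
  "feasible D a b \<longleftrightarrow> Domain (Z a b) \<inter> Domain D \<subseteq> {\<one>} \<and> Range (Z a b) \<inter> Range D \<subseteq> {\<one>\<^bsub>G2\<^esub>}"

text \<open>One \<open>k\<close> serves both families: after one module is exhausted its family is
  continued with trivial elements.\<close>

definition greedy_inv :: "('a \<times> 'b) set \<Rightarrow> bool" where
  "greedy_inv D \<longleftrightarrow> (\<exists>\<alpha> \<beta> k. D = pairs \<alpha> \<beta> k \<and> M.summand \<alpha> k \<and> N.summand \<beta> k)"

lemma greedy_inv_init: "greedy_inv {(\<one>, \<one>\<^bsub>G2\<^esub>)}"
  unfolding greedy_inv_def using pairs_0 M.summand_0 N.summand_0 by metis

text \<open>The projections of \<open>Z a b\<close> are \<open>cyc a\<close> and
  \<open>cyc b\<close>, so feasibility is a condition on \<open>a\<close> and an independent one on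
  \<open>b\<close>. Varying one coordinate at a time therefore yields the maximality that each
  module requires.\<close>

lemma greedy_inv_step:
  assumes D: "greedy_inv D" and ab: "a \<in> A" "b \<in> B" "feasible D a b"
    and max1: "\<And>a'. a' \<in> A \<Longrightarrow> feasible D a' b \<Longrightarrow> card (Domain (Z a' b)) \<le> card (Domain (Z a b))"
    and max2: "\<And>b'. b' \<in> B \<Longrightarrow> feasible D a b' \<Longrightarrow> card (Range (Z a b')) \<le> card (Range (Z a b))"
  shows "greedy_inv (cl (insert (a, b) D))"
proof -
  obtain \<alpha> \<beta> k where *: "D = pairs \<alpha> \<beta> k" "M.summand \<alpha> k" "N.summand \<beta> k"
    using D unfolding greedy_inv_def by blast
  have \<alpha>: "\<And>i. i < k \<Longrightarrow> \<alpha> i \<in> A" and \<beta>: "\<And>i. i < k \<Longrightarrow> \<beta> i \<in> B"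
    using *(2,3) unfolding M.summand_def N.summand_def M.indep_def N.indep_def by simp_all
  have feas: "feasible D a' b' \<longleftrightarrow> M.cyc a' \<inter> M.span \<alpha> k \<subseteq> {\<one>} \<and> N.cyc b' \<inter> N.span \<beta> k \<subseteq> {\<one>\<^bsub>G2\<^esub>}"
    if "a' \<in> A" "b' \<in> B" for a' b'
    unfolding feasible_def Z_cyc[OF that] *(1) Domain_pairs Range_pairs ..
  have "M.summand (\<alpha>(k := a)) (Suc k)"
  proof (rule M.summand_Suc[OF *(2)])
    fix a' assume "a' \<in> carrier M" "M.cyc a' \<inter> M.span \<alpha> k \<subseteq> {\<one>\<^bsub>M\<^esub>}"
    then show "card (M.cyc a') \<le> card (M.cyc a)" using max1[of a'] feas ab Z_cyc by auto
  qed (use ab feas in auto)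
  moreover have "N.summand (\<beta>(k := b)) (Suc k)"
  proof (rule N.summand_Suc[OF *(3)])
    fix b' assume "b' \<in> carrier N" "N.cyc b' \<inter> N.span \<beta> k \<subseteq> {\<one>\<^bsub>N\<^esub>}"
    then show "card (N.cyc b') \<le> card (N.cyc b)" using max2[of b'] feas ab Z_cyc by auto
  qed (use ab feas in auto)
  moreover have "cl (insert (a, b) D) = pairs (\<alpha>(k := a)) (\<beta>(k := b)) (Suc k)"
    unfolding *(1) using \<alpha> \<beta> ab(1,2) by (rule cl_insert_pairs)
  ultimately show ?thesis unfolding greedy_inv_def by metis
qed

text \<open>Every element is uniquely \<open>u \<otimes> v\<close> with \<open>u\<close> in
  \<open>A\<close> and \<open>v\<close> a power of \<open>c\<close>. Sending it to the product of
  \<open>\<phi> u\<close> and \<open>f v\<close> is multiplicative because \<open>\<phi>\<close>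
  intertwines conjugation by \<open>c\<close> and by \<open>d\<close>.\<close>

lemma extend_hom:
  assumes \<phi>: "\<phi> \<in> hom M N" "\<phi> ` A = B" "\<And>x. x \<in> A \<Longrightarrow> \<phi> (\<chi>1 x) = \<chi>2 (\<phi> x)"
  shows "\<exists>g\<in>epi G1 G2. (\<forall>x\<in>A. g x = \<phi> x) \<and> g c = d"
proof -
  define C where "C = range (\<lambda>n::nat. c [^] n)"
  have Cc: "v \<in> carrier G1" if "v \<in> C" for v using that c unfolding C_def by auto
  have C_mult: "v \<otimes> w \<in> C" if "v \<in> C" "w \<in> C" for v w
    using that c unfolding C_def by (auto simp: G1.nat_pow_mult)
  have \<phi>A: "\<phi> x \<in> B" if "x \<in> A" for x using \<phi>(2) that by blast
  \<comment> \<open>Uniqueness of the second factor: the quotient of two such powers of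
    \<open>c\<close>, arranged to have a natural exponent, lies in \<open>A\<close> and is trivial
    by \<open>inter\<close>.\<close>
  have inter': "v = v'" if vv: "u \<in> A" "u' \<in> A" "v \<in> C" "v' \<in> C" "u \<otimes> v = u' \<otimes> v'" for u u' v v'
  proof -
    obtain n n' where n: "v = c [^] (n::nat)" "v' = c [^] (n'::nat)" using vv(3,4) unfolding C_def by blast
    have key: "c [^] i = c [^] j" if "i \<le> j" "u \<in> A" "u' \<in> A"
      "u \<otimes> c [^] i = u' \<otimes> c [^] j" for i j :: nat and u u'
    proof -
      have cij: "c [^] j = c [^] (j - i) \<otimes> c [^] i" using that(1) c by (simp add: G1.nat_pow_mult)
      then have "u = u' \<otimes> c [^] (j - i)"
        using that(4) c A_sub[OF that(2)] A_sub[OF that(3)] by (simp flip: G1.m_assoc)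
      then have "c [^] (j - i) = inv u' \<otimes> u"
        using c A_sub[OF that(3)] by (simp flip: G1.m_assoc)
      then have "c [^] (j - i) \<in> A" using that(2,3) by simp
      then have "c [^] (j - i) = \<one>" by (rule inter)
      then show ?thesis using cij c by simp
    qed
    show ?thesis
    proof (cases "n \<le> n'")
      case True
      then show ?thesis using key[OF True vv(1,2)] vv(5) n by simp
    next
      case False
      then show ?thesis using key[of n' n u' u] vv n by simp
    qed
  qed
  have dec: "\<exists>u\<in>A. \<exists>v\<in>C. x = u \<otimes> v" if "x \<in> carrier G1" for x
    using decomp[OF that] unfolding C_def by blast
  define g where "g x = (SOME y. \<exists>u\<in>A. \<exists>v\<in>C. x = u \<otimes> v \<and> y = \<phi> u \<otimes>\<^bsub>G2\<^esub> f v)" for x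
  have g: "g (u \<otimes> v) = \<phi> u \<otimes>\<^bsub>G2\<^esub> f v" if "u \<in> A" "v \<in> C" for u v
  proof -
    have "\<exists>u'\<in>A. \<exists>v'\<in>C. u \<otimes> v = u' \<otimes> v' \<and> g (u \<otimes> v) = \<phi> u' \<otimes>\<^bsub>G2\<^esub> f v'"
      unfolding g_def by (rule someI_ex) (use that in blast)
    then obtain u' v' where uv': "u' \<in> A" "v' \<in> C" "u \<otimes> v = u' \<otimes> v'"
      "g (u \<otimes> v) = \<phi> u' \<otimes>\<^bsub>G2\<^esub> f v'" by blast
    have "v = v'" by (rule inter'[OF that(1) uv'(1) that(2) uv'(2,3)])
    moreover from this have "u = u'" using uv'(1,3) that A_sub Cc G1.right_cancel by metis
    ultimately show ?thesis using uv'(4) by simp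
  qed
  \<comment> \<open>Writing \<open>\<phi> x\<close> as \<open>f x'\<close> with \<open>x'\<close> in
    \<open>A\<close> moves the conjugation by \<open>f v\<close> back to \<open>G1\<close>, where it
    is an iterate of \<open>\<chi>1\<close>.\<close>
  have \<phi>_conj: "\<phi> (v \<otimes> x \<otimes> inv v) = f v \<otimes>\<^bsub>G2\<^esub> \<phi> x \<otimes>\<^bsub>G2\<^esub> inv\<^bsub>G2\<^esub> (f v)"
    if v: "v \<in> C" and x: "x \<in> A" for v x
  proof -
    obtain n where n: "v = c [^] (n::nat)" using v unfolding C_def by blast
    obtain x' where x': "x' \<in> A" "\<phi> x = f x'" using \<phi>A[OF x] unfolding B_def by blast
    have pw: "(\<chi>1 ^^ n) z = v \<otimes> z \<otimes> inv v" if "z \<in> A" for z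
      using chi_pow[of z n] A_sub[OF that] Cc[OF v] n G1.inv_solve_right by simp
    have "\<phi> ((\<chi>1 ^^ n) x) = (\<chi>2 ^^ n) (\<phi> x)"
    proof (induction n)
      case (Suc n)
      have "(\<chi>1 ^^ n) x \<in> A" using x by (induction n) (simp_all add: chi_A)
      then show ?case using Suc \<phi>(3) by simp
    qed simp
    also have "\<dots> = f ((\<chi>1 ^^ n) x')" using f_chi_pow x' A_sub by simp
    finally show ?thesis using pw[OF x] pw[OF x'(1)] x' A_sub Cc[OF v] by simp
  qed
  have "g \<in> hom G1 G2"
  proof (rule homI)
    fix x assume "x \<in> carrier G1"
    then obtain u v where uv: "u \<in> A" "v \<in> C" "x = u \<otimes> v" using dec by blast
    then show "g x \<in> carrier G2" using g \<phi>A[OF uv(1)] B_sub Cc by simp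
  next
    fix x y assume "x \<in> carrier G1" "y \<in> carrier G1"
    then obtain u v u' v' where uv: "u \<in> A" "v \<in> C" "x = u \<otimes> v" and uv': "u' \<in> A" "v' \<in> C" "y = u' \<otimes> v'"
      using dec by metis
    note cs = A_sub[OF uv(1)] A_sub[OF uv'(1)] Cc[OF uv(2)] Cc[OF uv'(2)]
    note cs2 = B_sub[OF \<phi>A[OF uv(1)]] B_sub[OF \<phi>A[OF uv'(1)]]
    define w where "w = v \<otimes> u' \<otimes> inv v"
    have w: "w \<in> A" unfolding w_def using A.inv_op_closed2[OF cs(3) uv'(1)] .
    have "v \<otimes> u' = w \<otimes> v" unfolding w_def using cs by (simp add: G1.m_assoc)
    then have "x \<otimes> y = (u \<otimes> w) \<otimes> (v \<otimes> v')"
      unfolding uv(3) uv'(3) using cs A_sub[OF w] G1.m_assoc by (metis G1.m_closed)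
    then have "g (x \<otimes> y) = \<phi> (u \<otimes> w) \<otimes>\<^bsub>G2\<^esub> f (v \<otimes> v')"
      using g[of "u \<otimes> w" "v \<otimes> v'"] uv(1,2) uv'(2) w C_mult by simp
    also have "\<phi> (u \<otimes> w) = \<phi> u \<otimes>\<^bsub>G2\<^esub> \<phi> w" using hom_mult[OF \<phi>(1), of u w] uv(1) w by simp
    also have "\<phi> w = f v \<otimes>\<^bsub>G2\<^esub> \<phi> u' \<otimes>\<^bsub>G2\<^esub> inv\<^bsub>G2\<^esub> (f v)"
      unfolding w_def by (rule \<phi>_conj[OF uv(2) uv'(1)])
    finally have "g (x \<otimes> y) = (\<phi> u \<otimes>\<^bsub>G2\<^esub> (f v \<otimes>\<^bsub>G2\<^esub> \<phi> u' \<otimes>\<^bsub>G2\<^esub> inv\<^bsub>G2\<^esub> (f v))) \<otimes>\<^bsub>G2\<^esub> (f v \<otimes>\<^bsub>G2\<^esub> f v')"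
      using cs by simp
    also have "\<dots> = (\<phi> u \<otimes>\<^bsub>G2\<^esub> f v) \<otimes>\<^bsub>G2\<^esub> (\<phi> u' \<otimes>\<^bsub>G2\<^esub> f v')"
      using cs cs2 G2.m_assoc[of "inv\<^bsub>G2\<^esub> (f v)" "f v" "f v'"] by (simp add: G2.m_assoc del: f.hom_inv)
    finally show "g (x \<otimes> y) = g x \<otimes>\<^bsub>G2\<^esub> g y" using g uv uv' by simp
  qed
  moreover have "g ` carrier G1 = carrier G2"
  proof
    show "g ` carrier G1 \<subseteq> carrier G2" using hom_in_carrier[OF calculation] by auto
    \<comment> \<open>On \<open>A\<close> the maps \<open>\<phi>\<close> and \<open>f\<close> may
      differ, but they have the same image \<open>B\<close>, so \<open>f u\<close> can be replaced
      by some \<open>\<phi> u'\<close>.\<close>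
    show "carrier G2 \<subseteq> g ` carrier G1"
    proof
      fix y assume "y \<in> carrier G2"
      then obtain x where "x \<in> carrier G1" "y = f x" using f_surj by blast
      then obtain u v where uv: "u \<in> A" "v \<in> C" "y = f (u \<otimes> v)" using dec by blast
      have "f u \<in> \<phi> ` A" using uv(1) \<phi>(2) unfolding B_def by blast
      then obtain u' where u': "u' \<in> A" "f u = \<phi> u'" by blast
      have "y = g (u' \<otimes> v)" using uv u' g A_sub Cc by simp
      then show "y \<in> g ` carrier G1" using u'(1) uv(2) A_sub Cc by blast
    qed
  qed
  ultimately have "g \<in> epi G1 G2" by (simp add: epi_def)
  moreover have one: "\<one> \<in> C" unfolding C_def using G1.nat_pow_0 by (metis rangeI)
  moreover have "g x = \<phi> x" if "x \<in> A" for x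
    using g[OF that one] A_sub[OF that] B_sub[OF \<phi>A[OF that]] by simp
  moreover have "g c = d"
  proof -
    have "c \<in> C" unfolding C_def using c G1.nat_pow_eone by (metis rangeI)
    moreover have "\<phi> \<one> = \<one>\<^bsub>G2\<^esub>" using hom_one[OF \<phi>(1) M_endo.is_group N_endo.is_group] by simp
    ultimately show ?thesis using g[OF A.one_closed, of c] c d unfolding d_def by simp
  qed
  ultimately show ?thesis by blast
qed

text \<open>Applying \<open>none\<close> to pairs with one trivial coordinate shows that both spans
  are full. The witness \<open>f\<close> then provides the annihilator inclusions, so
  \<open>D\<close> is the graph of a linear surjection. Adjoining \<open>(c, d)\<close> generates
  the graph of its extension to \<open>G1\<close>.\<close>

lemma greedy_inv_end:
  assumes D: "greedy_inv D" and none: "\<And>a b. a \<in> A \<Longrightarrow> b \<in> B \<Longrightarrow> feasible D a b \<Longrightarrow> a = \<one> \<and> b = \<one>\<^bsub>G2\<^esub>"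
  shows "\<exists>g\<in>epi G1 G2. cl (insert (c, d) D) = {(x, g x) |x. x \<in> carrier G1}"
proof -
  obtain \<alpha> \<beta> k where *: "D = pairs \<alpha> \<beta> k" "M.summand \<alpha> k" "N.summand \<beta> k"
    using D unfolding greedy_inv_def by blast
  have ind: "M.indep \<alpha> k" "N.indep \<beta> k" using *(2,3) unfolding M.summand_def N.summand_def by simp_all
  have \<beta>: "\<And>i. i < k \<Longrightarrow> \<beta> i \<in> carrier N" using ind unfolding N.indep_def by simp
  have one: "\<one> \<in> A" "\<one>\<^bsub>G2\<^esub> \<in> B" using A.one_closed subgroup.one_closed[OF B_subgroup] by blast+
  have cyc1: "M.cyc \<one> \<subseteq> {\<one>}" "N.cyc \<one>\<^bsub>G2\<^esub> \<subseteq> {\<one>\<^bsub>G2\<^esub>}"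
    using M.act_one N.act_one by (auto simp: M.cyc_def N.cyc_def)
  have sp1: "M.span \<alpha> k = carrier M"
  proof (rule M.summand_full[OF *(2)])
    fix a assume "a \<in> carrier M" "M.cyc a \<inter> M.span \<alpha> k \<subseteq> {\<one>\<^bsub>M\<^esub>}"
    then have "feasible D a \<one>\<^bsub>G2\<^esub>"
      unfolding feasible_def using Z_cyc[of a "\<one>\<^bsub>G2\<^esub>"] one cyc1 *(1) Domain_pairs by auto
    then show "a = \<one>\<^bsub>M\<^esub>" using none[of a "\<one>\<^bsub>G2\<^esub>"] one \<open>a \<in> carrier M\<close> by simp
  qed
  have sp2: "N.span \<beta> k = carrier N"
  proof (rule N.summand_full[OF *(3)])
    fix b assume "b \<in> carrier N" "N.cyc b \<inter> N.span \<beta> k \<subseteq> {\<one>\<^bsub>N\<^esub>}"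
    then have "feasible D \<one> b"
      unfolding feasible_def using Z_cyc[of "\<one>" b] one cyc1 *(1) Range_pairs by auto
    then show "b = \<one>\<^bsub>N\<^esub>" using none[of "\<one>" b] one \<open>b \<in> carrier N\<close> by simp
  qed
  have ann: "act2 r (\<beta> i) = \<one>\<^bsub>N\<^esub>" if "i < k" "act1 r (\<alpha> i) = \<one>\<^bsub>M\<^esub>" for i r
    by (rule annihilator_chain[OF M.finite_rmod_axioms N.finite_rmod_axioms ind(1) sp1 ind(2) sp2 f_hom_MN _ _ that])
      (auto simp: B_def f_act)
  obtain \<phi> where \<phi>: "\<phi> \<in> hom M N" "\<phi> ` carrier M = carrier N" "\<And>t. \<phi> (M.comb t \<alpha> k) = N.comb t \<beta> k"
    "\<And>r x. x \<in> carrier M \<Longrightarrow> \<phi> (act1 r x) = act2 r (\<phi> x)"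
    using ex_lift[OF M.rmod_axioms N.rmod_axioms ind(1) sp1 \<beta> sp2 ann] by blast
  have \<phi>B: "\<phi> x \<in> B" if "x \<in> A" for x using \<phi>(2) that by auto
  have "\<phi> (\<chi>1 x) = \<chi>2 (\<phi> x)" if "x \<in> A" for x
    using \<phi>(4)[of x "[:0, 1:]"] act_X(1)[OF that] act_X(2)[OF \<phi>B[OF that]] that by simp
  then obtain g where g: "g \<in> epi G1 G2" "\<And>x. x \<in> A \<Longrightarrow> g x = \<phi> x" "g c = d"
    using extend_hom[of \<phi>] \<phi>(1,2) by auto
  interpret g: group_hom G1 G2 g using g(1) by unfold_locales (auto simp: epi_def)
  have combA: "M.comb t \<alpha> k \<in> A" for t using sp1 unfolding M.span_def by auto
  have Dx: "D = {(x, g x) |x. x \<in> A}"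
  proof -
    have "D = (\<lambda>x. (x, g x)) ` M.span \<alpha> k"
      unfolding *(1) pairs_def M.span_def by (simp add: image_image g(2) combA \<phi>(3))
    then show ?thesis unfolding sp1 by auto
  qed
  let ?S = "insert (c, d) D"
  have "cl ?S \<subseteq> {(x, g x) |x. x \<in> carrier G1}"
  proof (rule pair_closure_least)
    show "?S \<subseteq> {(x, g x) |x. x \<in> carrier G1}" using Dx A_sub c g(3) by auto
    \<comment> \<open>Because \<open>g c = d\<close>, the equation for \<open>v\<close> is also
      satisfied by \<open>g u\<close>; cancelling \<open>d\<close> leaves the conjugation rule no
      other value.\<close>
    have "v = g u" if "x \<in> carrier G1" "u \<in> carrier G1" "v \<in> carrier G2"
      "u \<otimes> c = c \<otimes> x" "v \<otimes>\<^bsub>G2\<^esub> d = d \<otimes>\<^bsub>G2\<^esub> g x" for x u v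
    proof -
      have "g u \<otimes>\<^bsub>G2\<^esub> d = d \<otimes>\<^bsub>G2\<^esub> g x" using that c g(3) by (metis g.hom_mult)
      then show ?thesis using that d G2.right_cancel[of d v "g u"] by simp
    qed
    then show "pair_closed G1 G2 c d {(x, g x) |x. x \<in> carrier G1}"
      unfolding pair_closed_def by auto
  qed
  moreover have "(x, g x) \<in> cl ?S" if x: "x \<in> carrier G1" for x
  proof -
    obtain u n where un: "u \<in> A" "x = u \<otimes> c [^] (n::nat)" using decomp[OF x] by blast
    have "(c [^] n, d [^]\<^bsub>G2\<^esub> n) \<in> cl ?S" for n :: nat
    proof (induction n)
      case 0
      have "(\<one>, g \<one>) \<in> D" unfolding Dx using one by blast
      then show ?case by (auto intro: pair_closure.base)
    next
      case (Suc n)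
      then show ?case using pair_closure.mult[OF Suc, of c d] by (simp add: pair_closure.base)
    qed
    moreover have "(u, g u) \<in> cl ?S" using un(1) Dx by (auto intro: pair_closure.base)
    moreover have "g x = g u \<otimes>\<^bsub>G2\<^esub> d [^]\<^bsub>G2\<^esub> n" using un A_sub c g(3) by (simp add: g.hom_nat_pow)
    ultimately show ?thesis using un(2) pair_closure.mult by metis
  qed
  ultimately have "cl ?S = {(x, g x) |x. x \<in> carrier G1}" by auto
  then show ?thesis using g(1) by blast
qed

end

section \<open>For-programs\<close>

text \<open>
  Loop bounds are variables that the loop body leaves alone (ultimately the two group orders), hence every
  such program runs in polynomial time, and its effect is the state transformer \<open>den\<close>. Correctness can
  then be proved without mentioning time.
\<close>

datatype lp =
    Nop
  | Asg vname aexp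
  | Sto vname aexp aexp aexp
  | Sq lp lp (infixr ";;" 60)
  | Cond bexp lp lp
  | For vname vname lp

primrec compile :: "lp \<Rightarrow> com" where
  "compile Nop = Skip"
| "compile (Asg x e) = Assign x e"
| "compile (Sto a e1 e2 e) = Store a e1 e2 e"
| "compile (p ;; q) = Seq (compile p) (compile q)"
| "compile (Cond b p q) = Branch b (compile p) (compile q)"
| "compile (For x n p) = Seq (Assign x (Num 0))
     (While (Less (Var x) (Var n)) (Seq (compile p) (Assign x (Add (Var x) (Num 1)))))"

text \<open>The number of iterations is read once on entry, whereas the compiled loop compares with
  the bound in every round. The two agree when the body changes neither counter nor bound.\<close>

primrec den :: "lp \<Rightarrow> state \<Rightarrow> state" where
  "den Nop s = s"
| "den (Asg x e) s = assign x (aval e s) s"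
| "den (Sto a e1 e2 e) s = store a (aval e1 s) (aval e2 s) (aval e s) s"
| "den (p ;; q) s = den q (den p s)"
| "den (Cond b p q) s = (if bval b s then den p s else den q s)"
| "den (For x n p) s = ((\<lambda>s. assign x (Suc (vars s x)) (den p s)) ^^ vars s n) (assign x 0 s)"

primrec modv :: "lp \<Rightarrow> vname set" where
  "modv Nop = {}"
| "modv (Asg x e) = {x}"
| "modv (Sto a e1 e2 e) = {}"
| "modv (p ;; q) = modv p \<union> modv q"
| "modv (Cond b p q) = modv p \<union> modv q"
| "modv (For x n p) = insert x (modv p)"

primrec moda :: "lp \<Rightarrow> vname set" where
  "moda Nop = {}"
| "moda (Asg x e) = {}"
| "moda (Sto a e1 e2 e) = {a}"
| "moda (p ;; q) = moda p \<union> moda q"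
| "moda (Cond b p q) = moda p \<union> moda q"
| "moda (For x n p) = moda p"

primrec well_formed :: "lp \<Rightarrow> bool" where
  "well_formed Nop = True"
| "well_formed (Asg x e) = True"
| "well_formed (Sto a e1 e2 e) = True"
| "well_formed (p ;; q) = (well_formed p \<and> well_formed q)"
| "well_formed (Cond b p q) = (well_formed p \<and> well_formed q)"
| "well_formed (For x n p) = (well_formed p \<and> x \<notin> modv p \<and> n \<in> {''n1'', ''n2''})"

lemma vars_assign [simp]: "vars (assign x v s) y = (if y = x then v else vars s y)"
  by (simp add: assign_def)

lemma arrs_assign [simp]: "arrs (assign x v s) = arrs s"
  by (simp add: assign_def)

lemma vars_store [simp]: "vars (store a i j v s) = vars s"
  by (simp add: store_def)

lemma arrs_store [simp]:
  "arrs (store a i j v s) b k l = (if b = a \<and> k = i \<and> l = j then v else arrs s b k l)"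
  by (simp add: store_def)

lemma vars_den: "x \<notin> modv p \<Longrightarrow> vars (den p s) x = vars s x"
proof (induction p arbitrary: s)
  case (For y n p)
  have "vars (((\<lambda>s. assign y (Suc (vars s y)) (den p s)) ^^ k) s') x = vars s' x" for k s'
    using For by (induction k) simp_all
  then show ?case using For.prems by simp
qed simp_all

lemma arrs_den: "a \<notin> moda p \<Longrightarrow> arrs (den p s) a = arrs s a"
proof (induction p arbitrary: s)
  case (Sto b e1 e2 e)
  then show ?case by (intro ext) simp
next
  case (For y n p)
  have "arrs (((\<lambda>s. assign y (Suc (vars s y)) (den p s)) ^^ k) s') a = arrs s' a" for k s'
    using For by (induction k) simp_all
  then show ?case using For.prems by simp
qed simp_all

text \<open>A loop rule with the frame conditions built in: the invariant \<open>I\<close> has to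
  mention only what the body modifies.\<close>

lemma for_induct:
  assumes x: "x \<notin> modv p" and n: "n \<notin> modv p" "x \<noteq> n" and N: "vars s n = N"
    and I0: "I 0 (assign x 0 s)"
    and I: "\<And>i s'. i < N \<Longrightarrow> I i s' \<Longrightarrow> vars s' x = i \<Longrightarrow>
      (\<And>y. y \<notin> insert x (modv p) \<Longrightarrow> vars s' y = vars s y) \<Longrightarrow>
      (\<And>a. a \<notin> moda p \<Longrightarrow> arrs s' a = arrs s a) \<Longrightarrow> I (Suc i) (assign x (Suc i) (den p s'))"
  shows "I N (den (For x n p) s)"
proof -
  let ?F = "\<lambda>s. assign x (Suc (vars s x)) (den p s)"
  let ?s = "\<lambda>k. (?F ^^ k) (assign x 0 s)"
  have frame: "vars (?s k) y = vars s y" if "y \<notin> insert x (modv p)" for k y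
    using that by (induction k) (simp_all add: vars_den)
  have frame': "arrs (?s k) a = arrs s a" if "a \<notin> moda p" for k a
    using that by (induction k) (simp_all add: arrs_den)
  have "vars (?s k) x = k \<and> I k (?s k)" if "k \<le> N" for k
    using that
  proof (induction k)
    case 0
    then show ?case using I0 by simp
  next
    case (Suc k)
    then have "I (Suc k) (assign x (Suc k) (den p (?s k)))"
      using frame frame' by (intro I) auto
    then show ?case using Suc by simp
  qed
  then show ?thesis using N by simp
qed

lemma den_bounds:
  assumes "{''n1'', ''n2''} \<inter> modv p = {}"
  shows "vars (den p s) ''n1'' = vars s ''n1''" "vars (den p s) ''n2'' = vars s ''n2''"
  using assms by (simp_all add: vars_den)

text \<open>Each level of nesting multiplies the bound by a group order, so the exponent grows with
  the program text and not with the input. The summand \<open>1\<close> keeps the base positive,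
  which allows a smaller exponent to be raised to a larger one.\<close>

lemma exec_lp:
  assumes "well_formed p" "{''n1'', ''n2''} \<inter> modv p = {}"
  shows "\<exists>K k. \<forall>s::state. \<exists>t. exec (compile p) s t (den p s) \<and> t \<le> K * (vars s ''n1'' + vars s ''n2'' + 1) ^ k"
  using assms
proof (induction p)
  case Nop
  then show ?case by (intro exI[of _ 1] exI[of _ 0]) (auto intro: exec.Skip)
next
  case (Asg x e)
  then show ?case by (intro exI[of _ 1] exI[of _ 0]) (auto intro: exec.Assign)
next
  case (Sto a e1 e2 e)
  then show ?case by (intro exI[of _ 1] exI[of _ 0]) (auto intro: exec.Store)
next
  case (Sq p q)
  then obtain K k L l where
    p: "\<And>s::state. \<exists>t. exec (compile p) s t (den p s) \<and> t \<le> K * (vars s ''n1'' + vars s ''n2'' + 1) ^ k" and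
    q: "\<And>s::state. \<exists>t. exec (compile q) s t (den q s) \<and> t \<le> L * (vars s ''n1'' + vars s ''n2'' + 1) ^ l"
    by (auto simp: Int_Un_distrib)
  show ?case
  proof (rule exI[of _ "K + L"], rule exI[of _ "k + l"], rule allI)
    fix s :: state
    let ?N = "vars s ''n1'' + vars s ''n2'' + 1"
    obtain t where t: "exec (compile p) s t (den p s)" "t \<le> K * ?N ^ k" using p by blast
    obtain u where u: "exec (compile q) (den p s) u (den q (den p s))" "u \<le> L * ?N ^ l"
      using q[of "den p s"] den_bounds[of p s] Sq.prems(2) by auto
    have "K * ?N ^ k \<le> K * ?N ^ (k + l)" "L * ?N ^ l \<le> L * ?N ^ (k + l)"
      by (intro mult_le_mono2 power_increasing; simp)+
    then have "t + u \<le> (K + L) * ?N ^ (k + l)" using t(2) u(2) by (simp only: distrib_right)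
    then show "\<exists>t. exec (compile (p ;; q)) s t (den (p ;; q) s) \<and> t \<le> (K + L) * ?N ^ (k + l)"
      using exec.Seq[OF t(1) u(1)] by auto
  qed
next
  case (Cond b p q)
  then obtain K k L l where
    p: "\<And>s::state. \<exists>t. exec (compile p) s t (den p s) \<and> t \<le> K * (vars s ''n1'' + vars s ''n2'' + 1) ^ k" and
    q: "\<And>s::state. \<exists>t. exec (compile q) s t (den q s) \<and> t \<le> L * (vars s ''n1'' + vars s ''n2'' + 1) ^ l"
    by (auto simp: Int_Un_distrib)
  show ?case
  proof (rule exI[of _ "1 + K + L"], rule exI[of _ "k + l"], rule allI)
    fix s :: state
    let ?N = "vars s ''n1'' + vars s ''n2'' + 1"
    obtain t where t: "exec (compile p) s t (den p s)" "t \<le> K * ?N ^ k" using p by blast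
    obtain u where u: "exec (compile q) s u (den q s)" "u \<le> L * ?N ^ l" using q by blast
    have "K * ?N ^ k \<le> K * ?N ^ (k + l)" "L * ?N ^ l \<le> L * ?N ^ (k + l)"
      by (intro mult_le_mono2 power_increasing; simp)+
    moreover have "1 \<le> ?N ^ (k + l)" by simp
    ultimately have le: "1 + t \<le> (1 + K + L) * ?N ^ (k + l)" "1 + u \<le> (1 + K + L) * ?N ^ (k + l)"
      using t(2) u(2) by (simp_all only: distrib_right mult_1)
    show "\<exists>t. exec (compile (Cond b p q)) s t (den (Cond b p q) s) \<and> t \<le> (1 + K + L) * ?N ^ (k + l)"
    proof (cases "bval b s")
      case True
      then show ?thesis using exec.BranchTrue[OF True t(1)] le by auto
    next
      case False
      then show ?thesis using exec.BranchFalse[OF False u(1)] le by auto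
    qed
  qed
next
  case (For x n p)
  then obtain K k where
    p: "\<And>s::state. \<exists>t. exec (compile p) s t (den p s) \<and> t \<le> K * (vars s ''n1'' + vars s ''n2'' + 1) ^ k"
    by auto
  have n: "n \<notin> modv p" "x \<noteq> n" and x: "x \<notin> modv p" "x \<noteq> ''n1''" "x \<noteq> ''n2''" using For.prems by auto
  let ?body = "Seq (compile p) (Assign x (Add (Var x) (Num 1)))"
  let ?F = "\<lambda>s. assign x (Suc (vars s x)) (den p s)"
  have F: "vars (?F s) x = Suc (vars s x)" "vars (?F s) n = vars s n"
    "vars (?F s) ''n1'' = vars s ''n1''" "vars (?F s) ''n2'' = vars s ''n2''" for s
    using x n For.prems(2) by (simp_all add: vars_den)
  have body: "\<exists>t. exec ?body s t (?F s) \<and> t \<le> K * (vars s ''n1'' + vars s ''n2'' + 1) ^ k + 1" for s :: state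
  proof -
    obtain t where t: "exec (compile p) s t (den p s)" "t \<le> K * (vars s ''n1'' + vars s ''n2'' + 1) ^ k"
      using p by blast
    have "exec (Assign x (Add (Var x) (Num 1))) (den p s) 1 (?F s)"
      using exec.Assign[of x "Add (Var x) (Num 1)" "den p s"] by (simp add: vars_den[OF x(1)])
    from exec.Seq[OF t(1) this] show ?thesis using t(2) by auto
  qed
  have loop: "\<exists>t. exec (While (Less (Var x) (Var n)) ?body) s t ((?F ^^ j) s) \<and>
      t \<le> 1 + j * (K * (vars s ''n1'' + vars s ''n2'' + 1) ^ k + 2)" if "vars s x + j = vars s n" for s :: state and j
    using that
  proof (induction j arbitrary: s)
    case 0
    then show ?case using exec.WhileFalse[of "Less (Var x) (Var n)" s ?body] by auto
  next
    case (Suc j)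
    let ?T = "K * (vars s ''n1'' + vars s ''n2'' + 1) ^ k"
    obtain t where t: "exec ?body s t (?F s)" "t \<le> ?T + 1" using body by blast
    obtain u where u: "exec (While (Less (Var x) (Var n)) ?body) (?F s) u ((?F ^^ j) (?F s))"
      "u \<le> 1 + j * (?T + 2)"
      using Suc.IH[of "?F s"] Suc.prems unfolding F by auto
    have b: "bval (Less (Var x) (Var n)) s" using Suc.prems by simp
    have "exec (While (Less (Var x) (Var n)) ?body) s (1 + t + u) ((?F ^^ Suc j) s)"
      using exec.WhileTrue[OF b t(1) u(1)] by (simp only: funpow_Suc_right o_apply)
    moreover have "1 + t + u \<le> 1 + Suc j * (?T + 2)" using t(2) u(2) by simp
    ultimately show ?case by blast
  qed
  show ?case
  \<comment> \<open>An iteration costs 2 beyond the body, for the test and the increment;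
    initialisation and the final test add 2 in all. Thus
    \<open>2 * N + 2 \<le> 4 * N ^ Suc k\<close> is to be absorbed, where \<open>N\<close> is the
    base.\<close>
  proof (rule exI[of _ "K + 4"], rule exI[of _ "Suc k"], rule allI)
    fix s :: state
    let ?N = "vars s ''n1'' + vars s ''n2'' + 1"
    let ?s = "assign x 0 s"
    obtain t where t: "exec (While (Less (Var x) (Var n)) ?body) ?s t ((?F ^^ vars s n) ?s)"
      "t \<le> 1 + vars s n * (K * ?N ^ k + 2)"
      using loop[of ?s "vars s n"] n x by auto
    have "exec (Assign x (Num 0)) s 1 ?s" using exec.Assign[of x "Num 0" s] by simp
    from exec.Seq[OF this t(1)] have ex: "exec (compile (For x n p)) s (1 + t) (den (For x n p) s)"
      by simp
    have "vars s n \<le> ?N" using For.prems(1) by auto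
    then have "vars s n * (K * ?N ^ k + 2) \<le> ?N * (K * ?N ^ k + 2)" by (rule mult_le_mono1)
    also have "\<dots> = K * ?N ^ Suc k + 2 * ?N" by (simp add: algebra_simps)
    finally have *: "vars s n * (K * ?N ^ k + 2) \<le> K * ?N ^ Suc k + 2 * ?N" .
    have "?N ^ 1 \<le> ?N ^ Suc k" by (intro power_increasing) auto
    then have "?N \<le> ?N ^ Suc k" "1 \<le> ?N ^ Suc k" by (simp_all only: power_one_right)
    have "1 + t \<le> (K + 4) * ?N ^ Suc k"
    proof -
      have "1 + t \<le> z + 4 * x" if "t \<le> 1 + y" "y \<le> z + 2 * v" "v \<le> x" "1 \<le> x" for x y z v :: nat
        using that by linarith
      from this[OF t(2) * \<open>?N \<le> ?N ^ Suc k\<close> \<open>1 \<le> ?N ^ Suc k\<close>] show ?thesis by (simp only: distrib_right)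
    qed
    then show "\<exists>t. exec (compile (For x n p)) s t (den (For x n p) s) \<and> t \<le> (K + 4) * ?N ^ Suc k"
      using ex by blast
  qed
qed

section \<open>The algorithm\<close>

(* otherwise it shadows the order of a group *)
hide_const (open) Polynomial.order

text \<open>For loops that enlarge a relation while reading it. What an iteration adds depends on
  the current contents, so the result is only enclosed: from below by the contributions
  \<open>Q\<close>, which may be those of the initial relation, and from above by \<open>U\<close>,
  in applications a closed set.\<close>

lemma for_collect:
  fixes R :: "state \<Rightarrow> 'x set"
  assumes x: "x \<notin> modv p" and n: "n \<notin> modv p" "x \<noteq> n" and N: "vars s n = N"
    and R: "\<And>v s. R (assign x v s) = R s"
    and upper: "R s \<subseteq> U"
    and step: "\<And>i s'. i < N \<Longrightarrow> R s \<subseteq> R s' \<Longrightarrow> R s' \<subseteq> U \<Longrightarrow> vars s' x = i \<Longrightarrow>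
      (\<And>y. y \<notin> insert x (modv p) \<Longrightarrow> vars s' y = vars s y) \<Longrightarrow>
      (\<And>a. a \<notin> moda p \<Longrightarrow> arrs s' a = arrs s a) \<Longrightarrow>
      R s' \<subseteq> R (den p s') \<and> Q i \<subseteq> R (den p s') \<and> R (den p s') \<subseteq> U"
  shows "R s \<subseteq> R (den (For x n p) s) \<and> (\<Union>i<N. Q i) \<subseteq> R (den (For x n p) s) \<and> R (den (For x n p) s) \<subseteq> U"
proof (rule for_induct[where I = "\<lambda>k s'. R s \<subseteq> R s' \<and> (\<Union>i<k. Q i) \<subseteq> R s' \<and> R s' \<subseteq> U", OF x n N])
  fix i s'
  assume *: "i < N" "R s \<subseteq> R s' \<and> (\<Union>i<i. Q i) \<subseteq> R s' \<and> R s' \<subseteq> U" "vars s' x = i"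
    "\<And>y. y \<notin> insert x (modv p) \<Longrightarrow> vars s' y = vars s y" "\<And>a. a \<notin> moda p \<Longrightarrow> arrs s' a = arrs s a"
  have "R s' \<subseteq> R (den p s') \<and> Q i \<subseteq> R (den p s') \<and> R (den p s') \<subseteq> U"
    using * by (intro step) blast+
  then show "R s \<subseteq> R (assign x (Suc i) (den p s')) \<and> (\<Union>i<Suc i. Q i) \<subseteq> R (assign x (Suc i) (den p s')) \<and>
      R (assign x (Suc i) (den p s')) \<subseteq> U"
    using * unfolding R lessThan_Suc by auto
qed (use upper R in auto)

definition Eq :: "aexp \<Rightarrow> aexp \<Rightarrow> bexp" where
  "Eq e1 e2 = Conj (Neg (Less e1 e2)) (Neg (Less e2 e1))"

lemma bval_Eq [simp]: "bval (Eq e1 e2) s \<longleftrightarrow> aval e1 s = aval e2 s"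
  by (auto simp: Eq_def)

abbreviation T1 :: "aexp \<Rightarrow> aexp \<Rightarrow> aexp" where "T1 \<equiv> Elem ''table1''"
abbreviation T2 :: "aexp \<Rightarrow> aexp \<Rightarrow> aexp" where "T2 \<equiv> Elem ''table2''"

section \<open>Saturation of a relation under multiplication and conjugation\<close>

definition close_pair :: "vname \<Rightarrow> lp" where
  "close_pair X =
    For ''u'' ''n1'' (For ''v'' ''n2'' (
      Cond (Eq (Elem X (Var ''u'') (Var ''v'')) (Num 1))
        (Sto X (T1 (Var ''g'') (Var ''u'')) (T2 (Var ''h'') (Var ''v'')) (Num 1)) Nop ;;
      Cond (Conj (Eq (T1 (Var ''u'') (Var ''c'')) (T1 (Var ''c'') (Var ''g'')))
                 (Eq (T2 (Var ''v'') (Var ''d'')) (T2 (Var ''d'') (Var ''h''))))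
        (Sto X (Var ''u'') (Var ''v'') (Num 1)) Nop))"

definition close_round :: "vname \<Rightarrow> lp" where
  "close_round X = For ''g'' ''n1'' (For ''h'' ''n2''
    (Cond (Eq (Elem X (Var ''g'') (Var ''h'')) (Num 1)) (close_pair X) Nop))"

definition close :: "vname \<Rightarrow> lp" where
  "close X = For ''r'' ''n1'' (For ''q'' ''n2'' (close_round X))"

lemma close_frame [simp]:
  "modv (close_pair X) = {''u'', ''v''}" "moda (close_pair X) = {X}" "well_formed (close_pair X)"
  "modv (close_round X) = {''g'', ''h'', ''u'', ''v''}" "moda (close_round X) = {X}" "well_formed (close_round X)"
  "modv (close X) = {''r'', ''q'', ''g'', ''h'', ''u'', ''v''}" "moda (close X) = {X}" "well_formed (close X)"
  by (auto simp: close_def close_round_def close_pair_def)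

locale tables =
  fixes G1 :: "nat monoid" (structure) and G2 :: "nat monoid"
  assumes table1: "table_group G1" and table2: "table_group G2"
begin

sublocale G1: group G1 using table1 by (simp add: table_group_def)
sublocale G2: group G2 using table2 by (simp add: table_group_def)

abbreviation "N1 \<equiv> order G1"
abbreviation "N2 \<equiv> order G2"

lemma carrier: "x \<in> carrier G1 \<longleftrightarrow> x < N1" "y \<in> carrier G2 \<longleftrightarrow> y < N2"
  using table1 table2 by (auto simp: table_group_def)

definition rel :: "vname \<Rightarrow> state \<Rightarrow> (nat \<times> nat) set" where
  "rel X s = {(x, y). x < N1 \<and> y < N2 \<and> arrs s X x y = 1}"

definition inp :: "nat \<Rightarrow> nat \<Rightarrow> state \<Rightarrow> bool" where
  "inp c d s \<longleftrightarrow> vars s ''n1'' = N1 \<and> vars s ''n2'' = N2 \<and>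
     arrs s ''table1'' = cayley_table G1 \<and> arrs s ''table2'' = cayley_table G2 \<and>
     vars s ''c'' = c \<and> vars s ''d'' = d \<and> c < N1 \<and> d < N2"

lemma rel_assign [simp]: "rel X (assign x v s) = rel X s"
  by (simp add: rel_def)

lemma rel_cong: "arrs s X = arrs s' X \<Longrightarrow> rel X s = rel X s'"
  by (simp add: rel_def)

lemma rel_store: "rel X (store X x y (Suc 0) s) = (if x < N1 \<and> y < N2 then insert (x, y) (rel X s) else rel X s)"
  by (auto simp: rel_def)

lemma mult_less [simp]: "x < N1 \<Longrightarrow> u < N1 \<Longrightarrow> x \<otimes> u < N1" "y < N2 \<Longrightarrow> v < N2 \<Longrightarrow> y \<otimes>\<^bsub>G2\<^esub> v < N2"
  using G1.m_closed[of x u] G2.m_closed[of y v] unfolding carrier by auto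

definition conjs :: "nat \<Rightarrow> nat \<Rightarrow> nat \<times> nat \<Rightarrow> nat \<times> nat \<Rightarrow> bool" where
  "conjs c d z w \<longleftrightarrow> fst w \<otimes> c = c \<otimes> fst z \<and> snd w \<otimes>\<^bsub>G2\<^esub> d = d \<otimes>\<^bsub>G2\<^esub> snd z"

lemma close_pair:
  assumes s: "inp c d s" and X: "X \<noteq> ''table1''" "X \<noteq> ''table2''"
    and gh: "vars s ''g'' = x" "vars s ''h'' = y" "x < N1" "y < N2"
    and upper: "rel X s \<subseteq> CL" "pair_closed G1 G2 c d CL" "(x, y) \<in> CL"
  shows "rel X s \<subseteq> rel X (den (close_pair X) s) \<and> rel X (den (close_pair X) s) \<subseteq> CL \<and>
    {(x \<otimes> u, y \<otimes>\<^bsub>G2\<^esub> v) |u v. (u, v) \<in> rel X s} \<union>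
    {(u, v). u < N1 \<and> v < N2 \<and> conjs c d (x, y) (u, v)} \<subseteq> rel X (den (close_pair X) s)"
proof -
  define S where "S = rel X s"
  define Q where "Q u v = (if (u, v) \<in> S then {(x \<otimes> u, y \<otimes>\<^bsub>G2\<^esub> v)} else {}) \<union>
    (if conjs c d (x, y) (u, v) then {(u, v)} else {})" for u v
  note inp = s[unfolded inp_def]
  have main: "rel X s \<subseteq> rel X (den (close_pair X) s) \<and> (\<Union>u<N1. \<Union>v<N2. Q u v) \<subseteq> rel X (den (close_pair X) s) \<and>
      rel X (den (close_pair X) s) \<subseteq> CL"
    unfolding close_pair_def
  proof (rule for_collect, goal_cases)
    case (7 u s1)
    note s1 = 7
    show ?case
    proof (rule for_collect, goal_cases)
      case (7 v s2)
      have val: "vars s2 ''u'' = u" "vars s2 ''v'' = v" "vars s2 ''g'' = x" "vars s2 ''h'' = y"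
        "vars s2 ''c'' = c" "vars s2 ''d'' = d" "arrs s2 ''table1'' = cayley_table G1" "arrs s2 ''table2'' = cayley_table G2"
        using 7 s1 inp gh X by simp_all
      have uv: "u < N1" "v < N2" "c < N1" "d < N2" using 7(1) s1(1) inp by auto
      have S: "S \<subseteq> rel X s2" using 7(2) s1(2) unfolding S_def by blast
      have up: "(x \<otimes> u, y \<otimes>\<^bsub>G2\<^esub> v) \<in> CL" if "(u, v) \<in> CL"
        using upper(2,3) that unfolding pair_closed_def by blast
      have up': "(u, v) \<in> CL" if "conjs c d (x, y) (u, v)"
        using upper(2,3) that uv unfolding pair_closed_def conjs_def carrier by auto
      have eq: "arrs s2 X u v = 1 \<longleftrightarrow> (u, v) \<in> rel X s2" using uv unfolding rel_def by simp
      define s3 where "s3 = (if (u, v) \<in> rel X s2 then store X (x \<otimes> u) (y \<otimes>\<^bsub>G2\<^esub> v) 1 s2 else s2)"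
      define s4 where "s4 = (if conjs c d (x, y) (u, v) then store X u v 1 s3 else s3)"
      have "vars s3 = vars s2" "arrs s3 ''table1'' = arrs s2 ''table1''" "arrs s3 ''table2'' = arrs s2 ''table2''"
        unfolding s3_def using X by (auto intro!: ext)
      note val3 = this[unfolded val] val(1-6)
      have s4: "den (Cond (Eq (Elem X (Var ''u'') (Var ''v'')) (Num 1))
          (Sto X (T1 (Var ''g'') (Var ''u'')) (T2 (Var ''h'') (Var ''v'')) (Num 1)) Nop ;;
        Cond (Conj (Eq (T1 (Var ''u'') (Var ''c'')) (T1 (Var ''c'') (Var ''g'')))
                   (Eq (T2 (Var ''v'') (Var ''d'')) (T2 (Var ''d'') (Var ''h''))))
          (Sto X (Var ''u'') (Var ''v'') (Num 1)) Nop) s2 = s4"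
      proof -
        have 1: "den (Cond (Eq (Elem X (Var ''u'') (Var ''v'')) (Num 1))
          (Sto X (T1 (Var ''g'') (Var ''u'')) (T2 (Var ''h'') (Var ''v'')) (Num 1)) Nop) s2 = s3"
          unfolding s3_def eq[symmetric] using uv gh(3,4) by (simp add: val cayley_table_def)
        have 2: "den (Cond (Conj (Eq (T1 (Var ''u'') (Var ''c'')) (T1 (Var ''c'') (Var ''g'')))
                   (Eq (T2 (Var ''v'') (Var ''d'')) (T2 (Var ''d'') (Var ''h''))))
          (Sto X (Var ''u'') (Var ''v'') (Num 1)) Nop) s3 = s4"
          unfolding s4_def conjs_def using uv gh(3,4) by (simp add: val3 cayley_table_def)
        show ?thesis using 1 2 by (simp del: den.simps(5))
      qed
      have r3: "rel X s3 = rel X s2 \<union> (if (u, v) \<in> rel X s2 then {(x \<otimes> u, y \<otimes>\<^bsub>G2\<^esub> v)} else {})"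
        unfolding s3_def using uv gh(3,4) by (simp add: rel_store)
      have r4: "rel X s4 = rel X s3 \<union> (if conjs c d (x, y) (u, v) then {(u, v)} else {})"
        unfolding s4_def using uv by (simp add: rel_store)
      show ?case
        unfolding s4 r4 r3 Q_def using S up up' 7(3) by (auto split: if_splits)
    qed (use s1 inp in auto)
  qed (use inp upper in auto)
  have sub: "{(x \<otimes> u, y \<otimes>\<^bsub>G2\<^esub> v) |u v. (u, v) \<in> rel X s} \<union>
    {(u, v). u < N1 \<and> v < N2 \<and> conjs c d (x, y) (u, v)} \<subseteq> (\<Union>u<N1. \<Union>v<N2. Q u v)"
  proof (rule subsetI)
    fix w assume w: "w \<in> {(x \<otimes> u, y \<otimes>\<^bsub>G2\<^esub> v) |u v. (u, v) \<in> rel X s} \<union>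
      {(u, v). u < N1 \<and> v < N2 \<and> conjs c d (x, y) (u, v)}"
    then have "\<exists>u v. u < N1 \<and> v < N2 \<and> w \<in> Q u v" unfolding Q_def S_def by (auto simp: rel_def)
    then show "w \<in> (\<Union>u<N1. \<Union>v<N2. Q u v)" by blast
  qed
  show ?thesis using main subset_trans[OF sub, of "rel X (den (close_pair X) s)"] by simp
qed

text \<open>A round adds at least all products and conjugates of the initial pairs; if the relation
  is unchanged, these were already present and it is closed.\<close>

lemma close_round:
  assumes s: "inp c d s" and X: "X \<noteq> ''table1''" "X \<noteq> ''table2''"
    and upper: "rel X s \<subseteq> CL" "pair_closed G1 G2 c d CL"
  shows "rel X s \<subseteq> rel X (den (close_round X) s) \<and> rel X (den (close_round X) s) \<subseteq> CL \<and>
    (pair_closed G1 G2 c d (rel X s) \<or> rel X s \<noteq> rel X (den (close_round X) s))"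
proof -
  define S where "S = rel X s"
  define Q where "Q x y = {w. (x, y) \<in> S \<and> w \<in> {(x \<otimes> u, y \<otimes>\<^bsub>G2\<^esub> v) |u v. (u, v) \<in> S} \<union>
    {(u, v). u < N1 \<and> v < N2 \<and> conjs c d (x, y) (u, v)}}" for x y
  note inp = s[unfolded inp_def]
  have main: "rel X s \<subseteq> rel X (den (close_round X) s) \<and> (\<Union>x<N1. \<Union>y<N2. Q x y) \<subseteq> rel X (den (close_round X) s) \<and>
      rel X (den (close_round X) s) \<subseteq> CL"
    unfolding close_round_def
  proof (rule for_collect, goal_cases)
    case (7 x s1)
    note s1 = 7
    show ?case
    proof (rule for_collect, goal_cases)
      case (7 y s2)
      have inp2: "inp c d s2" and val: "vars s2 ''g'' = x" "vars s2 ''h'' = y"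
        using 7 s1 inp X unfolding inp_def by simp_all
      have S: "S \<subseteq> rel X s2" using 7(2) s1(2) unfolding S_def by blast
      have xy: "x < N1" "y < N2" using 7(1) s1(1) by auto
      have eq: "bval (Eq (Elem X (Var ''g'') (Var ''h'')) (Num 1)) s2 \<longleftrightarrow> (x, y) \<in> rel X s2"
        using xy val by (simp add: rel_def)
      show ?case
      proof (cases "(x, y) \<in> rel X s2")
        case True
        have "(x, y) \<in> CL" using True 7(3) by blast
        from close_pair[OF inp2 X val xy 7(3) upper(2) this] show ?thesis
          unfolding den.simps if_P[OF iffD2[OF eq True]] using S unfolding Q_def by blast
      next
        case False
        then have "Q x y = {}" using S unfolding Q_def by blast
        then show ?thesis using False 7(3) by (simp only: den.simps eq if_False) simp
      qed
    qed (use s1 inp in auto)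
  qed (use inp upper in auto)
  have "pair_closed G1 G2 c d S" if "S = rel X (den (close_round X) s)"
  proof -
    have sub: "(\<Union>x<N1. \<Union>y<N2. Q x y) \<subseteq> S" using main that by blast
    have Q: "w \<in> S" if "w \<in> Q x y" for w x y
    proof -
      have "(x, y) \<in> S" using that unfolding Q_def by blast
      then have "x < N1" "y < N2" unfolding S_def rel_def by auto
      then show ?thesis using that sub by blast
    qed
    show ?thesis
      unfolding pair_closed_def
    proof (intro conjI allI impI)
      fix x y u v assume "(x, y) \<in> S" "(u, v) \<in> S"
      then show "(x \<otimes> u, y \<otimes>\<^bsub>G2\<^esub> v) \<in> S" by (intro Q[of _ x y]) (auto simp: Q_def)
    next
      fix x y u v assume "(x, y) \<in> S" "u \<in> carrier G1" "v \<in> carrier G2"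
        "u \<otimes> c = c \<otimes> x" "v \<otimes>\<^bsub>G2\<^esub> d = d \<otimes>\<^bsub>G2\<^esub> y"
      then show "(u, v) \<in> S" by (intro Q[of _ x y]) (auto simp: Q_def conjs_def carrier)
    qed
  qed
  then show ?thesis using main unfolding S_def by blast
qed

text \<open>A round on an unsaturated relation adds a pair, and there are only
  \<open>N1 * N2\<close> pairs, so that many rounds suffice.\<close>

lemma close:
  assumes s: "inp c d s" and X: "X \<noteq> ''table1''" "X \<noteq> ''table2''" and ne: "rel X s \<noteq> {}"
  shows "rel X (den (close X) s) = pair_closure G1 G2 c d (rel X s)"
proof -
  define CL where "CL = pair_closure G1 G2 c d (rel X s)"
  have CL: "pair_closed G1 G2 c d CL" "rel X s \<subseteq> CL"
    unfolding CL_def by (auto intro: pair_closed_closure pair_closure.base)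
  \<comment> \<open>The strict bound \<open>j < card\<close> holds initially because the relation is
    nonempty. After \<open>N1 * N2\<close> rounds it would exceed the number of available pairs,
    which leaves only the closed case.\<close>
  define I where "I j s' \<longleftrightarrow> rel X s \<subseteq> rel X s' \<and> rel X s' \<subseteq> CL \<and>
    (pair_closed G1 G2 c d (rel X s') \<or> j < card (rel X s'))" for j s'
  have I_assign: "I j (assign x v s') = I j s'" for j x v s' unfolding I_def by simp
  have sub: "rel X s' \<subseteq> {..<N1} \<times> {..<N2}" for s' unfolding rel_def by auto
  have fin: "finite (rel X s')" for s' by (rule finite_subset[OF sub]) simp
  note inp = s[unfolded inp_def]
  have round: "I (Suc j) (den (close_round X) s')" if I: "I j s'" and inp': "inp c d s'" for j s'
  proof -
    have up: "rel X s' \<subseteq> CL" using I unfolding I_def by blast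
    from close_round[OF inp' X up CL(1)] consider
      (cl) "pair_closed G1 G2 c d (rel X s')" "rel X s' \<subseteq> rel X (den (close_round X) s')"
        "rel X (den (close_round X) s') \<subseteq> CL" |
      (gr) "\<not> pair_closed G1 G2 c d (rel X s')" "rel X s' \<subset> rel X (den (close_round X) s')"
        "rel X (den (close_round X) s') \<subseteq> CL" by blast
    then show ?thesis
    proof cases
      case cl
      have "CL \<subseteq> rel X s'"
        unfolding CL_def using I cl(1) by (intro pair_closure_least) (auto simp: I_def)
      then have "rel X (den (close_round X) s') = rel X s'" using cl(2,3) by blast
      then show ?thesis using I cl(1) unfolding I_def by simp
    next
      case gr
      have "card (rel X s') < card (rel X (den (close_round X) s'))" using gr(2) fin by (rule psubset_card_mono[rotated])
      then show ?thesis using I gr unfolding I_def by auto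
    qed
  qed
  have "I (N1 * N2) (den (close X) s)"
    unfolding close_def
  proof (rule for_induct[where I = "\<lambda>i. I (i * N2)"], goal_cases)
    case 5
    have "card (rel X s) > 0" using ne fin by (simp add: card_gt_0_iff)
    then show ?case unfolding I_assign using CL unfolding I_def by simp
  next
    case (6 i s1)
    note s1 = 6
    have "I (i * N2 + N2) (den (For ''q'' ''n2'' (close_round X)) s1)"
    proof (rule for_induct[where I = "\<lambda>j. I (i * N2 + j)"], goal_cases)
      case 5
      then show ?case using s1(2) unfolding I_assign by simp
    next
      case (6 j s2)
      have "inp c d s2" using 6 s1 inp X unfolding inp_def by simp
      then show ?case unfolding I_assign using round[OF 6(2)] by simp
    qed (use s1 inp in auto)
    then show ?case unfolding I_assign by (simp add: add.commute)
  qed (use inp in auto)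
  then have *: "rel X s \<subseteq> rel X (den (close X) s)" "rel X (den (close X) s) \<subseteq> CL"
    "pair_closed G1 G2 c d (rel X (den (close X) s)) \<or> N1 * N2 < card (rel X (den (close X) s))"
    unfolding I_def by auto
  have "card (rel X (den (close X) s)) \<le> N1 * N2"
    using card_mono[OF _ sub[of "den (close X) s"]] by simp
  then have "CL \<subseteq> rel X (den (close X) s)"
    unfolding CL_def using * by (intro pair_closure_least) auto
  then show ?thesis using *(2) unfolding CL_def by blast
qed

end

text \<open>
  Array \<open>Z\<close> holds the closure of the candidate \<open>(a, b)\<close>, array \<open>D\<close> the partial homomorphism built so far.
  Candidates are visited by decreasing sizes \<open>n1 - i\<close> and \<open>n2 - j\<close> of the two projections of \<open>Z\<close>. The
  variable \<open>m\<close> ranges from \<open>0\<close>, so the exponent tested by \<open>compute_powers\<close> is \<open>m + 1\<close>.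
\<close>

definition init_pairs :: "vname \<Rightarrow> lp" where
  "init_pairs X = For ''g'' ''n1'' (For ''h'' ''n2'' (Sto X (Var ''g'') (Var ''h'') (Num 0))) ;;
    Sto X (Var ''e1'') (Var ''e2'') (Num 1)"

text \<open>Rows and columns share this code. The flags \<open>p\<close> and \<open>o\<close> tell
  whether the line contains a pair of \<open>Z\<close> and of \<open>D\<close>, that is, whether the
  outer index lies in the respective projections.\<close>

definition scan_line :: "vname \<Rightarrow> vname \<Rightarrow> vname \<Rightarrow> lp" where
  "scan_line xi ni e =
    Asg ''p'' (Num 0) ;; Asg ''o'' (Num 0) ;;
    For xi ni (
      Cond (Eq (Elem ''Z'' (Var ''g'') (Var ''h'')) (Num 1)) (Asg ''p'' (Num 1)) Nop ;;
      Cond (Eq (Elem ''D'' (Var ''g'') (Var ''h'')) (Num 1)) (Asg ''o'' (Num 1)) Nop)"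

text \<open>\<open>k\<close> measures a projection of \<open>Z\<close>, while \<open>bad\<close>
  reports a nontrivial common element of the projections of \<open>Z\<close> and \<open>D\<close>.
  The flag is never cleared here, so the verdicts of both sides accumulate.\<close>

definition compare_side :: "vname \<Rightarrow> vname \<Rightarrow> vname \<Rightarrow> vname \<Rightarrow> vname \<Rightarrow> vname \<Rightarrow> lp" where
  "compare_side xo no xi ni e k =
    Asg k (Num 0) ;;
    For xo no (
      scan_line xi ni e ;;
      Asg k (Add (Var k) (Var ''p'')) ;;
      Cond (Conj (Eq (Var ''p'') (Num 1)) (Conj (Eq (Var ''o'') (Num 1)) (Neg (Eq (Var xo) (Var e)))))
        (Asg ''bad'' (Num 1)) Nop)"

text \<open>Loop bounds may only be group orders, so the loop runs to \<open>n1\<close> and the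
  guard stops the multiplication after \<open>m + 1\<close> factors.\<close>

definition compute_powers :: lp where
  "compute_powers =
    Asg ''x'' (Var ''e1'') ;; Asg ''y'' (Var ''e2'') ;;
    For ''t'' ''n1'' (Cond (Less (Var ''t'') (Add (Var ''m'') (Num 1)))
      (Asg ''x'' (T1 (Var ''x'') (Var ''a'')) ;; Asg ''y'' (T2 (Var ''y'') (Var ''b''))) Nop)"

definition greedy_step :: lp where
  "greedy_step =
    compute_powers ;;
    Cond (Conj (Eq (Var ''x'') (Var ''e1'')) (Eq (Var ''y'') (Var ''e2'')))
      (init_pairs ''Z'' ;; Sto ''Z'' (Var ''a'') (Var ''b'') (Num 1) ;; close ''Z'' ;;
       Asg ''bad'' (Num 0) ;;
       compare_side ''g'' ''n1'' ''h'' ''n2'' ''e1'' ''k1'' ;;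
       compare_side ''h'' ''n2'' ''g'' ''n1'' ''e2'' ''k2'' ;;
       Cond (Conj (Eq (Var ''bad'') (Num 0)) (Conj (Eq (Add (Var ''k1'') (Var ''i'')) (Var ''n1''))
           (Eq (Add (Var ''k2'') (Var ''j'')) (Var ''n2''))))
         (Sto ''D'' (Var ''a'') (Var ''b'') (Num 1) ;; close ''D'') Nop) Nop"

lemma greedy_step_frame [simp]:
  "modv (init_pairs X) = {''g'', ''h''}" "moda (init_pairs X) = {X}" "well_formed (init_pairs X)"
  "modv (scan_line xi ni e) = {''p'', ''o'', xi}" "moda (scan_line xi ni e) = {}"
  "modv (compare_side xo no xi ni e k) = {k, xo, ''p'', ''o'', xi, ''bad''}" "moda (compare_side xo no xi ni e k) = {}"
  "modv compute_powers = {''x'', ''y'', ''t''}" "moda compute_powers = {}" "well_formed compute_powers"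
  by (auto simp: init_pairs_def scan_line_def compare_side_def compute_powers_def)

lemma compare_side_well_formed [simp]:
  "well_formed (compare_side ''g'' ''n1'' ''h'' ''n2'' ''e1'' ''k1'')" "well_formed (compare_side ''h'' ''n2'' ''g'' ''n1'' ''e2'' ''k2'')"
  by (auto simp: compare_side_def scan_line_def)

lemma ex_less_Suc_iff: "(\<exists>j<Suc i. P j) \<longleftrightarrow> (\<exists>j<i. P j) \<or> P i"
  by (auto simp: less_Suc_eq)

lemma scan_line:
  assumes x: "(xo, xi) \<in> {(''g'', ''h''), (''h'', ''g'')}" and ni: "ni \<in> {''n1'', ''n2''}"
    and f: "\<And>j (s'::state). j < vars s ni \<Longrightarrow> vars s' xo = vars s xo \<Longrightarrow> vars s' xi = j \<Longrightarrow> arrs s' = arrs s \<Longrightarrow>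
      arrs s' ''Z'' (vars s' ''g'') (vars s' ''h'') = Suc 0 \<longleftrightarrow> P j"
      "\<And>j (s'::state). j < vars s ni \<Longrightarrow> vars s' xo = vars s xo \<Longrightarrow> vars s' xi = j \<Longrightarrow> arrs s' = arrs s \<Longrightarrow>
      arrs s' ''D'' (vars s' ''g'') (vars s' ''h'') = Suc 0 \<longleftrightarrow> Q j"
  shows "vars (den (scan_line xi ni e) s) ''p'' = of_bool (\<exists>j<vars s ni. P j)"
    "vars (den (scan_line xi ni e) s) ''o'' = of_bool (\<exists>j<vars s ni. Q j)"
proof -
  let ?s = "assign ''o'' 0 (assign ''p'' 0 s)"
  let ?b = "Cond (Eq (Elem ''Z'' (Var ''g'') (Var ''h'')) (Num 1)) (Asg ''p'' (Num 1)) Nop ;;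
      Cond (Eq (Elem ''D'' (Var ''g'') (Var ''h'')) (Num 1)) (Asg ''o'' (Num 1)) Nop"
  define N where "N = vars s ni"
  have "vars (den (For xi ni ?b) ?s) ''p'' = of_bool (\<exists>j<N. P j) \<and> vars (den (For xi ni ?b) ?s) ''o'' = of_bool (\<exists>j<N. Q j)"
  proof (rule for_induct[where I = "\<lambda>i s'. vars s' ''p'' = of_bool (\<exists>j<i. P j) \<and> vars s' ''o'' = of_bool (\<exists>j<i. Q j)"], goal_cases)
    case (6 i s')
    have "arrs s' = arrs s" "vars s' xo = vars s xo" using 6(5)[of] 6(4)[of xo] x by (auto intro!: ext)
    then have "arrs s' ''Z'' (vars s' ''g'') (vars s' ''h'') = Suc 0 \<longleftrightarrow> P i"
      "arrs s' ''D'' (vars s' ''g'') (vars s' ''h'') = Suc 0 \<longleftrightarrow> Q i"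
      using f(1)[of i s'] f(2)[of i s'] 6(1,3) unfolding N_def by blast+
    then have "vars (den ?b s') ''p'' = (if P i then 1 else vars s' ''p'')"
      "vars (den ?b s') ''o'' = (if Q i then 1 else vars s' ''o'')"
      by simp_all
    then show ?case using 6(2) x unfolding ex_less_Suc_iff by (auto simp del: den.simps)
  qed (use x ni in \<open>auto simp: N_def\<close>)
  then show "vars (den (scan_line xi ni e) s) ''p'' = of_bool (\<exists>j<vars s ni. P j)"
    "vars (den (scan_line xi ni e) s) ''o'' = of_bool (\<exists>j<vars s ni. Q j)"
    by (simp_all add: scan_line_def N_def)
qed

lemma card_less_Suc_filter: "card {i. i < Suc n \<and> P i} = card {i. i < n \<and> P i} + of_bool (P n)"
proof -
  have *: "{i. i < Suc n \<and> P i} = {i. i < n \<and> P i} \<union> (if P n then {n} else {})" by (auto simp: less_Suc_eq)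
  show ?thesis unfolding * by (subst card_Un_disjoint) auto
qed

lemma compare_side:
  assumes x: "(xo, xi) \<in> {(''g'', ''h''), (''h'', ''g'')}" and n: "no \<in> {''n1'', ''n2''}" "ni \<in> {''n1'', ''n2''}"
    and e: "(e, k) \<in> {(''e1'', ''k1''), (''e2'', ''k2'')}"
    and f: "\<And>i j (s'::state). i < vars s no \<Longrightarrow> j < vars s ni \<Longrightarrow> vars s' xo = i \<Longrightarrow> vars s' xi = j \<Longrightarrow> arrs s' = arrs s \<Longrightarrow>
      arrs s' ''Z'' (vars s' ''g'') (vars s' ''h'') = Suc 0 \<longleftrightarrow> P i j"
      "\<And>i j (s'::state). i < vars s no \<Longrightarrow> j < vars s ni \<Longrightarrow> vars s' xo = i \<Longrightarrow> vars s' xi = j \<Longrightarrow> arrs s' = arrs s \<Longrightarrow>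
      arrs s' ''D'' (vars s' ''g'') (vars s' ''h'') = Suc 0 \<longleftrightarrow> Q i j"
  shows "vars (den (compare_side xo no xi ni e k) s) k = card {i. i < vars s no \<and> (\<exists>j<vars s ni. P i j)}"
    "vars (den (compare_side xo no xi ni e k) s) ''bad'' =
      (if \<exists>i<vars s no. (\<exists>j<vars s ni. P i j) \<and> (\<exists>j<vars s ni. Q i j) \<and> i \<noteq> vars s e then 1 else vars s ''bad'')"
proof -
  let ?s = "assign k 0 s"
  let ?b = "scan_line xi ni e ;;
      Asg k (Add (Var k) (Var ''p'')) ;;
      Cond (Conj (Eq (Var ''p'') (Num 1)) (Conj (Eq (Var ''o'') (Num 1)) (Neg (Eq (Var xo) (Var e)))))
        (Asg ''bad'' (Num 1)) Nop"
  define N where "N = vars s no"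
  define P' where "P' i \<longleftrightarrow> (\<exists>j<vars s ni. P i j)" for i
  define Q' where "Q' i \<longleftrightarrow> (\<exists>j<vars s ni. Q i j)" for i
  define I where "I n s' \<longleftrightarrow> vars s' k = card {i. i < n \<and> P' i} \<and>
    vars s' ''bad'' = (if \<exists>i<n. P' i \<and> Q' i \<and> i \<noteq> vars s e then 1 else vars s ''bad'')" for n and s' :: state
  have "I N (den (For xo no ?b) ?s)"
  proof (rule for_induct[where I = I], goal_cases)
    case (6 n s')
    have arrs: "arrs s' = arrs s" using 6(5) by (auto intro!: ext)
    have ve: "vars s' e = vars s e" "vars s' ni = vars s ni" using 6(4)[of e] 6(4)[of ni] x n e by auto
    define s1 where "s1 = den (scan_line xi ni e) s'"
    have po: "vars s1 ''p'' = of_bool (P' n)" "vars s1 ''o'' = of_bool (Q' n)"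
      unfolding s1_def P'_def Q'_def ve(2)[symmetric]
      using f(1)[of n] f(2)[of n] 6(1,3) arrs ve(2) unfolding N_def
      by (intro scan_line[OF x n(2)]; simp)+
    have fr: "vars s1 y = vars s' y" if "y \<notin> {''p'', ''o'', xi}" for y
      unfolding s1_def using that by (intro vars_den) simp
    have v: "vars s1 k = vars s' k" "vars s1 e = vars s e" "vars s1 xo = n" "vars s1 ''bad'' = vars s' ''bad''"
      using fr[of k] fr[of e] fr[of xo] fr[of "''bad''"] ve 6(3) x n e by auto
    have ke: "k \<noteq> ''p''" "k \<noteq> ''o''" "k \<noteq> e" "k \<noteq> xo" "k \<noteq> ''bad''" "xo \<noteq> ''bad''" using x e by auto
    define s2 where "s2 = assign k (vars s1 k + vars s1 ''p'') s1"
    define s3 where "s3 = (if P' n \<and> Q' n \<and> n \<noteq> vars s e then assign ''bad'' 1 s2 else s2)"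
    have s3: "den ?b s' = s3"
      using ke po v unfolding s3_def s2_def by (simp add: s1_def[symmetric])
    have "vars s3 k = vars s' k + of_bool (P' n)"
      "vars s3 ''bad'' = (if P' n \<and> Q' n \<and> n \<noteq> vars s e then 1 else vars s' ''bad'')"
      using ke po v unfolding s3_def s2_def by auto
    then have "I (Suc n) s3"
      using 6(2) unfolding I_def card_less_Suc_filter ex_less_Suc_iff by auto
    then show ?case using ke x e unfolding s3 I_def by auto
  next
    case 5
    then show ?case using x e unfolding I_def by auto
  qed (use x n e in \<open>auto simp: N_def\<close>)
  then show "vars (den (compare_side xo no xi ni e k) s) k = card {i. i < vars s no \<and> (\<exists>j<vars s ni. P i j)}"
    "vars (den (compare_side xo no xi ni e k) s) ''bad'' =
      (if \<exists>i<vars s no. (\<exists>j<vars s ni. P i j) \<and> (\<exists>j<vars s ni. Q i j) \<and> i \<noteq> vars s e then 1 else vars s ''bad'')"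
    unfolding I_def P'_def Q'_def N_def by (simp_all add: compare_side_def)
qed

context tables begin

definition base :: "nat \<Rightarrow> nat \<Rightarrow> state \<Rightarrow> bool" where
  "base c d s \<longleftrightarrow> inp c d s \<and> vars s ''e1'' = \<one> \<and> vars s ''e2'' = \<one>\<^bsub>G2\<^esub>"

lemma one_less [simp]: "\<one> < N1" "\<one>\<^bsub>G2\<^esub> < N2"
  using G1.one_closed G2.one_closed unfolding carrier by auto

lemma base_den:
  assumes "base c d s" "{''n1'', ''n2'', ''c'', ''d'', ''e1'', ''e2''} \<inter> modv p = {}" "{''table1'', ''table2''} \<inter> moda p = {}"
  shows "base c d (den p s)"
  using assms unfolding base_def inp_def by (simp add: vars_den arrs_den)

lemma init_pairs:
  assumes s: "base c d s"
  shows "rel X (den (init_pairs X) s) = {(\<one>, \<one>\<^bsub>G2\<^esub>)}"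
proof -
  let ?p = "For ''g'' ''n1'' (For ''h'' ''n2'' (Sto X (Var ''g'') (Var ''h'') (Num 0)))"
  note b = s[unfolded base_def inp_def]
  have "\<forall>x<N1. \<forall>y<N2. arrs (den ?p s) X x y = 0"
  proof (rule for_induct[where I = "\<lambda>i s'. \<forall>x<i. \<forall>y<N2. arrs s' X x y = 0"], goal_cases)
    case (6 x s1)
    note s1 = 6
    let ?q = "For ''h'' ''n2'' (Sto X (Var ''g'') (Var ''h'') (Num 0))"
    have "(\<forall>x'<x. \<forall>y<N2. arrs (den ?q s1) X x' y = 0) \<and> (\<forall>y<N2. arrs (den ?q s1) X x y = 0)"
    proof (rule for_induct[where I = "\<lambda>j s'. (\<forall>x'<x. \<forall>y<N2. arrs s' X x' y = 0) \<and> (\<forall>y<j. arrs s' X x y = 0)"], goal_cases)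
      case (6 y s2)
      have "vars s2 ''g'' = x" using 6(4)[of "''g''"] s1(3) by simp
      then show ?case using 6(2,3) by (auto simp: less_Suc_eq)
    qed (use s1 b in auto)
    then show ?case by (auto simp: less_Suc_eq)
  qed (use b in auto)
  then have "rel X (den ?p s) = {}" unfolding rel_def by auto
  moreover have "vars (den ?p s) ''e1'' = \<one>" "vars (den ?p s) ''e2'' = \<one>\<^bsub>G2\<^esub>"
    using b by (simp_all add: vars_den del: den.simps)
  ultimately show ?thesis by (simp add: init_pairs_def rel_store del: den.simps(6))
qed

lemma compute_powers:
  assumes s: "base c d s" and m: "vars s ''m'' < N1" and ab: "vars s ''a'' = a" "vars s ''b'' = b" "a < N1" "b < N2"
  shows "vars (den compute_powers s) ''x'' = a [^] Suc (vars s ''m'')" "vars (den compute_powers s) ''y'' = b [^]\<^bsub>G2\<^esub> Suc (vars s ''m'')"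
proof -
  let ?b = "Cond (Less (Var ''t'') (Add (Var ''m'') (Num 1)))
      (Asg ''x'' (T1 (Var ''x'') (Var ''a'')) ;; Asg ''y'' (T2 (Var ''y'') (Var ''b''))) Nop"
  let ?s = "assign ''y'' (vars s ''e2'') (assign ''x'' (vars s ''e1'') s)"
  note b = s[unfolded base_def inp_def]
  let ?I = "\<lambda>i s'. vars s' ''x'' = a [^] min i (Suc (vars s ''m'')) \<and> vars s' ''y'' = b [^]\<^bsub>G2\<^esub> min i (Suc (vars s ''m''))"
  have lt: "a [^] (k::nat) < N1" "b [^]\<^bsub>G2\<^esub> k < N2" for k
    using G1.nat_pow_closed[of a k] G2.nat_pow_closed[of b k] ab(3,4) unfolding carrier by auto
  have "?I N1 (den (For ''t'' ''n1'' ?b) ?s)"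
  proof (rule for_induct[where I = ?I], goal_cases)
    case (6 i s')
    have "vars s' ''m'' = vars s ''m''" "vars s' ''a'' = a" "vars s' ''b'' = b" "vars s' ''t'' = i"
      "arrs s' ''table1'' = cayley_table G1" "arrs s' ''table2'' = cayley_table G2"
      using 6(3,4,5) ab b by simp_all
    then show ?case
      using 6(2) lt ab by (simp add: cayley_table_def min_def not_less_eq_eq split: if_splits)
  qed (use b in auto)
  moreover have "min N1 (Suc (vars s ''m'')) = Suc (vars s ''m'')" using m by simp
  ultimately show "vars (den compute_powers s) ''x'' = a [^] Suc (vars s ''m'')" "vars (den compute_powers s) ''y'' = b [^]\<^bsub>G2\<^esub> Suc (vars s ''m'')"
    by (simp_all add: compute_powers_def)
qed

end

context tables begin

lemma in_rel_iff: "x < N1 \<Longrightarrow> y < N2 \<Longrightarrow> arrs s X x y = Suc 0 \<longleftrightarrow> (x, y) \<in> rel X s"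
  by (simp add: rel_def)

lemma rel_den: "X \<notin> moda p \<Longrightarrow> rel X (den p s) = rel X s"
  by (rule rel_cong) (rule arrs_den)

lemma rel_sub: "(x, y) \<in> rel X s \<Longrightarrow> x < N1 \<and> y < N2"
  by (auto simp: rel_def)

text \<open>Membership in \<open>A\<close> and \<open>B\<close> and feasibility, expressed through
  the tables, \<open>c\<close>, \<open>d\<close> and the exponent alone; no epimorphism has to be
  given.\<close>

definition candidate :: "nat \<Rightarrow> nat \<Rightarrow> nat \<Rightarrow> (nat \<times> nat) set \<Rightarrow> nat \<Rightarrow> nat \<Rightarrow> nat \<Rightarrow> nat \<Rightarrow> bool" where
  "candidate c d m D i j a b \<longleftrightarrow>
    (let Z = pair_closure G1 G2 c d {(\<one>, \<one>\<^bsub>G2\<^esub>), (a, b)} in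
      a [^] m = \<one> \<and> b [^]\<^bsub>G2\<^esub> m = \<one>\<^bsub>G2\<^esub> \<and>
      Domain Z \<inter> Domain D \<subseteq> {\<one>} \<and> Range Z \<inter> Range D \<subseteq> {\<one>\<^bsub>G2\<^esub>} \<and>
      card (Domain Z) + i = N1 \<and> card (Range Z) + j = N2)"

lemma greedy_step:
  assumes s: "base c d s" and m: "vars s ''m'' < N1"
    and ab: "vars s ''a'' = a" "vars s ''b'' = b" "a < N1" "b < N2"
  shows "rel ''D'' (den greedy_step s) =
    (if candidate c d (Suc (vars s ''m'')) (rel ''D'' s) (vars s ''i'') (vars s ''j'') a b
     then pair_closure G1 G2 c d (insert (a, b) (rel ''D'' s)) else rel ''D'' s)"
proof -
  define D where "D = rel ''D'' s"
  define Z where "Z = pair_closure G1 G2 c d {(\<one>, \<one>\<^bsub>G2\<^esub>), (a, b)}"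
  define s1 where "s1 = den compute_powers s"
  have b1: "base c d s1" unfolding s1_def by (rule base_den[OF s]) auto
  have v1: "vars s1 ''a'' = a" "vars s1 ''b'' = b" "vars s1 ''i'' = vars s ''i''" "vars s1 ''j'' = vars s ''j''"
    unfolding s1_def using ab by (simp_all add: vars_den)
  have D1: "rel ''D'' s1 = D" unfolding s1_def D_def by (rule rel_den) simp
  have cond: "bval (Conj (Eq (Var ''x'') (Var ''e1'')) (Eq (Var ''y'') (Var ''e2''))) s1 \<longleftrightarrow>
      a [^] Suc (vars s ''m'') = \<one> \<and> b [^]\<^bsub>G2\<^esub> Suc (vars s ''m'') = \<one>\<^bsub>G2\<^esub>"
    using b1 compute_powers[OF s m ab] unfolding s1_def[symmetric] base_def by simp
  show ?thesis
  proof (cases "bval (Conj (Eq (Var ''x'') (Var ''e1'')) (Eq (Var ''y'') (Var ''e2''))) s1")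
    case False
    then have "den greedy_step s = s1"
      unfolding greedy_step_def den.simps s1_def[symmetric] by (simp only: if_False)
    moreover have "\<not> candidate c d (Suc (vars s ''m'')) D (vars s ''i'') (vars s ''j'') a b"
      using False unfolding cond candidate_def Let_def by blast
    ultimately show ?thesis using D1 unfolding D_def by simp
  next
    case True
    define s2 where "s2 = den (init_pairs ''Z'') s1"
    have b2: "base c d s2" unfolding s2_def by (rule base_den[OF b1]) auto
    have v2: "vars s2 ''a'' = a" "vars s2 ''b'' = b" "vars s2 ''i'' = vars s ''i''" "vars s2 ''j'' = vars s ''j''"
      unfolding s2_def using v1 by (simp_all add: vars_den)
    have D2: "rel ''D'' s2 = D" "rel ''Z'' s2 = {(\<one>, \<one>\<^bsub>G2\<^esub>)}"
      unfolding s2_def using D1 init_pairs[OF b1] by (simp_all add: rel_den)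
    define s3 where "s3 = store ''Z'' a b (Suc 0) s2"
    have arrs3: "arrs s3 X = arrs s2 X" if "X \<noteq> ''Z''" for X
      unfolding s3_def using that by (auto intro!: ext)
    have b3: "base c d s3" using b2 arrs3[of "''table1''"] arrs3[of "''table2''"]
      unfolding base_def inp_def by (simp add: s3_def)
    have v3: "vars s3 ''i'' = vars s ''i''" "vars s3 ''j'' = vars s ''j''" "vars s3 ''a'' = a" "vars s3 ''b'' = b"
      unfolding s3_def using v2 by simp_all
    have "rel ''D'' s3 = D" using D2(1) rel_cong[OF arrs3, of "''D''"] by simp
    moreover have "rel ''Z'' s3 = {(\<one>, \<one>\<^bsub>G2\<^esub>), (a, b)}"
      unfolding s3_def rel_store using D2(2) ab by auto
    ultimately have D3: "rel ''D'' s3 = D" "rel ''Z'' s3 = {(\<one>, \<one>\<^bsub>G2\<^esub>), (a, b)}" by blast+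
    define s4 where "s4 = den (close ''Z'') s3"
    have b4: "base c d s4" unfolding s4_def by (rule base_den[OF b3]) auto
    have v4: "vars s4 ''i'' = vars s ''i''" "vars s4 ''j'' = vars s ''j''" "vars s4 ''a'' = a" "vars s4 ''b'' = b"
      unfolding s4_def using v3 by (simp_all add: vars_den)
    have "inp c d s3" using b3 unfolding base_def by blast
    then have D4: "rel ''D'' s4 = D" "rel ''Z'' s4 = Z"
      unfolding s4_def Z_def using D3 by (simp_all add: rel_den close)
    define s5 where "s5 = assign ''bad'' 0 s4"
    have b5: "base c d s5" using b4 unfolding s5_def base_def inp_def by simp
    have v5: "vars s5 ''i'' = vars s ''i''" "vars s5 ''j'' = vars s ''j''" "vars s5 ''a'' = a" "vars s5 ''b'' = b"
      "vars s5 ''bad'' = 0" "vars s5 ''n1'' = N1" "vars s5 ''n2'' = N2"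
      "vars s5 ''e1'' = \<one>" "vars s5 ''e2'' = \<one>\<^bsub>G2\<^esub>"
      using v4 b5 unfolding s5_def base_def inp_def by simp_all
    have D5: "rel ''D'' s5 = D" "rel ''Z'' s5 = Z" unfolding s5_def using D4 by simp_all
    have Zb: "x < N1 \<and> y < N2" if "(x, y) \<in> Z" for x y using that rel_sub[of x y] D5(2) by blast
    have Db: "x < N1 \<and> y < N2" if "(x, y) \<in> D" for x y using that rel_sub[of x y] D5(1) by blast
    have dom: "{x. x < N1 \<and> (\<exists>y<N2. (x, y) \<in> Z)} = Domain Z" "{y. y < N2 \<and> (\<exists>x<N1. (x, y) \<in> Z)} = Range Z"
      using Zb by blast+
    have rel5: "arrs s' ''Z'' x y = Suc 0 \<longleftrightarrow> (x, y) \<in> Z" "arrs s' ''D'' x y = Suc 0 \<longleftrightarrow> (x, y) \<in> D"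
      if "arrs s' = arrs s5" "x < N1" "y < N2" for s' :: state and x y
      using in_rel_iff[OF that(2,3)] rel_cong[of s' _ s5] D5 that(1) by metis+
    define s6 where "s6 = den (compare_side ''g'' ''n1'' ''h'' ''n2'' ''e1'' ''k1'') s5"
    have s6: "vars s6 ''k1'' = card {x. x < vars s5 ''n1'' \<and> (\<exists>y<vars s5 ''n2''. (x, y) \<in> Z)}"
      "vars s6 ''bad'' = (if \<exists>x<vars s5 ''n1''. (\<exists>y<vars s5 ''n2''. (x, y) \<in> Z) \<and>
        (\<exists>y<vars s5 ''n2''. (x, y) \<in> D) \<and> x \<noteq> vars s5 ''e1'' then 1 else vars s5 ''bad'')"
      unfolding s6_def by (rule compare_side; auto simp: rel5 v5)+
    have arrs6: "arrs s6 = arrs s5" unfolding s6_def by (auto intro!: ext simp: arrs_den)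
    have v6: "vars s6 ''i'' = vars s ''i''" "vars s6 ''j'' = vars s ''j''" "vars s6 ''a'' = a" "vars s6 ''b'' = b"
      "vars s6 ''n1'' = N1" "vars s6 ''n2'' = N2" "vars s6 ''e2'' = \<one>\<^bsub>G2\<^esub>"
      unfolding s6_def using v5 by (simp_all add: vars_den)
    define s7 where "s7 = den (compare_side ''h'' ''n2'' ''g'' ''n1'' ''e2'' ''k2'') s6"
    have s7: "vars s7 ''k2'' = card {y. y < vars s6 ''n2'' \<and> (\<exists>x<vars s6 ''n1''. (x, y) \<in> Z)}"
      "vars s7 ''bad'' = (if \<exists>y<vars s6 ''n2''. (\<exists>x<vars s6 ''n1''. (x, y) \<in> Z) \<and>
        (\<exists>x<vars s6 ''n1''. (x, y) \<in> D) \<and> y \<noteq> vars s6 ''e2'' then 1 else vars s6 ''bad'')"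
      unfolding s7_def by (rule compare_side; auto simp: rel5 v6 arrs6)+
    have b7: "base c d s7" unfolding s7_def s6_def by (intro base_den b5) auto
    have v7: "vars s7 ''i'' = vars s ''i''" "vars s7 ''j'' = vars s ''j''" "vars s7 ''a'' = a" "vars s7 ''b'' = b"
      "vars s7 ''n1'' = N1" "vars s7 ''n2'' = N2" "vars s7 ''k1'' = card (Domain Z)" "vars s7 ''k2'' = card (Range Z)"
      using v6 s6(1) s7(1) v5 dom by (simp_all add: s7_def vars_den)
    have D7: "rel ''D'' s7 = D" unfolding s7_def s6_def using D5 by (simp add: rel_den)
    have "vars s7 ''bad'' = 0 \<longleftrightarrow> Domain Z \<inter> Domain D \<subseteq> {\<one>} \<and> Range Z \<inter> Range D \<subseteq> {\<one>\<^bsub>G2\<^esub>}"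
    proof -
      have "(\<exists>x<N1. (\<exists>y<N2. (x, y) \<in> Z) \<and> (\<exists>y<N2. (x, y) \<in> D) \<and> x \<noteq> \<one>) \<longleftrightarrow>
          \<not> Domain Z \<inter> Domain D \<subseteq> {\<one>}" using Zb Db by blast
      moreover have "(\<exists>y<N2. (\<exists>x<N1. (x, y) \<in> Z) \<and> (\<exists>x<N1. (x, y) \<in> D) \<and> y \<noteq> \<one>\<^bsub>G2\<^esub>) \<longleftrightarrow>
          \<not> Range Z \<inter> Range D \<subseteq> {\<one>\<^bsub>G2\<^esub>}" using Zb Db by blast
      ultimately show ?thesis using s6(2) s7(2) v5 v6 by simp
    qed
    then have cand: "bval (Conj (Eq (Var ''bad'') (Num 0)) (Conj (Eq (Add (Var ''k1'') (Var ''i'')) (Var ''n1''))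
           (Eq (Add (Var ''k2'') (Var ''j'')) (Var ''n2'')))) s7 \<longleftrightarrow>
        candidate c d (Suc (vars s ''m'')) D (vars s ''i'') (vars s ''j'') a b"
      using True unfolding cond candidate_def Let_def Z_def[symmetric] by (simp add: v7)
    have steps: "den greedy_step s = (if candidate c d (Suc (vars s ''m'')) D (vars s ''i'') (vars s ''j'') a b
        then den (close ''D'') (store ''D'' a b (Suc 0) s7) else s7)"
      unfolding greedy_step_def den.simps s1_def[symmetric] if_P[OF True] s2_def[symmetric]
      by (simp add: v2 v7 s3_def[symmetric] s4_def[symmetric] s5_def[symmetric] s6_def[symmetric] s7_def[symmetric]
          cand del: bval.simps bval_Eq)
    define s8 where "s8 = store ''D'' a b (Suc 0) s7"
    have "arrs s8 X = arrs s7 X" if "X \<noteq> ''D''" for X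
      unfolding s8_def using that by (auto intro!: ext)
    then have "inp c d s8" using b7 unfolding base_def inp_def by (simp add: s8_def)
    moreover have "rel ''D'' s8 = insert (a, b) D" unfolding s8_def rel_store using D7 ab by simp
    ultimately have "rel ''D'' (den (close ''D'') s8) = pair_closure G1 G2 c d (insert (a, b) D)"
      using close[of c d s8 "''D''"] by simp
    then show ?thesis unfolding steps s8_def[symmetric] D_def[symmetric] using D7 by simp
  qed
qed

end

section \<open>Lexicographic search for the next pair of generators\<close>

definition greedy_loop :: lp where
  "greedy_loop = For ''i'' ''n1'' (For ''j'' ''n2'' (For ''a'' ''n1'' (For ''b'' ''n2'' greedy_step)))"

definition lex4 :: "nat \<times> nat \<times> nat \<times> nat \<Rightarrow> nat \<times> nat \<times> nat \<times> nat \<Rightarrow> bool" where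
  "lex4 = (\<lambda>(i', j', a', b') (i, j, a, b).
     i' < i \<or> i' = i \<and> (j' < j \<or> j' = j \<and> (a' < a \<or> a' = a \<and> b' < b)))"

lemma greedy_loop_frame [simp]:
  "modv greedy_step = {''x'', ''y'', ''t'', ''g'', ''h'', ''u'', ''v'', ''r'', ''q'', ''bad'', ''k1'', ''k2'', ''p'', ''o''}"
  "moda greedy_step = {''Z'', ''D''}" "well_formed greedy_step"
  "modv greedy_loop = {''i'', ''j'', ''a'', ''b'', ''x'', ''y'', ''t'', ''g'', ''h'', ''u'', ''v'', ''r'', ''q'', ''bad'', ''k1'', ''k2'', ''p'', ''o''}"
  "moda greedy_loop = {''Z'', ''D''}" "well_formed greedy_loop"
  by (auto simp: greedy_step_def greedy_loop_def)

text \<open>The instance of \<open>B_eq\<close> for the identity epimorphism.\<close>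

lemma (in semidirect) A_eq: "A = {x \<in> carrier G1. x [^] m = \<one>}"
proof -
  have "id \<in> epi G1 G1" by (simp add: epi_def hom_def Pi_def)
  then interpret self: semidirect_epi G1 A c m h G1 id
    using semidirect_axioms G1.is_group by (simp add: semidirect_epi_def semidirect_epi_axioms_def)
  have "self.B = A" by (simp add: self.B_def)
  from trans[OF sym[OF this] self.B_eq] show ?thesis .
qed

locale tables_epi = tables + semidirect_epi G1 A c "Suc m" h G2 f for A c m h f
begin

text \<open>
  The position in the four nested loops at which a pair is accepted, if at all. Feasibility only shrinks
  while \<open>D\<close> grows, so pairs that were passed over remain useless.
\<close>

definition key :: "nat \<Rightarrow> nat \<Rightarrow> nat \<times> nat \<times> nat \<times> nat" where
  "key a b = (N1 - card (Domain (Z a b)), N2 - card (Range (Z a b)), a, b)"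

text \<open>The identity pair stays feasible forever, which is why it is exempted.\<close>

definition invar :: "nat \<times> nat \<times> nat \<times> nat \<Rightarrow> (nat \<times> nat) set \<Rightarrow> bool" where
  "invar t D \<longleftrightarrow> greedy_inv D \<and>
    (\<forall>a\<in>A. \<forall>b\<in>B. feasible D a b \<longrightarrow> lex4 (key a b) t \<longrightarrow> a = \<one> \<and> b = \<one>\<^bsub>G2\<^esub>)"

lemma Z_card:
  assumes "a \<in> A" "b \<in> B"
  shows "0 < card (Domain (Z a b))" "card (Domain (Z a b)) \<le> N1" "0 < card (Range (Z a b))" "card (Range (Z a b)) \<le> N2"
    "\<one> \<in> Domain (Z a b)" "\<one>\<^bsub>G2\<^esub> \<in> Range (Z a b)" "a \<in> Domain (Z a b)" "b \<in> Range (Z a b)"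
proof -
  have c1: "Domain (Z a b) \<subseteq> carrier G1" "Range (Z a b) \<subseteq> carrier G2"
    using Z_cyc[OF assms] assms M.submodD(1)[OF M.submod_cyc[of a]] N.submodD(1)[OF N.submod_cyc[of b]] A_sub B_sub by auto
  show 1: "\<one> \<in> Domain (Z a b)" "\<one>\<^bsub>G2\<^esub> \<in> Range (Z a b)" "a \<in> Domain (Z a b)" "b \<in> Range (Z a b)"
    by (auto intro: pair_closure.base)
  have fin: "finite (carrier G1)" "finite (carrier G2)" using table1 table2 unfolding table_group_def by (metis finite_atLeastLessThan)+
  have fin': "finite (Domain (Z a b))" "finite (Range (Z a b))" using c1 fin finite_subset by blast+
  show "0 < card (Domain (Z a b))" "0 < card (Range (Z a b))" using 1 fin' by (auto simp: card_gt_0_iff)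
  show "card (Domain (Z a b)) \<le> N1" "card (Range (Z a b)) \<le> N2"
    using card_mono[OF fin(1) c1(1)] card_mono[OF fin(2) c1(2)] by (simp_all add: Coset.order_def)
qed

lemma A_iff: "a < N1 \<Longrightarrow> a \<in> A \<longleftrightarrow> a [^] Suc m = \<one>"
  using A_eq carrier by auto

lemma B_iff: "b < N2 \<Longrightarrow> b \<in> B \<longleftrightarrow> b [^]\<^bsub>G2\<^esub> Suc m = \<one>\<^bsub>G2\<^esub>"
  using B_eq carrier by auto

lemma candidate_iff:
  assumes "a < N1" "b < N2"
  shows "candidate c d (Suc m) D i j a b \<longleftrightarrow> a \<in> A \<and> b \<in> B \<and> feasible D a b \<and>
    card (Domain (Z a b)) + i = N1 \<and> card (Range (Z a b)) + j = N2"
  unfolding candidate_def Let_def A_iff[OF assms(1)] B_iff[OF assms(2)] feasible_def by blast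

lemma card_Z_one: "a \<in> A \<Longrightarrow> b \<in> B \<Longrightarrow> card (Domain (Z \<one> b)) = 1" "a \<in> A \<Longrightarrow> b \<in> B \<Longrightarrow> card (Range (Z a \<one>\<^bsub>G2\<^esub>)) = 1"
proof -
  have "M.cyc \<one> = {\<one>}" "N.cyc \<one>\<^bsub>G2\<^esub> = {\<one>\<^bsub>G2\<^esub>}"
    using M.act_one N.act_one by (auto simp: M.cyc_def N.cyc_def)
  then show "a \<in> A \<Longrightarrow> b \<in> B \<Longrightarrow> card (Domain (Z \<one> b)) = 1" "a \<in> A \<Longrightarrow> b \<in> B \<Longrightarrow> card (Range (Z a \<one>\<^bsub>G2\<^esub>)) = 1"
    using Z_cyc A.one_closed subgroup.one_closed[OF B_subgroup] by simp_all
qed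

text \<open>A feasible pair beating the accepted one in one coordinate would have an earlier key:
  changing \<open>b\<close> alone leaves the first key component as it is. By the invariant its
  changed coordinate is trivial and generates a set of size 1, which beats nothing. An accepted pair
  lies in the new \<open>D\<close> and is thereby infeasible itself unless trivial.\<close>

lemma invar_step:
  assumes D: "invar (i, j, a, b) D" and ab: "a < N1" "b < N2"
  shows "invar (i, j, a, Suc b) (if candidate c d (Suc m) D i j a b then cl (insert (a, b) D) else D)"
proof (cases "candidate c d (Suc m) D i j a b")
  case True
  then have *: "a \<in> A" "b \<in> B" "feasible D a b" "card (Domain (Z a b)) + i = N1" "card (Range (Z a b)) + j = N2"
    unfolding candidate_iff[OF ab] by blast+
  have key: "key a b = (i, j, a, b)" unfolding key_def using *(4,5) by auto
  have triv: "a' = \<one> \<and> b' = \<one>\<^bsub>G2\<^esub>" if "a' \<in> A" "b' \<in> B" "feasible D a' b'" "lex4 (key a' b') (i, j, a, b)" for a' b'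
    using D that unfolding invar_def by blast
  define D' where "D' = cl (insert (a, b) D)"
  have sub: "insert (a, b) D \<subseteq> D'" unfolding D'_def by (auto intro: pair_closure.base)
  have "greedy_inv D'"
    unfolding D'_def
  proof (rule greedy_inv_step[OF _ *(1,2,3)])
    show "greedy_inv D" using D unfolding invar_def by blast
  next
    fix a' assume a': "a' \<in> A" "feasible D a' b"
    show "card (Domain (Z a' b)) \<le> card (Domain (Z a b))"
    proof (rule ccontr)
      assume gt: "\<not> ?thesis"
      then have "lex4 (key a' b) (i, j, a, b)"
        using Z_card(2)[OF a'(1) *(2)] *(4) unfolding key_def lex4_def by auto
      then have "a' = \<one>" using triv[OF a'(1) *(2) a'(2)] by blast
      then show False using gt card_Z_one(1)[OF *(1,2)] Z_card(1)[OF *(1,2)] by simp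
    qed
  next
    fix b' assume b': "b' \<in> B" "feasible D a b'"
    show "card (Range (Z a b')) \<le> card (Range (Z a b))"
    proof (rule ccontr)
      assume gt: "\<not> ?thesis"
      then have "lex4 (key a b') (i, j, a, b)"
        using Z_card(4)[OF *(1) b'(1)] *(4,5) Z_cyc[OF *(1,2)] Z_cyc[OF *(1) b'(1)] unfolding key_def lex4_def by auto
      then have "b' = \<one>\<^bsub>G2\<^esub>" using triv[OF *(1) b'(1) b'(2)] by blast
      then show False using gt card_Z_one(2)[OF *(1,2)] Z_card(3)[OF *(1,2)] by simp
    qed
  qed
  moreover have "a' = \<one> \<and> b' = \<one>\<^bsub>G2\<^esub>"
    if a': "a' \<in> A" "b' \<in> B" "feasible D' a' b'" "lex4 (key a' b') (i, j, a, Suc b)" for a' b'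
  proof (cases "lex4 (key a' b') (i, j, a, b)")
    case True
    have "feasible D a' b'"
      using a'(3) sub unfolding feasible_def by (meson Domain_mono Int_mono Range_mono order_refl subset_insertI subset_trans)
    then show ?thesis using triv a' True by blast
  next
    case False
    \<comment> \<open>Advancing from \<open>b\<close> to \<open>Suc b\<close> passes exactly one
      position, namely \<open>(i, j, a, b)\<close>.\<close>
    then have "a' = a \<and> b' = b" using a'(4) unfolding key_def lex4_def by auto
    moreover have "a \<in> Domain (Z a b) \<inter> Domain D'" "b \<in> Range (Z a b) \<inter> Range D'"
      using Z_card(7,8)[OF *(1,2)] sub by auto
    ultimately show ?thesis using a'(3) unfolding feasible_def by blast
  qed
  ultimately show ?thesis using True unfolding invar_def D'_def by simp
next
  case False
  have "a' = \<one> \<and> b' = \<one>\<^bsub>G2\<^esub>"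
    if a': "a' \<in> A" "b' \<in> B" "feasible D a' b'" "lex4 (key a' b') (i, j, a, Suc b)" for a' b'
  proof (cases "lex4 (key a' b') (i, j, a, b)")
    case True
    then show ?thesis using D a' unfolding invar_def by blast
  next
    case False': False
    then have eq: "a' = a" "b' = b" using a'(4) unfolding key_def lex4_def by auto
    then have "N1 - card (Domain (Z a b)) = i" "N2 - card (Range (Z a b)) = j"
      using a'(4) False' unfolding key_def lex4_def by auto
    then have "candidate c d (Suc m) D i j a b"
      unfolding candidate_iff[OF ab] using a' Z_card(2,4)[OF a'(1,2)] eq by auto
    then show ?thesis using False by blast
  qed
  then show ?thesis using False D unfolding invar_def by simp
qed

text \<open>Serves to roll the position over at the end of an inner loop, where no key lies between
  the old and the new position.\<close>

lemma invar_mono: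
  assumes "invar t D" "\<And>a b. a \<in> A \<Longrightarrow> b \<in> B \<Longrightarrow> lex4 (key a b) t' \<Longrightarrow> lex4 (key a b) t"
  shows "invar t' D"
  using assms unfolding invar_def by blast

lemma greedy_loop:
  assumes s: "base c d s" and m: "vars s ''m'' = m" "m < N1" and D: "rel ''D'' s = {(\<one>, \<one>\<^bsub>G2\<^esub>)}"
  shows "greedy_inv (rel ''D'' (den greedy_loop s))"
    "\<And>a b. a \<in> A \<Longrightarrow> b \<in> B \<Longrightarrow> feasible (rel ''D'' (den greedy_loop s)) a b \<Longrightarrow> a = \<one> \<and> b = \<one>\<^bsub>G2\<^esub>"
proof -
  note bb = s[unfolded base_def inp_def]
  have AN: "a < N1" if "a \<in> A" for a using A_sub[OF that] carrier by blast
  have BN: "b < N2" if "b \<in> B" for b using B_sub[OF that] carrier by blast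
  have "invar (N1, 0, 0, 0) (rel ''D'' (den greedy_loop s))"
    unfolding greedy_loop_def
  proof (rule for_induct[where I = "\<lambda>i s'. invar (i, 0, 0, 0) (rel ''D'' s')"], goal_cases)
    case 5
    then show ?case using greedy_inv_init unfolding rel_assign D invar_def lex4_def by auto
  next
    case (6 i s1)
    note s1 = 6
    have "invar (i, N2, 0, 0) (rel ''D'' (den (For ''j'' ''n2'' (For ''a'' ''n1'' (For ''b'' ''n2'' greedy_step))) s1))"
    proof (rule for_induct[where I = "\<lambda>j s'. invar (i, j, 0, 0) (rel ''D'' s')"], goal_cases)
      case 5
      then show ?case using s1(2) by simp
    next
      case (6 j s2)
      note s2 = 6
      have "invar (i, j, N1, 0) (rel ''D'' (den (For ''a'' ''n1'' (For ''b'' ''n2'' greedy_step)) s2))"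
      proof (rule for_induct[where I = "\<lambda>a s'. invar (i, j, a, 0) (rel ''D'' s')"], goal_cases)
        case 5
        then show ?case using s2(2) by simp
      next
        case (6 a s3)
        note s3 = 6
        have "invar (i, j, a, N2) (rel ''D'' (den (For ''b'' ''n2'' greedy_step) s3))"
        proof (rule for_induct[where I = "\<lambda>b s'. invar (i, j, a, b) (rel ''D'' s')"], goal_cases)
          case 5
          then show ?case using s3(2) by simp
        next
          case (6 b s4)
          have v: "vars s4 ''i'' = i" "vars s4 ''j'' = j" "vars s4 ''a'' = a" "vars s4 ''b'' = b" "vars s4 ''m'' = m"
            "base c d s4"
            using 6 s3 s2 s1 bb m unfolding base_def inp_def by simp_all
          have "rel ''D'' (den greedy_step s4) = (if candidate c d (Suc m) (rel ''D'' s4) i j a b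
              then cl (insert (a, b) (rel ''D'' s4)) else rel ''D'' s4)"
            using greedy_step[OF v(6) _ v(3,4) s3(1) 6(1)] v m by simp
          then show ?case using invar_step[OF 6(2) s3(1) 6(1)] by simp
        qed (use s1 s2 s3 bb in auto)
        then show ?case
          unfolding rel_assign by (rule invar_mono) (use BN in \<open>auto simp: key_def lex4_def less_Suc_eq\<close>)
      qed (use s1 s2 bb in auto)
      then show ?case
        unfolding rel_assign by (rule invar_mono) (use AN in \<open>auto simp: key_def lex4_def less_Suc_eq\<close>)
    qed (use s1 bb in auto)
    then show ?case
      unfolding rel_assign
    \<comment> \<open>The range of \<open>Z a b\<close> contains the identity, so the second key
      component is below \<open>N2\<close> and all keys with first component \<open>i\<close> have
      been passed.\<close>
    proof (rule invar_mono)
      fix a b assume "a \<in> A" "b \<in> B" "lex4 (key a b) (Suc i, 0, 0, 0)"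
      then show "lex4 (key a b) (i, N2, 0, 0)"
        using Z_card(3)[of a b] Z_card(4)[of a b] by (auto simp: key_def lex4_def less_Suc_eq)
    qed
  qed (use bb in auto)
  then have I: "invar (N1, 0, 0, 0) (rel ''D'' (den greedy_loop s))" .
  then show "greedy_inv (rel ''D'' (den greedy_loop s))" unfolding invar_def by blast
  fix a b assume ab: "a \<in> A" "b \<in> B" "feasible (rel ''D'' (den greedy_loop s)) a b"
  \<comment> \<open>Domains are nonempty as well, so every key precedes the final position.\<close>
  have "lex4 (key a b) (N1, 0, 0, 0)"
    using Z_card(1,2)[OF ab(1,2)] unfolding key_def lex4_def by auto
  then show "a = \<one> \<and> b = \<one>\<^bsub>G2\<^esub>" using I ab unfolding invar_def by blast
qed

end

section \<open>Reading off and verifying the map\<close>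

definition readoff :: lp where
  "readoff = For ''g'' ''n1'' (
     Sto ''map'' (Var ''g'') (Num 0) (Var ''e2'') ;;
     For ''h'' ''n2'' (Cond (Eq (Elem ''D'' (Var ''g'') (Var ''h'')) (Num 1))
       (Sto ''map'' (Var ''g'') (Num 0) (Var ''h'')) Nop))"

text \<open>
  The candidate map is verified by brute force, so a positive answer is always correct; the structure
  theory is needed only to show that some choice of \<open>m\<close>, \<open>c\<close>, \<open>d\<close> succeeds.
\<close>

definition check_hom :: lp where
  "check_hom = For ''g'' ''n1'' (For ''h'' ''n1'' (
     Cond (Eq (Elem ''map'' (T1 (Var ''g'') (Var ''h'')) (Num 0))
              (T2 (Elem ''map'' (Var ''g'') (Num 0)) (Elem ''map'' (Var ''h'') (Num 0))))
       Nop (Asg ''ok'' (Num 0))))"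

definition check_surj :: lp where
  "check_surj = For ''h'' ''n2'' (
     Asg ''p'' (Num 0) ;;
     For ''g'' ''n1'' (Cond (Eq (Elem ''map'' (Var ''g'') (Num 0)) (Var ''h'')) (Asg ''p'' (Num 1)) Nop) ;;
     Cond (Eq (Var ''p'') (Num 1)) Nop (Asg ''ok'' (Num 0)))"

definition try_hom :: lp where
  "try_hom = init_pairs ''D'' ;; greedy_loop ;; Sto ''D'' (Var ''c'') (Var ''d'') (Num 1) ;; close ''D'' ;;
     readoff ;; Asg ''ok'' (Num 1) ;; check_hom ;; check_surj ;;
     Cond (Eq (Var ''ok'') (Num 1)) (Asg ''answer'' (Num 1)) Nop"

text \<open>The identity is the only idempotent of a group.\<close>

definition find_one :: "vname \<Rightarrow> vname \<Rightarrow> vname \<Rightarrow> lp" where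
  "find_one T n e = For ''g'' n (Cond (Eq (Elem T (Var ''g'') (Var ''g'')) (Var ''g'')) (Asg e (Var ''g'')) Nop)"

text \<open>The guard on \<open>answer\<close> protects the first verified map from being
  overwritten by later choices.\<close>

definition epi_prog :: lp where
  "epi_prog = find_one ''table1'' ''n1'' ''e1'' ;; find_one ''table2'' ''n2'' ''e2'' ;;
     For ''m'' ''n1'' (For ''c'' ''n1'' (For ''d'' ''n2''
       (Cond (Eq (Var ''answer'') (Num 0)) try_hom Nop)))"

lemma prog_frame [simp]:
  "modv readoff = {''g'', ''h''}" "moda readoff = {''map''}" "well_formed readoff"
  "modv check_hom = {''g'', ''h'', ''ok''}" "moda check_hom = {}" "well_formed check_hom"
  "modv check_surj = {''g'', ''h'', ''ok'', ''p''}" "moda check_surj = {}" "well_formed check_surj"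
  "modv (find_one T n e) = {''g'', e}" "moda (find_one T n e) = {}"
  by (auto simp: readoff_def check_hom_def check_surj_def find_one_def)

lemma try_hom_frame [simp]:
  "modv try_hom = {''i'', ''j'', ''a'', ''b'', ''x'', ''y'', ''t'', ''g'', ''h'', ''u'', ''v'', ''r'', ''q'', ''bad'',
     ''k1'', ''k2'', ''p'', ''o'', ''ok'', ''answer''}"
  "moda try_hom = {''Z'', ''D'', ''map''}" "well_formed try_hom"
  by (auto simp: try_hom_def)

lemma epi_prog_well_formed: "well_formed epi_prog" "{''n1'', ''n2''} \<inter> modv epi_prog = {}"
  by (auto simp: epi_prog_def find_one_def)

lemma output_map_assign [simp]: "output_map (assign x v s) = output_map s"
  by (rule ext) (simp add: output_map_def)

context tables begin

lemma readoff:
  assumes s: "base c d s"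
  shows "\<forall>x<N1. output_map (den readoff s) x < N2 \<and>
    ((\<exists>y. (x, y) \<in> rel ''D'' s) \<longrightarrow> (x, output_map (den readoff s) x) \<in> rel ''D'' s)"
proof -
  note bb = s[unfolded base_def inp_def]
  define P where "P x v J \<longleftrightarrow> v < N2 \<and> ((\<exists>y<J. (x, y) \<in> rel ''D'' s) \<longrightarrow> (x, v) \<in> rel ''D'' s)" for x v J
  have "\<forall>x<N1. P x (output_map (den readoff s) x) N2"
    unfolding readoff_def
  proof (rule for_induct[where I = "\<lambda>i s'. \<forall>x<i. P x (output_map s' x) N2"], goal_cases)
    case (6 x s1)
    note s1 = 6
    let ?s = "store ''map'' x 0 (vars s1 ''e2'') s1"
    let ?q = "For ''h'' ''n2'' (Cond (Eq (Elem ''D'' (Var ''g'') (Var ''h'')) (Num 1))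
       (Sto ''map'' (Var ''g'') (Num 0) (Var ''h'')) Nop)"
    have "(\<forall>x'<x. P x' (output_map (den ?q ?s) x') N2) \<and> P x (output_map (den ?q ?s) x) N2"
    proof (rule for_induct[where I = "\<lambda>j s'. (\<forall>x'<x. P x' (output_map s' x') N2) \<and> P x (output_map s' x) j"], goal_cases)
      case 5
      then show ?case using s1 bb by (auto simp: output_map_def P_def)
    next
      case (6 y s2)
      have v: "vars s2 ''g'' = x" "vars s2 ''h'' = y" "arrs s2 ''D'' = arrs s ''D''"
        using 6(3-5) s1(3-5) by (auto intro!: ext)
      have xy: "x < N1" "y < N2" by (rule s1(1), rule 6(1))
      have eq: "arrs s ''D'' x y = Suc 0 \<longleftrightarrow> (x, y) \<in> rel ''D'' s" by (rule in_rel_iff[OF xy])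
      show ?case
        using 6(2) xy eq by (auto simp: v output_map_def P_def less_Suc_eq)
    qed (use s1 bb in auto)
    then show ?case using s1(3) by (auto simp: less_Suc_eq output_map_def)
  qed (use bb in auto)
  then show ?thesis unfolding P_def using rel_sub by blast
qed

lemma check_hom:
  assumes s: "base c d s" and map: "\<And>x. x < N1 \<Longrightarrow> output_map s x < N2" and ok: "vars s ''ok'' = 1"
  shows "vars (den check_hom s) ''ok'' = of_bool (\<forall>x<N1. \<forall>y<N1. output_map s (x \<otimes> y) = output_map s x \<otimes>\<^bsub>G2\<^esub> output_map s y)"
proof -
  note bb = s[unfolded base_def inp_def]
  define P where "P x y \<longleftrightarrow> output_map s (x \<otimes> y) = output_map s x \<otimes>\<^bsub>G2\<^esub> output_map s y" for x y
  have "vars (den check_hom s) ''ok'' = of_bool (\<forall>x<N1. \<forall>y<N1. P x y)"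
    unfolding check_hom_def
  proof (rule for_induct[where I = "\<lambda>i s'. vars s' ''ok'' = of_bool (\<forall>x<i. \<forall>y<N1. P x y)"], goal_cases)
    case (6 x s1)
    note s1 = 6
    let ?q = "For ''h'' ''n1'' (
     Cond (Eq (Elem ''map'' (T1 (Var ''g'') (Var ''h'')) (Num 0))
              (T2 (Elem ''map'' (Var ''g'') (Num 0)) (Elem ''map'' (Var ''h'') (Num 0))))
       Nop (Asg ''ok'' (Num 0)))"
    have "vars (den ?q s1) ''ok'' = of_bool ((\<forall>x'<x. \<forall>y<N1. P x' y) \<and> (\<forall>y<N1. P x y))"
    proof (rule for_induct[where I = "\<lambda>j s'. vars s' ''ok'' = of_bool ((\<forall>x'<x. \<forall>y<N1. P x' y) \<and> (\<forall>y<j. P x y))"], goal_cases)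
      case (6 y s2)
      have v: "vars s2 ''g'' = x" "vars s2 ''h'' = y" "arrs s2 ''map'' = arrs s ''map''"
        "arrs s2 ''table1'' = cayley_table G1" "arrs s2 ''table2'' = cayley_table G2"
        using 6(3-5) s1(3-5) bb by auto
      have xy: "x < N1" "y < N1" by (rule s1(1), rule 6(1))
      have "bval (Eq (Elem ''map'' (T1 (Var ''g'') (Var ''h'')) (Num 0))
              (T2 (Elem ''map'' (Var ''g'') (Num 0)) (Elem ''map'' (Var ''h'') (Num 0)))) s2 \<longleftrightarrow> P x y"
        using xy map[OF xy(1)] map[OF xy(2)] unfolding P_def output_map_def by (simp add: v cayley_table_def)
      then show ?case using 6(2) by (auto simp: less_Suc_eq simp del: bval_Eq)
    qed (use s1 bb in auto)
    then show ?case by (auto simp: less_Suc_eq)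
  qed (use bb ok in auto)
  then show ?thesis unfolding P_def .
qed

lemma check_surj:
  assumes s: "base c d s" and ok: "vars s ''ok'' = of_bool Q"
  shows "vars (den check_surj s) ''ok'' = of_bool (Q \<and> (\<forall>y<N2. \<exists>x<N1. output_map s x = y))"
proof -
  note bb = s[unfolded base_def inp_def]
  define P where "P y \<longleftrightarrow> (\<exists>x<N1. output_map s x = y)" for y
  have "vars (den check_surj s) ''ok'' = of_bool (Q \<and> (\<forall>y<N2. P y))"
    unfolding check_surj_def
  proof (rule for_induct[where I = "\<lambda>i s'. vars s' ''ok'' = of_bool (Q \<and> (\<forall>y<i. P y))"], goal_cases)
    case (6 y s1)
    note s1 = 6
    let ?q = "For ''g'' ''n1'' (Cond (Eq (Elem ''map'' (Var ''g'') (Num 0)) (Var ''h'')) (Asg ''p'' (Num 1)) Nop)"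
    let ?s = "assign ''p'' 0 s1"
    have p: "vars (den ?q ?s) ''p'' = of_bool (\<exists>x<N1. output_map s x = y)"
    proof (rule for_induct[where I = "\<lambda>i s'. vars s' ''p'' = of_bool (\<exists>x<i. output_map s x = y)"], goal_cases)
      case (6 x s2)
      have v: "vars s2 ''g'' = x" "vars s2 ''h'' = y" "arrs s2 ''map'' = arrs s ''map''"
        using 6(3-5) s1(3-5) by auto
      show ?case using 6(2) by (auto simp: v output_map_def less_Suc_eq)
    qed (use s1 bb in auto)
    have ok: "vars (den ?q ?s) ''ok'' = vars s1 ''ok''" by (subst vars_den) auto
    show ?case using p ok s1(2) unfolding P_def[symmetric] by (auto simp: less_Suc_eq simp del: den.simps(6))
  qed (use bb ok in auto)
  then show ?thesis unfolding P_def .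
qed

lemma epi_iff:
  assumes "\<And>x. x < N1 \<Longrightarrow> f x < N2"
  shows "f \<in> epi G1 G2 \<longleftrightarrow> (\<forall>x<N1. \<forall>y<N1. f (x \<otimes> y) = f x \<otimes>\<^bsub>G2\<^esub> f y) \<and> (\<forall>y<N2. \<exists>x<N1. f x = y)"
proof -
  have C: "carrier G1 = {..<N1}" "carrier G2 = {..<N2}" using carrier by auto
  have "f ` {..<N1} = {..<N2} \<longleftrightarrow> (\<forall>y<N2. \<exists>x<N1. f x = y)"
  proof
    assume "f ` {..<N1} = {..<N2}"
    then have "y \<in> f ` {..<N1}" if "y < N2" for y using that by simp
    then show "\<forall>y<N2. \<exists>x<N1. f x = y" by fastforce
  next
    assume "\<forall>y<N2. \<exists>x<N1. f x = y"
    then show "f ` {..<N1} = {..<N2}" using assms by fastforce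
  qed
  then show ?thesis unfolding epi_def hom_def C using assms by (simp add: Ball_def)
qed

text \<open>The first part is soundness and holds for every choice of \<open>m\<close>,
  \<open>c\<close> and \<open>d\<close>: \<open>readoff\<close> starts each entry at
  \<open>e2\<close>, so its values stay below \<open>N2\<close> and the two checks decide being an
  epimorphism even if \<open>D\<close> is no graph. The second part is completeness for choices
  realised by some epimorphism \<open>f\<close>.\<close>

lemma try_hom:
  assumes s: "base c d s" and m: "vars s ''m'' = m" "m < N1" and ans: "answer s = 0"
  shows "answer (den try_hom s) = of_bool (output_map (den try_hom s) \<in> epi G1 G2)"
    "semidirect_epi G1 A c (Suc m) h G2 f \<Longrightarrow> f c = d \<Longrightarrow> output_map (den try_hom s) \<in> epi G1 G2"
proof -
  have cd: "c < N1" "d < N2" using s unfolding base_def inp_def by auto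
  define s1 where "s1 = den (init_pairs ''D'') s"
  have b1: "base c d s1" unfolding s1_def by (rule base_den[OF s]) auto
  have D1: "rel ''D'' s1 = {(\<one>, \<one>\<^bsub>G2\<^esub>)}" unfolding s1_def by (rule init_pairs[OF s])
  have m1: "vars s1 ''m'' = m" unfolding s1_def using m by (simp add: vars_den)
  define s2 where "s2 = den greedy_loop s1"
  have b2: "base c d s2" unfolding s2_def by (rule base_den[OF b1]) auto
  define s3 where "s3 = store ''D'' c d 1 s2"
  have a3: "arrs s3 X = arrs s2 X" if "X \<noteq> ''D''" for X unfolding s3_def using that by (auto intro!: ext)
  have b3: "base c d s3" using b2 a3[of "''table1''"] a3[of "''table2''"]
    unfolding base_def inp_def by (simp add: s3_def)
  have D3: "rel ''D'' s3 = insert (c, d) (rel ''D'' s2)"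
    unfolding s3_def using cd by (simp add: rel_store)
  define s4 where "s4 = den (close ''D'') s3"
  have b4: "base c d s4" unfolding s4_def by (rule base_den[OF b3]) auto
  have D4: "rel ''D'' s4 = pair_closure G1 G2 c d (insert (c, d) (rel ''D'' s2))"
    unfolding s4_def D3[symmetric] using b3 D3 by (intro close) (auto simp: base_def)
  define s5 where "s5 = den readoff s4"
  have b5: "base c d s5" unfolding s5_def by (rule base_den[OF b4]) auto
  have map5: "\<And>x. x < N1 \<Longrightarrow> output_map s5 x < N2"
    "\<And>x y. x < N1 \<Longrightarrow> (x, y) \<in> rel ''D'' s4 \<Longrightarrow> (x, output_map s5 x) \<in> rel ''D'' s4"
    using readoff[OF b4] unfolding s5_def[symmetric] by blast+
  define s6 where "s6 = assign ''ok'' 1 s5"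
  have b6: "base c d s6" using b5 unfolding s6_def base_def inp_def by simp
  have map6: "output_map s6 = output_map s5" unfolding s6_def output_map_def by simp
  define s7 where "s7 = den check_hom s6"
  have b7: "base c d s7" unfolding s7_def by (rule base_den[OF b6]) auto
  have map7: "output_map s7 = output_map s5"
    unfolding map6[symmetric] s7_def output_map_def by (simp add: arrs_den)
  have ok7: "vars s7 ''ok'' = of_bool (\<forall>x<N1. \<forall>y<N1. output_map s5 (x \<otimes> y) = output_map s5 x \<otimes>\<^bsub>G2\<^esub> output_map s5 y)"
    unfolding s7_def map6[symmetric] by (rule check_hom[OF b6]) (use map5(1) in \<open>simp add: map6\<close>, simp add: s6_def)
  define s8 where "s8 = den check_surj s7"
  have map8: "output_map s8 = output_map s5"
    unfolding map7[symmetric] s8_def output_map_def by (simp add: arrs_den)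
  have epi5: "output_map s5 \<in> epi G1 G2 \<longleftrightarrow>
      (\<forall>x<N1. \<forall>y<N1. output_map s5 (x \<otimes> y) = output_map s5 x \<otimes>\<^bsub>G2\<^esub> output_map s5 y) \<and>
      (\<forall>y<N2. \<exists>x<N1. output_map s5 x = y)"
    by (rule epi_iff) (rule map5(1))
  have ok8: "vars s8 ''ok'' = of_bool (output_map s5 \<in> epi G1 G2)"
    unfolding s8_def check_surj[OF b7 ok7] map7 epi5 ..
  have ans8: "vars s8 ''answer'' = 0"
    using ans unfolding answer_def s8_def s7_def s6_def s5_def s4_def s3_def s2_def s1_def
    by (simp add: vars_den)
  have fin: "den try_hom s = (if output_map s5 \<in> epi G1 G2 then assign ''answer'' 1 s8 else s8)"
    using ok8 b2 unfolding try_hom_def base_def inp_def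
    by (simp add: s1_def[symmetric] s2_def[symmetric] s3_def[symmetric, simplified] s4_def[symmetric] s5_def[symmetric]
        s6_def[symmetric, simplified] s7_def[symmetric] s8_def[symmetric])
  have map9: "output_map (den try_hom s) = output_map s5"
    unfolding fin using map8 by simp
  show "answer (den try_hom s) = of_bool (output_map (den try_hom s) \<in> epi G1 G2)"
    unfolding map9 using ans8 by (simp add: fin answer_def)
  assume sd: "semidirect_epi G1 A c (Suc m) h G2 f" and fc: "f c = d"
  interpret E: semidirect_epi G1 A c "Suc m" h G2 f by (rule sd)
  interpret T: tables_epi G1 G2 A c m h f by unfold_locales
  have d: "E.d = d" using fc by (simp add: E.d_def)
  note gr = T.greedy_loop[unfolded d, OF b1 m1 m(2) D1, folded s2_def]
  obtain g where g: "g \<in> epi G1 G2" "pair_closure G1 G2 c d (insert (c, d) (rel ''D'' s2)) = {(x, g x) |x. x \<in> carrier G1}"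
    using E.greedy_inv_end[unfolded d, OF gr] by blast
  \<comment> \<open>The final relation is the graph of \<open>g\<close>, so \<open>readoff\<close>
    finds exactly one entry in every row.\<close>
  have eq: "output_map s5 x = g x" if "x < N1" for x
  proof -
    have "(x, g x) \<in> rel ''D'' s4" unfolding D4 g(2) using that carrier by auto
    then show ?thesis using map5(2)[OF that] unfolding D4 g(2) by blast
  qed
  have glt: "g x < N2" if "x < N1" for x using map5(1)[OF that] eq[OF that] by simp
  have "output_map s5 \<in> epi G1 G2"
    using g(1) eq unfolding epi5 epi_iff[of g, OF glt, simplified] by simp metis
  then show "output_map (den try_hom s) \<in> epi G1 G2" unfolding map9 .
qed

end

section \<open>Search over the triples \<open>m\<close>, \<open>c\<close>, \<open>d\<close>\<close>

context tables begin

definition loaded :: "state \<Rightarrow> bool" where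
  "loaded s \<longleftrightarrow> vars s ''n1'' = N1 \<and> vars s ''n2'' = N2 \<and>
     arrs s ''table1'' = cayley_table G1 \<and> arrs s ''table2'' = cayley_table G2 \<and>
     vars s ''e1'' = \<one> \<and> vars s ''e2'' = \<one>\<^bsub>G2\<^esub>"

definition good :: "nat \<Rightarrow> nat \<Rightarrow> nat \<Rightarrow> bool" where
  "good m c d \<longleftrightarrow> (\<exists>A h f. semidirect_epi G1 A c (Suc m) h G2 f \<and> f c = d)"

lemma find_one:
  assumes "group G" "carrier G = {0..<Coset.order G}" "arrs s T = cayley_table G" "vars s n = Coset.order G" "n \<noteq> e"
    "n \<noteq> ''g''" "e \<noteq> ''g''"
  shows "vars (den (find_one T n e) s) e = \<one>\<^bsub>G\<^esub>"
proof -
  interpret group G by (rule assms(1))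
  have c: "x \<in> carrier G \<longleftrightarrow> x < Coset.order G" for x using assms(2) by auto
  have "\<one>\<^bsub>G\<^esub> < Coset.order G \<longrightarrow> vars (den (find_one T n e) s) e = \<one>\<^bsub>G\<^esub>"
    unfolding find_one_def
  proof (rule for_induct[where I = "\<lambda>i s'. \<one>\<^bsub>G\<^esub> < i \<longrightarrow> vars s' e = \<one>\<^bsub>G\<^esub>"], goal_cases)
    case (6 x s')
    have "x \<otimes>\<^bsub>G\<^esub> x = x \<longleftrightarrow> x = \<one>\<^bsub>G\<^esub>" using 6(1) c l_cancel_one[of x x] by simp
    moreover have "arrs s' T = cayley_table G" using 6(5) assms(3) by simp
    ultimately show ?case using 6(1,2,3) assms(7) by (auto simp: cayley_table_def less_Suc_eq)
  qed (use assms in auto)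
  then show ?thesis using one_closed c by blast
qed

lemma epi_prog:
  assumes init: "s = input_state G1 G2"
  shows "answer (den epi_prog s) = 1 \<longrightarrow> output_map (den epi_prog s) \<in> epi G1 G2" "answer (den epi_prog s) \<in> {0, 1}"
    "m < N1 \<Longrightarrow> c < N1 \<Longrightarrow> d < N2 \<Longrightarrow> good m c d \<Longrightarrow> answer (den epi_prog s) = 1"
proof -
  \<comment> \<open>\<open>P\<close> describes the triples tried so far; a realisable one among them
    must already have produced an answer.\<close>
  define I where "I P s' \<longleftrightarrow> (answer s' = 1 \<longrightarrow> output_map s' \<in> epi G1 G2) \<and> answer s' \<in> {0, 1} \<and>
    (\<forall>m<N1. \<forall>c<N1. \<forall>d<N2. P m c d \<and> good m c d \<longrightarrow> answer s' = 1)" for P :: "nat \<Rightarrow> nat \<Rightarrow> nat \<Rightarrow> bool" and s'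
  have I_assign: "I P (assign x v s') = I P s'" if "x \<noteq> ''answer''" for P x v s'
    unfolding I_def answer_def using that by simp
  have I_mono: "I P s' \<Longrightarrow> (\<And>m c d. m < N1 \<Longrightarrow> c < N1 \<Longrightarrow> d < N2 \<Longrightarrow> Q m c d \<Longrightarrow> P m c d) \<Longrightarrow> I Q s'" for P Q s'
    unfolding I_def by blast
  define s0 where "s0 = den (find_one ''table2'' ''n2'' ''e2'') (den (find_one ''table1'' ''n1'' ''e1'') s)"
  have tabs: "carrier G1 = {0..<N1}" "carrier G2 = {0..<N2}" using table1 table2 by (simp_all add: table_group_def)
  have in0: "vars s ''n1'' = N1" "vars s ''n2'' = N2" "arrs s ''table1'' = cayley_table G1" "arrs s ''table2'' = cayley_table G2"
    "vars s ''answer'' = 0"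
    unfolding init input_state_def by simp_all
  have "vars (den (find_one ''table1'' ''n1'' ''e1'') s) ''e1'' = \<one>"
    by (rule find_one[OF G1.is_group tabs(1)]) (simp_all add: in0)
  moreover have "vars s0 ''e2'' = \<one>\<^bsub>G2\<^esub>"
    unfolding s0_def by (rule find_one[OF G2.is_group tabs(2)]) (simp_all add: in0 vars_den arrs_den)
  ultimately have s0: "loaded s0" "answer s0 = 0"
    using in0 unfolding loaded_def s0_def answer_def by (simp_all add: vars_den arrs_den)
  let ?cond = "Cond (Eq (Var ''answer'') (Num 0)) try_hom Nop"
  have "I (\<lambda>m' c' d'. m' < N1) (den (For ''m'' ''n1'' (For ''c'' ''n1'' (For ''d'' ''n2'' ?cond))) s0)"
  proof (rule for_induct[where I = "\<lambda>m. I (\<lambda>m' c' d'. m' < m)"], goal_cases)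
    case 5
    then show ?case using s0(2) by (simp add: I_assign) (simp add: I_def)
  next
    case (6 m s1)
    note s1 = 6
    have "I (\<lambda>m' c' d'. m' < m \<or> m' = m \<and> c' < N1) (den (For ''c'' ''n1'' (For ''d'' ''n2'' ?cond)) s1)"
    proof (rule for_induct[where I = "\<lambda>c. I (\<lambda>m' c' d'. m' < m \<or> m' = m \<and> c' < c)"], goal_cases)
      case 5
      then show ?case using s1(2) by (simp add: I_assign)
    next
      case (6 c s2)
      note s2 = 6
      have "I (\<lambda>m' c' d'. m' < m \<or> m' = m \<and> (c' < c \<or> c' = c \<and> d' < N2)) (den (For ''d'' ''n2'' ?cond) s2)"
      proof (rule for_induct[where I = "\<lambda>d. I (\<lambda>m' c' d'. m' < m \<or> m' = m \<and> (c' < c \<or> c' = c \<and> d' < d))"], goal_cases)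
        case 5
        then show ?case using s2(2) by (simp add: I_assign)
      next
        case (6 d s3)
        have b3: "base c d s3" and m3: "vars s3 ''m'' = m"
          using 6 s1 s2 s0(1) unfolding base_def inp_def loaded_def by simp_all
        have "I (\<lambda>m' c' d'. m' < m \<or> m' = m \<and> (c' < c \<or> c' = c \<and> d' < Suc d)) (den ?cond s3)"
        proof (cases "answer s3 = 0")
          case True
          then have den: "den ?cond s3 = den try_hom s3" by (simp add: answer_def)
          note try_hom = try_hom[OF b3 m3 s1(1) True]
          have ans: "answer (den try_hom s3) = 1" if g: "good m c d"
          proof -
            obtain A h f where "semidirect_epi G1 A c (Suc m) h G2 f" "f c = d" using g unfolding good_def by blast
            then have "output_map (den try_hom s3) \<in> epi G1 G2" by (rule try_hom(2))
            then show ?thesis using try_hom(1) by simp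
          qed
          \<comment> \<open>An answer still equal to 0 rules out all earlier triples, so only the
            current one needs attention.\<close>
          have none: "\<not> good m' c' d'"
            if "m' < N1" "c' < N1" "d' < N2" "m' < m \<or> m' = m \<and> (c' < c \<or> c' = c \<and> d' < d)" for m' c' d'
          proof
            assume "good m' c' d'"
            then have "answer s3 = 1" using 6(2) that unfolding I_def by blast
            then show False using True by simp
          qed
          show ?thesis
            unfolding den I_def
          proof (intro conjI allI impI)
            show "answer (den try_hom s3) \<in> {0, 1}" using try_hom(1) by simp
            show "output_map (den try_hom s3) \<in> epi G1 G2" if "answer (den try_hom s3) = 1"
              using that try_hom(1) by (cases "output_map (den try_hom s3) \<in> epi G1 G2") auto
          next
            fix m' c' d'
            assume m': "m' < N1" "c' < N1" "d' < N2"
              and *: "(m' < m \<or> m' = m \<and> (c' < c \<or> c' = c \<and> d' < Suc d)) \<and> good m' c' d'"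
            then have "m' = m \<and> c' = c \<and> d' = d" using none[OF m'] by (auto simp: less_Suc_eq)
            then show "answer (den try_hom s3) = 1" using * ans by blast
          qed
        next
          case False
          then have "den ?cond s3 = s3" by (simp add: answer_def)
          moreover have "answer s3 = 1" using False 6(2) unfolding I_def by auto
          ultimately show ?thesis using 6(2) unfolding I_def by simp
        qed
        then show ?case by (simp add: I_assign)
      qed (use s1 s2 s0 in \<open>auto simp: loaded_def\<close>)
      then have "I (\<lambda>m' c' d'. m' < m \<or> m' = m \<and> c' < Suc c) (den (For ''d'' ''n2'' ?cond) s2)"
        by (rule I_mono) (auto simp: less_Suc_eq)
      then show ?case by (simp add: I_assign)
    qed (use s1 s0 in \<open>auto simp: loaded_def\<close>)
    then have "I (\<lambda>m' c' d'. m' < Suc m) (den (For ''c'' ''n1'' (For ''d'' ''n2'' ?cond)) s1)"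
      by (rule I_mono) (auto simp: less_Suc_eq)
    then show ?case by (simp add: I_assign)
  qed (use s0 in \<open>auto simp: loaded_def\<close>)
  moreover have "den epi_prog s = den (For ''m'' ''n1'' (For ''c'' ''n1'' (For ''d'' ''n2'' ?cond))) s0"
    unfolding epi_prog_def s0_def by (simp only: den.simps(4))
  ultimately have "I (\<lambda>m' c' d'. m' < N1) (den epi_prog s)" by simp
  then show "answer (den epi_prog s) = 1 \<longrightarrow> output_map (den epi_prog s) \<in> epi G1 G2" "answer (den epi_prog s) \<in> {0, 1}"
    "m < N1 \<Longrightarrow> c < N1 \<Longrightarrow> d < N2 \<Longrightarrow> good m c d \<Longrightarrow> answer (den epi_prog s) = 1"
    unfolding I_def by blast+
qed

end

text \<open>The orders of the kernel and of the complement serve as exponents, by Lagrange's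
  theorem; \<open>c\<close> is a generator of the cyclic complement.\<close>

lemma Coprime_Ab_Cyc_semidirect:
  fixes G (structure)
  assumes "G \<in> Coprime Ab Cyc"
  shows "\<exists>A c h. semidirect G A c (card A) h \<and> A \<subseteq> carrier G"
proof -
  obtain A H where G: "group G" "finite (carrier G)" and A: "A \<lhd> G" "G\<lparr>carrier := A\<rparr> \<in> Ab"
    and H: "subgroup H G" "G\<lparr>carrier := H\<rparr> \<in> Cyc" and AH: "A <#>\<^bsub>G\<^esub> H = carrier G" "A \<inter> H = {\<one>\<^bsub>G\<^esub>}"
    and cop: "gcd (card A) (card H) = 1"
    using assms unfolding Coprime_def mem_Collect_eq by (elim conjE exE) (rule that)
  interpret group G by (rule G(1))
  interpret H: group "G\<lparr>carrier := H\<rparr>" by (rule subgroup.subgroup_is_group[OF H(1) G(1)])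
  interpret A: normal A G by (rule A(1))
  interpret A': group "G\<lparr>carrier := A\<rparr>" by (rule A.subgroup_is_group[OF G(1)])
  have Hfin: "finite H" using G(2) subgroup.subset[OF H(1)] finite_subset by blast
  have Afin: "finite A" using G(2) A.subset finite_subset by blast
  have "cyclic_group (G\<lparr>carrier := H\<rparr>)" using H(2) unfolding Cyc_def by blast
  then obtain c where c: "c \<in> H" "H = range (\<lambda>n::int. c [^]\<^bsub>G\<lparr>carrier := H\<rparr>\<^esub> n)"
    using H.cyclic_group by auto
  have cG: "c \<in> carrier G" using c(1) subgroup.subset[OF H(1)] by blast
  have hpos: "card H > 0" using c(1) Hfin by (auto simp: card_gt_0_iff)
  have pc: "c [^] card H = \<one>"
    using H.pow_order_eq_1[of c] c(1) by (simp add: Coset.order_def nat_pow_consistent[symmetric])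
  have "semidirect G A c (card A) (card H)"
  proof (rule semidirect.intro)
    show "A \<lhd> G" by (rule A(1))
    show "finite (carrier G)" by (rule G(2))
    show "comm_group (G\<lparr>carrier := A\<rparr>)" using A(2) unfolding Ab_def by blast
    show "c \<in> carrier G" by (rule cG)
    show "c [^] card H = \<one>" by (rule pc)
    show "coprime (card A) (card H)" using cop by (rule gcd_eq_1_imp_coprime)
    have "A \<noteq> {}" using A.one_closed by blast
    then show "card A > 0" using Afin by (simp add: card_gt_0_iff)
    show "u [^] card A = \<one>" if "u \<in> A" for u
      using A'.pow_order_eq_1[of u] that by (simp add: Coset.order_def nat_pow_consistent[symmetric])
    show "c [^] n = \<one>" if "c [^] n \<in> A" for n :: nat
    proof -
      have "c [^] n \<in> H" using H.nat_pow_closed[of c n] c(1) by (simp add: nat_pow_consistent[symmetric])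
      then show ?thesis using that AH(2) by blast
    qed
    show "\<exists>u\<in>A. \<exists>n::nat. x = u \<otimes> c [^] n" if x: "x \<in> carrier G" for x
    proof -
      obtain u v where uv: "u \<in> A" "v \<in> H" "x = u \<otimes> v" using x unfolding AH(1)[symmetric] set_mult_def by blast
      have "v \<in> range (\<lambda>n::int. c [^]\<^bsub>G\<lparr>carrier := H\<rparr>\<^esub> n)" using uv(2) by (simp only: c(2)[symmetric])
      then obtain n :: int where "v = c [^]\<^bsub>G\<lparr>carrier := H\<rparr>\<^esub> n" by blast
      then have "v = c [^] n" using int_pow_consistent[OF H(1) c(1)] by simp
      \<comment> \<open>Cyclicity speaks of integer powers; \<open>c [^] card H = \<one>\<close>
        turns them into natural ones.\<close>
      then have "v = c [^] nat (n mod int (card H))" using pow_mod_eq(2)[OF cG pc hpos] by simp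
      then show ?thesis using uv by blast
    qed
  qed
  then show ?thesis using A.subset by blast
qed

theorem theorem1:
  shows "\<exists>(prog::com) (a::nat) (k::nat). \<forall>(G1::nat monoid) (G2::nat monoid).
    table_group G1 \<and> table_group G2 \<and> G1 \<in> Coprime Ab Cyc \<longrightarrow>
    (\<exists>t s. exec prog (input_state G1 G2) t s \<and>
       t \<le> a * (order G1 + order G2) ^ k \<and>
       answer s = (if epi G1 G2 \<noteq> {} then 1 else 0) \<and>
       (epi G1 G2 \<noteq> {} \<longrightarrow> output_map s \<in> epi G1 G2))"
proof -
  obtain K k where time: "\<And>s. \<exists>t. exec (compile epi_prog) s t (den epi_prog s) \<and>
      t \<le> K * (vars s ''n1'' + vars s ''n2'' + 1) ^ k"
    using exec_lp[OF epi_prog_well_formed] by blast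
  show ?thesis
  \<comment> \<open>The factor \<open>2 ^ k\<close> absorbs the summand 1 in the base:
    \<open>G1\<close> is nonempty, hence \<open>N1 + N2 + 1 \<le> 2 * (N1 + N2)\<close>.\<close>
  proof (rule exI[of _ "compile epi_prog"], rule exI[of _ "K * 2 ^ k"], rule exI[of _ k], intro allI impI)
    fix G1 G2 :: "nat monoid"
    assume asm: "table_group G1 \<and> table_group G2 \<and> G1 \<in> Coprime Ab Cyc"
    then interpret tables G1 G2 by unfold_locales auto
    let ?s = "input_state G1 G2"
    obtain t where t: "exec (compile epi_prog) ?s t (den epi_prog ?s)" "t \<le> K * (N1 + N2 + 1) ^ k"
      using time[of ?s] by (auto simp: input_state_def)
    have "N1 \<noteq> 0" using one_less(1) by (metis not_less_zero)
    then have "N1 + N2 + 1 \<le> 2 * (N1 + N2)" by simp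
    then have "(N1 + N2 + 1) ^ k \<le> (2 * (N1 + N2)) ^ k" by (rule power_mono) simp
    then have "(N1 + N2 + 1) ^ k \<le> 2 ^ k * (N1 + N2) ^ k" by (simp only: power_mult_distrib)
    then have "K * (N1 + N2 + 1) ^ k \<le> K * (2 ^ k * (N1 + N2) ^ k)" by (rule mult_le_mono2)
    then have time': "t \<le> K * 2 ^ k * (N1 + N2) ^ k" unfolding mult.assoc by (rule le_trans[OF t(2)])
    have ans: "answer (den epi_prog ?s) = 1" if "epi G1 G2 \<noteq> {}"
    proof -
      obtain f where f: "f \<in> epi G1 G2" using \<open>epi G1 G2 \<noteq> {}\<close> by blast
      obtain A c h where sd: "semidirect G1 A c (card A) h" "A \<subseteq> carrier G1"
        using Coprime_Ab_Cyc_semidirect asm by blast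
      interpret semidirect G1 A c "card A" h by (rule sd(1))
      \<comment> \<open>The program tests the exponent \<open>m + 1\<close>, so the right choice is
        \<open>m = card A - 1\<close>, which the loop reaches because
        \<open>card A \<le> N1\<close>.\<close>
      have cA: "Suc (card A - 1) = card A" using m_pos by simp
      have "semidirect_epi G1 A c (Suc (card A - 1)) h G2 f"
        unfolding cA using f sd(1) G2.is_group by (simp add: semidirect_epi_def semidirect_epi_axioms_def)
      then have "good (card A - 1) c (f c)" unfolding good_def by blast
      moreover have "card A \<le> N1" using card_mono[OF fin1 sd(2)] by (simp add: Coset.order_def)
      then have "card A - 1 < N1" using m_pos by linarith
      moreover have "c < N1" using c carrier by blast
      moreover have "f c < N2" using f c carrier unfolding epi_def hom_def by auto
      ultimately show ?thesis using epi_prog(3)[OF refl] by blast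
    qed
    have "answer (den epi_prog ?s) = (if epi G1 G2 \<noteq> {} then 1 else 0)"
      using ans epi_prog(1,2)[OF refl] by (cases "epi G1 G2 = {}") auto
    moreover have "epi G1 G2 \<noteq> {} \<longrightarrow> output_map (den epi_prog ?s) \<in> epi G1 G2"
      using ans epi_prog(1)[OF refl] by blast
    ultimately show "\<exists>t s. exec (compile epi_prog) ?s t s \<and> t \<le> K * 2 ^ k * (order G1 + order G2) ^ k \<and>
        answer s = (if epi G1 G2 \<noteq> {} then 1 else 0) \<and> (epi G1 G2 \<noteq> {} \<longrightarrow> output_map s \<in> epi G1 G2)"
      using t(1) time' by blast
  qed
qed

end
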